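(* Let $\mathcal{A}=\mathcal{A}(\mathbf{x},B)$ be a cluster algebra such that either $\mathcal{A}$ is of finite mutation type or its initial exchange matrix $B$ is an indecomposable bipartite matrix. Then $\mathcal{A}$ is automorphism-finite if and only if $\mathcal{A}$ is of finite type.
   Context: **Labeled seeds.** Let $\mathcal{F}$ be a field isomorphic to the field of rational functions in $n$ variables over $\mathbb{Q}$, and $[1,n]=\{1,\dots,n\}$. A labeled seed (of rank $n$) is a pair $(\mathbf{x},B)$ with $\mathbf{x}=(x_1,\dots,x_n)$ an $n$-tuple of free generators of $\mathcal{F}$ and $B=(b_{ij})$ an $n\times n$ skew-symmetrizable integer matrix (i.e. $DB$ is skew-symmetric for some positive diagonal integer matrix $D$). Standing assumption: $B$ is indecomposable (for any $i,j$ there are $i=i_0,\dots,i_k=j$ with $b_{i_0i_1}\cdots b_{i_{k-1}i_k}\neq0$). With $[a]_+=\max(a,0)$, the mutation $\mu_k(\mathbf{x},B)=(\mathbf{x}',B')$, $k\in[1,n]$, is given by $x'_k=\big(\prod_i x_i^{[b_{ik}]_+}+\prod_i x_i^{[-b_{ik}]_+}\big)/x_k$, $x'_i=x_i$ for $i\ne k$; $b'_{ij}=-b_{ij}$ if $i=k$ or $j=k$, and $b'_{ij}=b_{ij}+\mathrm{sgn}(b_{ik})[b_{ik}b_{kj}]_+$ otherwise. Two labeled seeds are mutation equivalent if they are related by a finite sequence of mutations. An (unlabeled) seed is a class of labeled seeds up to simultaneous relabeling of $\mathbf{x}$ and of the rows and columns of $B$. The cluster algebra $\mathcal{A}(\mathbf{x},B)$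 (trivial coefficients) is the $\mathbb{Z}$-subalgebra of $\mathcal{F}$ generated by all entries (cluster variables) of the tuples in labeled seeds mutation equivalent to $(\mathbf{x},B)$; the seeds of $\mathcal{A}$ are those represented by such labeled seeds, and the set of cluster variables of a seed is a cluster. **Types.** $\mathcal{A}$ is of finite type if it has finitely many cluster variables. $\mathcal{A}$ is of finite mutation type if the set of exchange matrices occurring in labeled seeds mutation equivalent to $(\mathbf{x},B)$ is finite. $B$ is bipartite if there is a function $\varepsilon:[1,n]\to\{-1,1\}$ such that $\varepsilon(i)=1$ and $\varepsilon(j)=-1$ whenever $b_{ij}>0$. **Cluster automorphisms.** A $\mathbb{Z}$-algebra automorphism $f$ of $\mathcal{A}$ is a cluster automorphism if there is a seed $(\mathbf{x}',B')$ of $\mathcal{A}$ such that (1) $f(\mathbf{x}')$ is a cluster, and (2) $f(\mu_{x,\mathbf{x}'}(x))=\mu_{f(x),f(\mathbf{x}')}(f(x))$ for every $x\in\mathbf{x}'$, where $\mu_{x,\mathbf{x}'}(x)$ is the new cluster variable obtained by mutating the seed with cluster $\mathbf{x}'$ at $x$ (a seed is determined by its cluster). These form a group $\mathrm{Aut}(\mathcal{A})$. $\mathcal{A}$ is automorphism-finite if $\mathrm{Aut}(\mathcal{A})$ is a finite group. *)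

theory Defs
  imports "HOL-Analysis.Finite_Cartesian_Product" "HOL-Library.Poly_Mapping" "HOL-Library.FuncSet"
begin

text \<open>The rank is the cardinality of the finite index type \<open>'n\<close>. The ambient field is a type
  \<open>'a :: field_char_0\<close>; that it is isomorphic to the field of rational functions over \<open>\<rat>\<close> in
  as many variables is enforced by the existence of a tuple of free generators.\<close>

type_synonym ('n, 'a) lseed = "('n \<Rightarrow> 'a) \<times> (int ^ 'n ^ 'n)"

subsection \<open>Free generators\<close>

definition mpoly_eval :: "(('n::finite \<Rightarrow>\<^sub>0 nat) \<Rightarrow>\<^sub>0 rat) \<Rightarrow> ('n \<Rightarrow> 'a::field_char_0) \<Rightarrow> 'a" where
  "mpoly_eval p x = (\<Sum>m\<in>Poly_Mapping.keys p.
     of_rat (Poly_Mapping.lookup p m) * (\<Prod>i\<in>UNIV. x i ^ Poly_Mapping.lookup m i))"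

definition algebraically_independent :: "('n::finite \<Rightarrow> 'a::field_char_0) \<Rightarrow> bool" where
  "algebraically_independent x \<longleftrightarrow> (\<forall>p. mpoly_eval p x = 0 \<longrightarrow> p = 0)"

definition is_subring :: "'a::ring_1 set \<Rightarrow> bool" where
  "is_subring S \<longleftrightarrow> 1 \<in> S \<and> (\<forall>a\<in>S. \<forall>b\<in>S. a - b \<in> S \<and> a * b \<in> S)"

definition is_subfield :: "'a::field set \<Rightarrow> bool" where
  "is_subfield S \<longleftrightarrow> is_subring S \<and> (\<forall>a\<in>S. inverse a \<in> S)"

definition free_generators :: "('n::finite \<Rightarrow> 'a::field_char_0) \<Rightarrow> bool" where
  "free_generators x \<longleftrightarrow> algebraically_independent x \<and> is_subfield hull (range x) = UNIV"

subsection \<open>Labeled seeds and mutation\<close>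

definition skew_symmetrizable :: "int ^ 'n ^ 'n \<Rightarrow> bool" where
  "skew_symmetrizable B \<longleftrightarrow>
     (\<exists>d :: 'n \<Rightarrow> int. (\<forall>i. d i > 0) \<and> (\<forall>i j. d i * B $ i $ j = - (d j * B $ j $ i)))"

definition indecomposable :: "int ^ 'n ^ 'n \<Rightarrow> bool" where
  "indecomposable B \<longleftrightarrow> (\<forall>i j. (i, j) \<in> {(p, q). B $ p $ q \<noteq> 0}\<^sup>*)"

definition bipartite :: "int ^ 'n ^ 'n \<Rightarrow> bool" where
  "bipartite B \<longleftrightarrow> (\<exists>\<epsilon> :: 'n \<Rightarrow> int. range \<epsilon> \<subseteq> {-1, 1} \<and>
     (\<forall>i j. B $ i $ j > 0 \<longrightarrow> \<epsilon> i = 1 \<and> \<epsilon> j = -1))"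

definition labeled_seed :: "('n::finite \<Rightarrow> 'a::field_char_0) \<Rightarrow> int ^ 'n ^ 'n \<Rightarrow> bool" where
  "labeled_seed x B \<longleftrightarrow> free_generators x \<and> skew_symmetrizable B"

definition pos_part :: "int \<Rightarrow> int" where
  "pos_part a = max a 0"

definition mutated_variable ::
    "'n \<Rightarrow> ('n::finite \<Rightarrow> 'a::field_char_0) \<Rightarrow> int ^ 'n ^ 'n \<Rightarrow> 'a" where
  "mutated_variable k x B =
     ((\<Prod>i\<in>UNIV. x i ^ nat (pos_part (B $ i $ k))) +
      (\<Prod>i\<in>UNIV. x i ^ nat (pos_part (- B $ i $ k)))) / x k"

definition matrix_mutation :: "'n \<Rightarrow> int ^ 'n ^ 'n \<Rightarrow> int ^ 'n ^ 'n" where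
  "matrix_mutation k B = (\<chi> i j.
     if i = k \<or> j = k then - B $ i $ j
     else B $ i $ j + sgn (B $ i $ k) * pos_part (B $ i $ k * B $ k $ j))"

definition seed_mutation ::
    "'n \<Rightarrow> ('n::finite, 'a::field_char_0) lseed \<Rightarrow> ('n, 'a) lseed" where
  "seed_mutation k = (\<lambda>(x, B). (x(k := mutated_variable k x B), matrix_mutation k B))"

text \<open>The labeled seeds mutation equivalent to \<open>(x, B)\<close>. They represent the (unlabeled) seeds of the
  cluster algebra. Clusters are sets and do not depend on the labeling, and for the finiteness of
  the set of exchange matrices relabelings do not matter, so they are never quotiented out.\<close>

definition seeds :: "('n::finite \<Rightarrow> 'a::field_char_0) \<Rightarrow> int ^ 'n ^ 'n \<Rightarrow> ('n, 'a) lseed set" where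
  "seeds x B = {s. (\<lambda>s t. \<exists>k. t = seed_mutation k s)\<^sup>*\<^sup>* (x, B) s}"

definition clusters :: "('n::finite \<Rightarrow> 'a::field_char_0) \<Rightarrow> int ^ 'n ^ 'n \<Rightarrow> 'a set set" where
  "clusters x B = {range x' | x' B'. (x', B') \<in> seeds x B}"

definition cluster_variables :: "('n::finite \<Rightarrow> 'a::field_char_0) \<Rightarrow> int ^ 'n ^ 'n \<Rightarrow> 'a set" where
  "cluster_variables x B = \<Union> (clusters x B)"

definition cluster_algebra :: "('n::finite \<Rightarrow> 'a::field_char_0) \<Rightarrow> int ^ 'n ^ 'n \<Rightarrow> 'a set" where
  "cluster_algebra x B = is_subring hull (cluster_variables x B)"

definition finite_type :: "('n::finite \<Rightarrow> 'a::field_char_0) \<Rightarrow> int ^ 'n ^ 'n \<Rightarrow> bool" where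
  "finite_type x B \<longleftrightarrow> finite (cluster_variables x B)"

definition finite_mutation_type :: "('n::finite \<Rightarrow> 'a::field_char_0) \<Rightarrow> int ^ 'n ^ 'n \<Rightarrow> bool" where
  "finite_mutation_type x B \<longleftrightarrow> finite {B'. \<exists>x'. (x', B') \<in> seeds x B}"

subsection \<open>Cluster automorphisms\<close>

text \<open>\<open>cluster_mutation x B C u\<close> is the cluster variable that replaces \<open>u\<close> when the seed with
  cluster \<open>C\<close> is mutated at \<open>u \<in> C\<close>. The description is proper because a seed of the cluster
  algebra is determined, up to relabeling, by its cluster.\<close>

definition cluster_mutation ::
    "('n::finite \<Rightarrow> 'a::field_char_0) \<Rightarrow> int ^ 'n ^ 'n \<Rightarrow> 'a set \<Rightarrow> 'a \<Rightarrow> 'a" where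
  "cluster_mutation x B C u =
     (THE v. \<exists>x' B' k. (x', B') \<in> seeds x B \<and> range x' = C \<and> x' k = u \<and>
        v = mutated_variable k x' B')"

text \<open>Automorphisms of a subring \<open>A\<close> are represented by functions that are \<open>undefined\<close> off \<open>A\<close>,
  so that each automorphism is counted once. Unital ring automorphisms are the same as
  \<open>\<int>\<close>-algebra automorphisms.\<close>

definition ring_automorphisms :: "'a::ring_1 set \<Rightarrow> ('a \<Rightarrow> 'a) set" where
  "ring_automorphisms A = {f \<in> extensional A. bij_betw f A A \<and> f 1 = 1 \<and>
     (\<forall>a\<in>A. \<forall>b\<in>A. f (a + b) = f a + f b \<and> f (a * b) = f a * f b)}"

definition cluster_automorphisms ::
    "('n::finite \<Rightarrow> 'a::field_char_0) \<Rightarrow> int ^ 'n ^ 'n \<Rightarrow> ('a \<Rightarrow> 'a) set" where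
  "cluster_automorphisms x B = {f \<in> ring_automorphisms (cluster_algebra x B).
     \<exists>(x', B') \<in> seeds x B.
       f ` range x' \<in> clusters x B \<and>
       (\<forall>u \<in> range x'. f (cluster_mutation x B (range x') u) =
                        cluster_mutation x B (f ` range x') (f u))}"

definition automorphism_finite :: "('n::finite \<Rightarrow> 'a::field_char_0) \<Rightarrow> int ^ 'n ^ 'n \<Rightarrow> bool" where
  "automorphism_finite x B \<longleftrightarrow> finite (cluster_automorphisms x B)"

end

theory Submission
  imports Defs
begin

text \<open>If there are finitely many cluster variables, there are finitely many labeled clusters, and an
  automorphism is determined by a cluster and its image (\<open>automorphism_finite_if_finite_type\<close>).
  For the converse, automorphisms are produced from repeated exchange matrices. If two labeled seeds
  have the same matrix, the field automorphism that matches their clusters commutes with mutation,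
  hence preserves the cluster algebra and is a cluster automorphism (\<open>ex_cluster_automorphism\<close>). So
  if there are finitely many automorphisms, every matrix occurs in finitely many labeled seeds. When
  there are finitely many matrices, finite type follows by counting.

  When \<open>B\<close> is bipartite, mutating at all sources and then at all sinks leads back to \<open>B\<close>. So finiteness
  of the automorphism group makes this bipartite belt periodic, and it remains to show that a
  periodic belt contains all cluster variables. Let \<open>y\<close> be a cluster variable of a seed with cluster
  \<open>y\<^sub>1, \<dots>, y\<^sub>n\<close>, \<open>y = y\<^sub>k\<close>. The belt variables, as functions of this cluster, have vanishing orders
  along \<open>y\<^sub>k = 0\<close>, which obey the belt recurrence in its tropical form. The logarithms of the values of the
  belt variables at a positive real point obey the logarithmic form of the recurrence. Summing both over
  a period and comparing them by a maximum principle shows that some belt variable \<open>z\<close> vanishes to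
  positive order (\<open>belt_variable_vanishing\<close>). This forces \<open>z = y\<close> (\<open>cluster_variable_vanishing\<close>).

  The last step uses the Laurent phenomenon in its strong form: the upper bound of a seed, formed by the
  functions that are Laurent in the seed and in all its neighbours, does not depend on the seed
  (\<open>upper_bound_mutation\<close>). It applies to the quotient \<open>z / y\<close>, and shows that \<open>y\<close> is a monomial in the
  seed of \<open>z\<close>. This form needs exchange polynomials that are coprime in every seed, which principal
  coefficients guarantee. The Laurent phenomenon also implies that mutation
  of a cluster at one of its elements is independent of the seed that has this cluster
  (\<open>mutated_variable_same_cluster\<close>), on which the definition of cluster automorphisms relies.

  All of this is done with real functions on the positive orthant: there every mutation is a bijection,
  Laurent polynomials are sums of monomial functions, and valuations are growth rates. Algebraic
  independence transfers the results to the field (\<open>cluster_variable_eq_iff\<close>).\<close>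

section \<open>Mutation along paths\<close>

text \<open>Labeled seeds are reached along lists of mutation directions. The clusters along a path make
  sense over every field of characteristic 0. This is essential: the same path is also followed
  from positive real numbers, where no denominator vanishes.\<close>

definition cluster_step :: "'n \<Rightarrow> int ^ 'n ^ 'n \<Rightarrow> ('n::finite \<Rightarrow> 'a::field_char_0) \<Rightarrow> 'n \<Rightarrow> 'a" where
  "cluster_step k B x = x(k := mutated_variable k x B)"

fun cluster_along :: "'n list \<Rightarrow> int ^ 'n ^ 'n \<Rightarrow> ('n::finite \<Rightarrow> 'a::field_char_0) \<Rightarrow> 'n \<Rightarrow> 'a" where
  "cluster_along [] B x = x"
| "cluster_along (k # ks) B x = cluster_along ks (matrix_mutation k B) (cluster_step k B x)"

fun matrix_along :: "'n list \<Rightarrow> int ^ 'n ^ 'n \<Rightarrow> int ^ 'n ^ 'n" where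
  "matrix_along [] B = B"
| "matrix_along (k # ks) B = matrix_along ks (matrix_mutation k B)"

lemma cluster_along_append:
  "cluster_along (ks @ ls) B x = cluster_along ls (matrix_along ks B) (cluster_along ks B x)"
  by (induction ks arbitrary: B x) auto

lemma matrix_along_append: "matrix_along (ks @ ls) B = matrix_along ls (matrix_along ks B)"
  by (induction ks arbitrary: B) auto

lemma seed_along_rtranclp:
  "(\<lambda>s t. \<exists>k. t = seed_mutation k s)\<^sup>*\<^sup>* (x, B) (cluster_along ks B x, matrix_along ks B)"
proof (induction ks arbitrary: x B)
  case (Cons k ks)
  have "(\<lambda>s t. \<exists>k. t = seed_mutation k s) (x, B) (cluster_step k B x, matrix_mutation k B)"
    by (auto simp: seed_mutation_def cluster_step_def)
  then show ?case
    using Cons[where x = "cluster_step k B x" and B = "matrix_mutation k B"]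
    by (simp add: converse_rtranclp_into_rtranclp)
qed simp

lemma seeds_iff:
  "(x', B') \<in> seeds x B \<longleftrightarrow> (\<exists>ks. x' = cluster_along ks B x \<and> B' = matrix_along ks B)"
proof
  assume "(x', B') \<in> seeds x B"
  then have "(\<lambda>s t. \<exists>k. t = seed_mutation k s)\<^sup>*\<^sup>* (x, B) (x', B')"
    by (simp add: seeds_def)
  then show "\<exists>ks. x' = cluster_along ks B x \<and> B' = matrix_along ks B"
  proof (induction "(x', B')" arbitrary: x' B' rule: rtranclp_induct)
    case base
    then show ?case by (auto intro: exI[of _ "[]"])
  next
    case (step s)
    obtain x1 B1 where s: "s = (x1, B1)" by force
    from step(3)[OF s] obtain ks where "x1 = cluster_along ks B x" "B1 = matrix_along ks B" by blast
    moreover from step(2) s obtain k where "(x', B') = seed_mutation k (x1, B1)" by blast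
    ultimately show ?case
      by (intro exI[of _ "ks @ [k]"])
         (simp add: seed_mutation_def cluster_step_def cluster_along_append matrix_along_append)
  qed
qed (auto simp: seeds_def seed_along_rtranclp)

subsection \<open>Skew-symmetrizable matrices\<close>

lemma skew_symmetrizable_diag:
  assumes "skew_symmetrizable B" shows "B $ i $ i = 0"
proof -
  obtain d :: "'a \<Rightarrow> int" where "\<forall>i. d i > 0" "\<forall>i j. d i * B $ i $ j = - (d j * B $ j $ i)"
    using assms by (auto simp: skew_symmetrizable_def)
  then have "d i * B $ i $ i = - (d i * B $ i $ i)" "d i > 0" by blast+
  then show ?thesis by simp
qed

lemma skew_symmetrizable_sgn:
  assumes "skew_symmetrizable B" shows "sgn (B $ j $ i) = - sgn (B $ i $ j)"
proof -
  obtain d :: "'a \<Rightarrow> int" where d: "\<forall>i. d i > 0" "\<forall>i j. d i * B $ i $ j = - (d j * B $ j $ i)"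
    using assms by (auto simp: skew_symmetrizable_def)
  have "sgn (d i * B $ i $ j) = - sgn (d j * B $ j $ i)"
    unfolding d(2)[rule_format, of i j] by (simp add: sgn_if)
  moreover have "sgn (d i) = 1" "sgn (d j) = 1" using d(1) by auto
  ultimately show ?thesis by (simp add: sgn_mult)
qed

lemma skew_symmetrizable_iffs:
  assumes "skew_symmetrizable B"
  shows "B $ j $ i = 0 \<longleftrightarrow> B $ i $ j = 0" "B $ j $ i > 0 \<longleftrightarrow> B $ i $ j < 0"
  using skew_symmetrizable_sgn[OF assms, of j i] by (auto simp: sgn_if split: if_splits)

text \<open>This form of the mutation rule has no sign function and is linear in the \<open>k\<close>-th row, which
  suits linear algebra on the columns.\<close>

lemma matrix_mutation_nth:
  "matrix_mutation k B $ i $ j = (if i = k \<or> j = k then - B $ i $ j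
     else B $ i $ j + pos_part (B $ i $ k) * B $ k $ j + B $ i $ k * pos_part (- B $ k $ j))"
proof -
  have "sgn a * pos_part (a * b) = pos_part a * b + a * pos_part (- b)" for a b :: int
  proof -
    consider "a = 0" | "a > 0" "b \<ge> 0" | "a > 0" "b < 0" | "a < 0" "b \<ge> 0" | "a < 0" "b < 0"
      by linarith
    then show ?thesis
    proof cases
      case 2
      then have "0 \<le> a * b" by simp
      then show ?thesis using 2 by (simp add: pos_part_def)
    next
      case 3
      then have "a * b \<le> 0" by (simp add: mult_le_0_iff)
      then show ?thesis using 3 by (simp add: pos_part_def)
    next
      case 4
      then have "a * b \<le> 0" by (simp add: mult_le_0_iff)
      then show ?thesis using 4 by (simp add: pos_part_def)
    next
      case 5
      then have "0 \<le> a * b" by (simp add: zero_le_mult_iff)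
      then show ?thesis using 5 by (simp add: pos_part_def)
    qed (simp add: pos_part_def)
  qed
  then show ?thesis by (simp add: matrix_mutation_def)
qed

lemma matrix_mutation_involutive:
  assumes "skew_symmetrizable B"
  shows "matrix_mutation k (matrix_mutation k B) = B"
proof -
  have "matrix_mutation k (matrix_mutation k B) $ i $ j = B $ i $ j" for i j
    unfolding matrix_mutation_def by (simp add: sgn_minus)
  then show ?thesis by (simp add: vec_eq_iff)
qed

lemma skew_symmetrizable_mutation:
  assumes "skew_symmetrizable B" shows "skew_symmetrizable (matrix_mutation k B)"
proof -
  obtain d :: "'a \<Rightarrow> int" where d: "\<forall>i. d i > 0" "\<forall>i j. d i * B $ i $ j = - (d j * B $ j $ i)"
    using assms by (auto simp: skew_symmetrizable_def)
  have "d i * matrix_mutation k B $ i $ j = - (d j * matrix_mutation k B $ j $ i)" for i j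
  proof (cases "i = k \<or> j = k")
    case True
    then show ?thesis using d(2)[rule_format, of i j] by (auto simp: matrix_mutation_def)
  next
    case False
    (* The relation between the entries (i,k) and (k,i) carries over to their positive parts. *)
    have dik: "d i * B $ i $ k = - (d k * B $ k $ i)" and djk: "d j * B $ j $ k = - (d k * B $ k $ j)"
      using d(2) by blast+
    have pp: "c > 0 \<Longrightarrow> c * pos_part a = pos_part (c * a)" for a c :: int
      by (simp add: pos_part_def max_mult_distrib_left)
    have p1: "d i * pos_part (B $ i $ k) = d k * pos_part (- B $ k $ i)"
      using pp[of "d i" "B $ i $ k"] pp[of "d k" "- B $ k $ i"] d(1) dik by simp
    have p2: "d j * pos_part (B $ j $ k) = d k * pos_part (- B $ k $ j)"
      using pp[of "d j" "B $ j $ k"] pp[of "d k" "- B $ k $ j"] d(1) djk by simp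
    have "d i * matrix_mutation k B $ i $ j
        = d i * B $ i $ j + (d i * pos_part (B $ i $ k)) * B $ k $ j + (d i * B $ i $ k) * pos_part (- B $ k $ j)"
      using False by (simp add: matrix_mutation_nth algebra_simps)
    also have "\<dots> = - (d j * B $ j $ i) + d k * pos_part (- B $ k $ i) * B $ k $ j
        - B $ k $ i * (d k * pos_part (- B $ k $ j))"
      using d(2)[rule_format, of i j] by (simp add: p1 dik algebra_simps)
    also have "\<dots> = - (d j * B $ j $ i) - pos_part (- B $ k $ i) * (d j * B $ j $ k)
        - B $ k $ i * (d j * pos_part (B $ j $ k))"
      by (simp add: p2 djk algebra_simps)
    also have "\<dots> = - (d j * matrix_mutation k B $ j $ i)"
      using False by (simp add: matrix_mutation_nth algebra_simps)
    finally show ?thesis .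
  qed
  then show ?thesis using d(1) by (auto simp: skew_symmetrizable_def)
qed

lemma skew_symmetrizable_along:
  "skew_symmetrizable B \<Longrightarrow> skew_symmetrizable (matrix_along ks B)"
  by (induction ks arbitrary: B) (auto simp: skew_symmetrizable_mutation)

subsection \<open>Mutation is an involution\<close>

definition exchange_numerator ::
    "'n \<Rightarrow> int ^ 'n ^ 'n \<Rightarrow> ('n::finite \<Rightarrow> 'a::field_char_0) \<Rightarrow> 'a" where
  "exchange_numerator k B x = (\<Prod>i\<in>UNIV. x i ^ nat (pos_part (B $ i $ k))) +
     (\<Prod>i\<in>UNIV. x i ^ nat (pos_part (- B $ i $ k)))"

lemma mutated_variable_eq: "mutated_variable k x B = exchange_numerator k B x / x k"
  by (simp add: mutated_variable_def exchange_numerator_def)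

lemma exchange_numerator_cong:
  assumes "\<And>i. B $ i $ k \<noteq> 0 \<Longrightarrow> x i = y i"
  shows "exchange_numerator k B x = exchange_numerator k B y"
proof -
  have "x i ^ nat (pos_part (B $ i $ k)) = y i ^ nat (pos_part (B $ i $ k))"
       "x i ^ nat (pos_part (- B $ i $ k)) = y i ^ nat (pos_part (- B $ i $ k))" for i
    using assms[of i] by (cases "B $ i $ k = 0"; simp add: pos_part_def)+
  then show ?thesis by (simp add: exchange_numerator_def)
qed

lemma exchange_numerator_upd:
  assumes "B $ j $ k = 0"
  shows "exchange_numerator k B (x(j := a)) = exchange_numerator k B x"
  by (rule exchange_numerator_cong) (use assms in auto)

lemma exchange_numerator_mutation:
  "exchange_numerator k (matrix_mutation k B) x = exchange_numerator k B x"
  by (simp add: exchange_numerator_def matrix_mutation_def add.commute)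

lemma exchange_numerator_pos:
  fixes r :: "'n::finite \<Rightarrow> real"
  assumes "\<forall>i. r i > 0" shows "exchange_numerator k B r > 0"
  using assms by (auto simp: exchange_numerator_def intro!: add_pos_pos prod_pos)

lemma cluster_step_pos:
  fixes r :: "'n::finite \<Rightarrow> real"
  assumes "\<forall>i. r i > 0" shows "\<forall>i. cluster_step k B r i > 0"
  using assms exchange_numerator_pos[OF assms, of k B] by (auto simp: cluster_step_def mutated_variable_eq)

lemma cluster_along_pos:
  fixes r :: "'n::finite \<Rightarrow> real"
  shows "\<forall>i. r i > 0 \<Longrightarrow> \<forall>i. cluster_along ks B r i > 0"
proof (induction ks arbitrary: B r)
  case (Cons k ks)
  show ?case using Cons.IH[OF cluster_step_pos[OF Cons.prems, of k B]] by simp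
qed simp

lemma cluster_step_involutive:
  assumes "skew_symmetrizable B" "x k \<noteq> 0" "exchange_numerator k B x \<noteq> 0"
  shows "cluster_step k (matrix_mutation k B) (cluster_step k B x) = x"
proof
  fix i
  have "exchange_numerator k B (x(k := c)) = exchange_numerator k B x" for c
    by (rule exchange_numerator_upd) (rule skew_symmetrizable_diag[OF assms(1)])
  then show "cluster_step k (matrix_mutation k B) (cluster_step k B x) i = x i"
    using assms(2,3) by (auto simp: cluster_step_def mutated_variable_eq exchange_numerator_mutation)
qed

lemma matrix_along_rev:
  "skew_symmetrizable B \<Longrightarrow> matrix_along (rev ks) (matrix_along ks B) = B"
proof (induction ks arbitrary: B)
  case (Cons k ks)
  then show ?case
    using Cons.IH[OF skew_symmetrizable_mutation[OF Cons.prems, of k]]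
    by (simp add: matrix_along_append matrix_mutation_involutive)
qed simp

lemma cluster_along_rev_pos:
  fixes r :: "'n::finite \<Rightarrow> real"
  shows "skew_symmetrizable B \<Longrightarrow> \<forall>i. r i > 0 \<Longrightarrow>
    cluster_along (rev ks) (matrix_along ks B) (cluster_along ks B r) = r"
proof (induction ks arbitrary: B r)
  case (Cons k ks)
  have "r k \<noteq> 0" "exchange_numerator k B r \<noteq> 0"
    using Cons.prems(2) exchange_numerator_pos[OF Cons.prems(2), of k B] by (metis less_irrefl)+
  then show ?case
    using Cons.IH[OF skew_symmetrizable_mutation[OF Cons.prems(1), of k]
        cluster_step_pos[OF Cons.prems(2), of k B]]
      cluster_step_involutive[OF Cons.prems(1)]
      matrix_along_rev[OF skew_symmetrizable_mutation[OF Cons.prems(1), of k], of ks]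
    by (simp add: cluster_along_append)
qed simp

section \<open>Laurent functions on the positive orthant\<close>

abbreviation pos :: "('m \<Rightarrow> real) \<Rightarrow> bool" where
  "pos r \<equiv> \<forall>i. r i > 0"

definition lmon :: "('m::finite \<Rightarrow> int) \<Rightarrow> ('m \<Rightarrow> real) \<Rightarrow> real" where
  "lmon m r = (\<Prod>i\<in>UNIV. r i powi m i)"

text \<open>Laurent polynomials are represented by the functions that they define on the positive orthant.
  There every exchange numerator is invertible and every path of mutations is a bijection, so that
  a change of seed is composition with a bijection. Values outside the orthant carry no
  information, whence the last rule. The coefficients are integers, so that a
  monomial with an invertible coefficient and positive values has coefficient 1.\<close>

inductive laurent :: "(('m::finite \<Rightarrow> real) \<Rightarrow> real) \<Rightarrow> bool" where
  monomial: "laurent (\<lambda>r. of_int c * lmon m r)"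
| add: "laurent f \<Longrightarrow> laurent g \<Longrightarrow> laurent (\<lambda>r. f r + g r)"
| cong: "laurent f \<Longrightarrow> (\<And>r. pos r \<Longrightarrow> f r = g r) \<Longrightarrow> laurent g"

lemma lmon_pos: "pos r \<Longrightarrow> lmon m r > 0"
  by (simp add: lmon_def prod_pos)

lemma lmon_add: "pos r \<Longrightarrow> lmon (\<lambda>i. m i + n i) r = lmon m r * lmon n r"
proof -
  assume "pos r"
  then have "r i \<noteq> 0" for i by (simp add: less_imp_neq[symmetric])
  then have "r i powi (m i + n i) = r i powi m i * r i powi n i" for i by (simp add: power_int_add)
  then show ?thesis by (simp add: lmon_def prod.distrib)
qed

lemma lmon_zero [simp]: "lmon (\<lambda>i. 0) r = 1"
  by (simp add: lmon_def)

lemma lmon_uminus: "pos r \<Longrightarrow> lmon (\<lambda>i. - m i) r = inverse (lmon m r)"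
  by (simp add: lmon_def power_int_minus prod_inversef[symmetric] o_def)

lemma lmon_mult_left: "lmon (\<lambda>i. c * m i) r = lmon m r powi c"
proof -
  have "r i powi (c * m i) = (r i powi m i) powi c" for i
    by (metis mult.commute power_int_mult)
  moreover have "(\<Prod>i\<in>A. f i powi c) = (\<Prod>i\<in>A. f i) powi c" if "finite A" for A and f :: "'a \<Rightarrow> real"
    using that by (induction A) (auto simp: power_int_mult_distrib)
  ultimately show ?thesis by (simp add: lmon_def)
qed

definition unit_vec :: "'m \<Rightarrow> 'm \<Rightarrow> int" where
  "unit_vec j = (\<lambda>i. if i = j then 1 else 0)"

lemma lmon_unit_vec [simp]: "lmon (unit_vec j) r = r j"
proof -
  have "(\<Prod>i\<in>UNIV. r i powi unit_vec j i) = (\<Prod>i\<in>UNIV. if i = j then r i else 1)"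
    by (rule prod.cong) (auto simp: unit_vec_def)
  then show ?thesis by (simp add: lmon_def)
qed

lemma laurent_lmon: "laurent (lmon m)"
  using laurent.monomial[of 1 m] by simp

lemma laurent_const: "laurent (\<lambda>r. of_int c)"
  using laurent.monomial[of c "\<lambda>i. 0"] by simp

lemma laurent_one: "laurent (\<lambda>r. 1)" and laurent_zero: "laurent (\<lambda>r. 0)"
  using laurent_const[of 1] laurent_const[of 0] by simp_all

lemma laurent_coord: "laurent (\<lambda>r. r j)"
  by (rule laurent.cong[OF laurent_lmon[of "unit_vec j"]]) simp

lemma laurent_mult:
  assumes "laurent f" "laurent g" shows "laurent (\<lambda>r. f r * g r)"
  using assms
proof (induction f)
  case (monomial c m)
  from monomial show ?case
  proof (induction g)
    case (monomial d n)
    show ?case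
      by (rule laurent.cong[OF laurent.monomial[of "c * d" "\<lambda>i. m i + n i"]]) (simp add: lmon_add)
  next
    case (add g1 g2)
    show ?case using laurent.add[OF add.IH(1) add.IH(2)] by (simp add: distrib_left)
  next
    case (cong f g)
    show ?case by (rule laurent.cong[OF cong(3)]) (simp add: cong)
  qed
next
  case (add f1 f2)
  show ?case using laurent.add[OF add.IH(1)[OF add.prems] add.IH(2)[OF add.prems]]
    by (simp add: distrib_right)
next
  case (cong f1 f2)
  show ?case by (rule laurent.cong[OF cong(3)[OF cong(4)]]) (simp add: cong)
qed

lemma laurent_uminus: "laurent f \<Longrightarrow> laurent (\<lambda>r. - f r)"
  using laurent_mult[OF laurent_const[of "-1"]] by simp

lemma laurent_diff: "laurent f \<Longrightarrow> laurent g \<Longrightarrow> laurent (\<lambda>r. f r - g r)"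
  using laurent.add[OF _ laurent_uminus, of f g] by simp

lemma laurent_power: "laurent f \<Longrightarrow> laurent (\<lambda>r. f r ^ n)"
  by (induction n) (simp_all add: laurent_one laurent_mult)

lemma laurent_sum: "(\<And>i. i \<in> A \<Longrightarrow> laurent (f i)) \<Longrightarrow> laurent (\<lambda>r. \<Sum>i\<in>A. f i r)"
  by (induction A rule: infinite_finite_induct) (simp_all add: laurent_zero laurent.add)

lemma laurent_prod: "(\<And>i. i \<in> A \<Longrightarrow> laurent (f i)) \<Longrightarrow> laurent (\<lambda>r. \<Prod>i\<in>A. f i r)"
  by (induction A rule: infinite_finite_induct) (simp_all add: laurent_one laurent_mult)

lemma laurent_at_one_Ints: "laurent f \<Longrightarrow> f (\<lambda>_. 1) \<in> \<int>"
  by (induction rule: laurent.induct) (auto simp: lmon_def)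

subsection \<open>Gradings\<close>

text \<open>Every integer vector \<open>w\<close> defines a grading, in which the coordinate \<open>r\<^sub>i\<close> has degree \<open>w\<^sub>i\<close>. On
  functions it is visible as the behaviour under \<open>r\<^sub>i \<mapsto> s\<^bsup>w i\<^esup> r\<^sub>i\<close>, so degrees make sense also for
  functions that are not Laurent.\<close>

definition scale :: "('m \<Rightarrow> int) \<Rightarrow> real \<Rightarrow> ('m \<Rightarrow> real) \<Rightarrow> 'm \<Rightarrow> real" where
  "scale w s r = (\<lambda>i. r i * s powi w i)"

definition dot :: "('m::finite \<Rightarrow> int) \<Rightarrow> ('m \<Rightarrow> int) \<Rightarrow> int" where
  "dot w m = (\<Sum>i\<in>UNIV. w i * m i)"

definition homogeneous :: "('m \<Rightarrow> int) \<Rightarrow> int \<Rightarrow> (('m \<Rightarrow> real) \<Rightarrow> real) \<Rightarrow> bool" where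
  "homogeneous w d f \<longleftrightarrow> (\<forall>r s. pos r \<longrightarrow> s > 0 \<longrightarrow> f (scale w s r) = s powi d * f r)"

lemma scale_pos: "pos r \<Longrightarrow> s > 0 \<Longrightarrow> pos (scale w s r)"
  by (simp add: scale_def)

lemma lmon_scale:
  assumes "s > 0" shows "lmon m (scale w s r) = s powi dot w m * lmon m r"
proof -
  have *: "(\<Prod>i\<in>A. (s powi w i) powi m i) = s powi (\<Sum>i\<in>A. w i * m i)" if "finite A" for A
    using that assms by (induction A) (auto simp: power_int_add power_int_mult)
  show ?thesis
    by (simp add: lmon_def scale_def dot_def power_int_mult_distrib prod.distrib * mult.commute)
qed

lemma homogeneous_lmon: "homogeneous w (dot w m) (lmon m)"
  by (simp add: homogeneous_def lmon_scale)

lemma homogeneous_mult: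
  assumes "homogeneous w d f" "homogeneous w e g"
  shows "homogeneous w (d + e) (\<lambda>r. f r * g r)"
  unfolding homogeneous_def
proof (intro allI impI)
  fix r :: "'a \<Rightarrow> real" and s :: real
  assume "pos r" "s > 0"
  then show "f (scale w s r) * g (scale w s r) = s powi (d + e) * (f r * g r)"
    using assms by (simp add: homogeneous_def power_int_add)
qed

lemma homogeneous_powi:
  assumes "homogeneous w d f" shows "homogeneous w (n * d) (\<lambda>r. f r powi n)"
proof -
  have "(s powi d) powi n = s powi (n * d)" for s :: real by (metis mult.commute power_int_mult)
  then show ?thesis
    using assms by (simp add: homogeneous_def power_int_mult_distrib)
qed

lemma homogeneous_add:
  "homogeneous w d f \<Longrightarrow> homogeneous w d g \<Longrightarrow> homogeneous w d (\<lambda>r. f r + g r)"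
  by (simp add: homogeneous_def algebra_simps)

lemma homogeneous_coord: "homogeneous (unit_vec j) (if i = j then 1 else 0) (\<lambda>r. r i)"
  by (simp add: homogeneous_def scale_def unit_vec_def)

lemma homogeneous_unit_vec:
  assumes "homogeneous (unit_vec j) d f" "pos r" "a > 0"
  shows "f (r(j := a)) = f r * (a / r j) powi d"
proof -
  have rj: "r j > 0" using assms by auto
  have "r(j := a) = scale (unit_vec j) (a / r j) r"
  proof
    fix i show "(r(j := a)) i = scale (unit_vec j) (a / r j) r i"
      using rj by (auto simp: scale_def unit_vec_def)
  qed
  then show ?thesis using assms rj by (simp add: homogeneous_def)
qed

text \<open>A finite sum of functions that are homogeneous of different degrees vanishes only if every
  summand does: scaling by 2 multiplies the summand of degree \<open>i\<close> by its own factor \<open>2\<^sup>i\<close>, so one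
  summand can be eliminated, as in the proof that characters are linearly independent.\<close>

lemma homogeneous_sum_zero:
  assumes "finite I" "\<And>i. i \<in> I \<Longrightarrow> homogeneous w i (F i)"
    and "\<And>r. pos r \<Longrightarrow> (\<Sum>i\<in>I. F i r) = 0"
  shows "\<forall>i\<in>I. \<forall>r. pos r \<longrightarrow> F i r = 0"
  using assms
proof (induction I arbitrary: F rule: finite_induct)
  case (insert k I)
  have hom: "homogeneous w i (\<lambda>r. (2 powi i - 2 powi k) * F i r)" if "i \<in> I" for i
    using insert.prems(1)[of i] that by (auto simp: homogeneous_def)
  have "(\<Sum>i\<in>I. (2 powi i - 2 powi k) * F i r) = 0" if r: "pos r" for r
  proof -
    have "(\<Sum>i\<in>insert k I. F i (scale w 2 r)) = 0"
      using insert.prems(2)[OF scale_pos[OF r]] by simp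
    moreover have "(\<Sum>i\<in>insert k I. F i (scale w 2 r)) = (\<Sum>i\<in>insert k I. 2 powi i * F i r)"
      using insert.prems(1) r by (intro sum.cong refl) (auto simp: homogeneous_def)
    moreover have "2 powi k * (\<Sum>i\<in>insert k I. F i r) = 0"
      using insert.prems(2)[OF r] by simp
    ultimately have "(\<Sum>i\<in>insert k I. 2 powi i * F i r) - (\<Sum>i\<in>insert k I. 2 powi k * F i r) = 0"
      by (simp add: sum_distrib_left)
    then show ?thesis
      using insert.hyps by (simp add: sum_subtractf left_diff_distrib)
  qed
  from insert.IH[OF hom this]
  have "\<forall>i\<in>I. \<forall>r. pos r \<longrightarrow> (2 powi i - 2 powi k) * F i r = 0" by blast
  moreover have "(2 :: real) powi i \<noteq> 2 powi k" if "i \<in> I" for i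
  proof -
    have "i \<noteq> k" using that insert.hyps by auto
    then consider "i < k" | "k < i" by linarith
    then show ?thesis
    proof cases
      case 1 then show ?thesis using power_int_strict_increasing[of i k "2::real"] by simp
    next
      case 2 then show ?thesis using power_int_strict_increasing[of k i "2::real"] by simp
    qed
  qed
  ultimately have I: "\<forall>i\<in>I. \<forall>r. pos r \<longrightarrow> F i r = 0" by auto
  then show ?case using insert.prems(2) insert.hyps by auto
qed simp

lemma laurent_components:
  assumes "laurent f"
  obtains I F where "finite I" "\<And>i. laurent (F i)" "\<And>i. homogeneous w i (F i)"
    "\<And>i r. i \<notin> I \<Longrightarrow> F i r = 0" "\<And>r. pos r \<Longrightarrow> f r = (\<Sum>i\<in>I. F i r)"
proof -
  have "\<exists>I F. finite I \<and> (\<forall>i. laurent (F i)) \<and> (\<forall>i. homogeneous w i (F i)) \<and>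
    (\<forall>i r. i \<notin> I \<longrightarrow> F i r = 0) \<and> (\<forall>r. pos r \<longrightarrow> f r = (\<Sum>i\<in>I. F i r))"
    using assms
  proof (induction f)
    case (monomial c m)
    let ?F = "\<lambda>i r. if i = dot w m then of_int c * lmon m r else 0"
    have "homogeneous w i (?F i)" for i
      using homogeneous_lmon[of w m] by (auto simp: homogeneous_def)
    moreover have "laurent (?F i)" for i
      using laurent.monomial[of c m] laurent_zero by (cases "i = dot w m") simp_all
    ultimately show ?case
      by (intro exI[of _ "{dot w m}"] exI[of _ ?F]) simp
  next
    case (add f g)
    then obtain I F J G where F: "finite I" "\<forall>i. laurent (F i)" "\<forall>i. homogeneous w i (F i)"
      "\<forall>i r. i \<notin> I \<longrightarrow> F i r = 0" "\<forall>r. pos r \<longrightarrow> f r = (\<Sum>i\<in>I. F i r)"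
      and G: "finite J" "\<forall>i. laurent (G i)" "\<forall>i. homogeneous w i (G i)"
      "\<forall>i r. i \<notin> J \<longrightarrow> G i r = 0" "\<forall>r. pos r \<longrightarrow> g r = (\<Sum>i\<in>J. G i r)"
      by blast
    have "(\<Sum>i\<in>I. F i r) = (\<Sum>i\<in>I\<union>J. F i r)" "(\<Sum>i\<in>J. G i r) = (\<Sum>i\<in>I\<union>J. G i r)" for r
      using F(1,4) G(1,4) by (auto intro!: sum.mono_neutral_left)
    then show ?case
      using F G by (intro exI[of _ "I \<union> J"] exI[of _ "\<lambda>i r. F i r + G i r"])
        (auto simp: sum.distrib intro: laurent.add homogeneous_add)
  next
    case (cong f g)
    then show ?case by metis
  qed
  then show ?thesis using that by blast
qed

text \<open>Hence in any decomposition of a Laurent function into homogeneous functions the summands are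
  Laurent functions themselves.\<close>

lemma laurent_component:
  assumes "laurent f" "finite I" "\<And>i. i \<in> I \<Longrightarrow> homogeneous w i (F i)"
    and f: "\<And>r. pos r \<Longrightarrow> f r = (\<Sum>i\<in>I. F i r)" and "k \<in> I"
  shows "laurent (F k)"
proof -
  obtain J G where G: "finite J" "\<And>i. laurent (G i)" "\<And>i. homogeneous w i (G i)"
    "\<And>i r. i \<notin> J \<Longrightarrow> G i r = 0" "\<And>r. pos r \<Longrightarrow> f r = (\<Sum>i\<in>J. G i r)"
    using laurent_components[OF assms(1)] by metis
  let ?H = "\<lambda>i r. (if i \<in> I then F i r else 0) + - 1 * G i r"
  have hom: "homogeneous w i (?H i)" for i
    using assms(3)[of i] G(3)[of i] by (auto simp: homogeneous_def algebra_simps)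
  have "(\<Sum>i\<in>I \<union> J. ?H i r) = 0" if "pos r" for r
  proof -
    have "(\<Sum>i\<in>I. F i r) = (\<Sum>i\<in>I\<union>J. if i \<in> I then F i r else 0)"
      using assms(2) G(1) by (intro sum.mono_neutral_cong_left) auto
    moreover have "(\<Sum>i\<in>J. G i r) = (\<Sum>i\<in>I\<union>J. G i r)"
      using G assms(2) by (intro sum.mono_neutral_left) auto
    ultimately show ?thesis
      using f[OF that] G(5)[OF that] by (simp add: sum_subtractf)
  qed
  from homogeneous_sum_zero[OF _ hom this] assms(2) G(1) \<open>k \<in> I\<close>
  have "\<forall>r. pos r \<longrightarrow> ?H k r = 0" by blast
  then have "\<forall>r. pos r \<longrightarrow> G k r = F k r" using \<open>k \<in> I\<close> by simp
  then show ?thesis using laurent.cong[OF G(2)[of k]] by blast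
qed

subsection \<open>Growth exponents\<close>

text \<open>The growth exponent of \<open>f\<close> in direction \<open>w\<close> is its tropical value at \<open>w\<close>. For a function built
  from positive functions by sums, products and quotients it can be computed by the rules of the
  tropical semifield. It is required to be the same at all base points, while the constants may
  depend on the base point.\<close>

definition growth :: "('m \<Rightarrow> int) \<Rightarrow> (('m \<Rightarrow> real) \<Rightarrow> real) \<Rightarrow> int \<Rightarrow> bool" where
  "growth w f e \<longleftrightarrow> (\<forall>r. pos r \<longrightarrow> (\<exists>c C. c > 0 \<and> (\<forall>s. 0 < s \<and> s < 1 \<longrightarrow>
      c * s powi e \<le> f (scale w s r) \<and> f (scale w s r) \<le> C * s powi e)))"

lemma growthD:
  assumes "growth w f e" "pos r"
  obtains c C where "c > 0" "C > 0" "\<And>s. 0 < s \<Longrightarrow> s < 1 \<Longrightarrow> c * s powi e \<le> f (scale w s r)"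
    "\<And>s. 0 < s \<Longrightarrow> s < 1 \<Longrightarrow> f (scale w s r) \<le> C * s powi e"
proof -
  have "\<exists>c C. c > 0 \<and> (\<forall>s. 0 < s \<and> s < 1 \<longrightarrow>
      c * s powi e \<le> f (scale w s r) \<and> f (scale w s r) \<le> C * s powi e)"
    by (rule mp[OF spec[OF assms(1)[unfolded growth_def]] assms(2)])
  then obtain c C where c: "c > 0"
    "\<forall>s. 0 < s \<and> s < 1 \<longrightarrow> c * s powi e \<le> f (scale w s r) \<and> f (scale w s r) \<le> C * s powi e"
    by (elim exE conjE)
  have lo: "c * s powi e \<le> f (scale w s r)" and hi: "f (scale w s r) \<le> C * s powi e"
    if "0 < s" "s < 1" for s using c(2) that by simp_all
  have "c * (1/2) powi e \<le> C * (1/2) powi e"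
    by (rule order_trans[OF lo hi]) simp_all
  moreover have "(0::real) < (1/2) powi e" by simp
  ultimately have "c \<le> C" by (rule mult_right_le_imp_le)
  then have "C > 0" using c(1) by linarith
  then show ?thesis by (rule that[OF c(1) _ lo hi])
qed

lemma growth_mult:
  assumes "growth w f d" "growth w g e" shows "growth w (\<lambda>r. f r * g r) (d + e)"
  unfolding growth_def
proof (intro allI impI)
  fix r :: "'a \<Rightarrow> real" assume r: "pos r"
  obtain c C where c: "c > 0" "C > 0" "\<And>s. 0 < s \<Longrightarrow> s < 1 \<Longrightarrow> c * s powi d \<le> f (scale w s r)"
    "\<And>s. 0 < s \<Longrightarrow> s < 1 \<Longrightarrow> f (scale w s r) \<le> C * s powi d"
    using growthD[OF assms(1) r] by blast
  obtain c' C' where c': "c' > 0" "C' > 0" "\<And>s. 0 < s \<Longrightarrow> s < 1 \<Longrightarrow> c' * s powi e \<le> g (scale w s r)"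
    "\<And>s. 0 < s \<Longrightarrow> s < 1 \<Longrightarrow> g (scale w s r) \<le> C' * s powi e"
    using growthD[OF assms(2) r] by blast
  have "c * c' * s powi (d + e) \<le> f (scale w s r) * g (scale w s r) \<and>
        f (scale w s r) * g (scale w s r) \<le> C * C' * s powi (d + e)" if s: "0 < s" "s < 1" for s
  proof -
    have p: "0 \<le> c * s powi d" "0 \<le> c' * s powi e" using c(1) c'(1) s by auto
    then have q: "0 \<le> f (scale w s r)" "0 \<le> g (scale w s r)" "0 \<le> C * s powi d"
      using c(3,4)[OF s] c'(3)[OF s] by linarith+
    have "(c * s powi d) * (c' * s powi e) \<le> f (scale w s r) * g (scale w s r)"
      by (rule mult_mono[OF c(3)[OF s] c'(3)[OF s] q(1) p(2)])
    moreover have "f (scale w s r) * g (scale w s r) \<le> (C * s powi d) * (C' * s powi e)"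
      by (rule mult_mono[OF c(4)[OF s] c'(4)[OF s] q(3) q(2)])
    moreover have "s powi (d + e) = s powi d * s powi e" using s by (simp add: power_int_add)
    ultimately show ?thesis by (simp add: mult.assoc mult.left_commute)
  qed
  then show "\<exists>c C. c > 0 \<and> (\<forall>s. 0 < s \<and> s < 1 \<longrightarrow>
      c * s powi (d + e) \<le> f (scale w s r) * g (scale w s r) \<and>
      f (scale w s r) * g (scale w s r) \<le> C * s powi (d + e))"
    using c(1) c'(1) by (intro exI[of _ "c * c'"] exI[of _ "C * C'"]) auto
qed

lemma growth_inverse:
  assumes "growth w f d" shows "growth w (\<lambda>r. inverse (f r)) (- d)"
  unfolding growth_def
proof (intro allI impI)
  fix r :: "'a \<Rightarrow> real" assume r: "pos r"
  obtain c C where c: "c > 0" "C > 0" "\<And>s. 0 < s \<Longrightarrow> s < 1 \<Longrightarrow> c * s powi d \<le> f (scale w s r)"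
    "\<And>s. 0 < s \<Longrightarrow> s < 1 \<Longrightarrow> f (scale w s r) \<le> C * s powi d"
    using growthD[OF assms(1) r] by blast
  have "inverse C * s powi - d \<le> inverse (f (scale w s r)) \<and>
        inverse (f (scale w s r)) \<le> inverse c * s powi - d" if s: "0 < s" "s < 1" for s
  proof -
    have p: "0 < c * s powi d" using c(1) s by simp
    then have "inverse (f (scale w s r)) \<le> inverse (c * s powi d)"
      using c(3)[OF s] by (intro le_imp_inverse_le) auto
    moreover have "inverse (C * s powi d) \<le> inverse (f (scale w s r))"
      using c(4)[OF s] c(3)[OF s] p by (intro le_imp_inverse_le) auto
    ultimately show ?thesis by (simp add: power_int_minus)
  qed
  then show "\<exists>c C. c > 0 \<and> (\<forall>s. 0 < s \<and> s < 1 \<longrightarrow>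
      c * s powi - d \<le> inverse (f (scale w s r)) \<and> inverse (f (scale w s r)) \<le> C * s powi - d)"
    using c(2) by (intro exI[of _ "inverse C"] exI[of _ "inverse c"]) auto
qed

lemma growth_add:
  assumes "growth w f d" "growth w g e" shows "growth w (\<lambda>r. f r + g r) (min d e)"
  unfolding growth_def
proof (intro allI impI)
  fix r :: "'a \<Rightarrow> real" assume r: "pos r"
  obtain c C where c: "c > 0" "C > 0" "\<And>s. 0 < s \<Longrightarrow> s < 1 \<Longrightarrow> c * s powi d \<le> f (scale w s r)"
    "\<And>s. 0 < s \<Longrightarrow> s < 1 \<Longrightarrow> f (scale w s r) \<le> C * s powi d"
    using growthD[OF assms(1) r] by blast
  obtain c' C' where c': "c' > 0" "C' > 0" "\<And>s. 0 < s \<Longrightarrow> s < 1 \<Longrightarrow> c' * s powi e \<le> g (scale w s r)"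
    "\<And>s. 0 < s \<Longrightarrow> s < 1 \<Longrightarrow> g (scale w s r) \<le> C' * s powi e"
    using growthD[OF assms(2) r] by blast
  have "min c c' * s powi (min d e) \<le> f (scale w s r) + g (scale w s r) \<and>
        f (scale w s r) + g (scale w s r) \<le> (C + C') * s powi (min d e)" if s: "0 < s" "s < 1" for s
  proof -
    have p: "0 < s powi d" "0 < s powi e" "0 < s powi (min d e)" using s by auto
    have "s powi d \<le> s powi (min d e)" "s powi e \<le> s powi (min d e)"
      using s by (auto intro!: power_int_decreasing)
    then have "C * s powi d \<le> C * s powi (min d e)" "C' * s powi e \<le> C' * s powi (min d e)"
      using c(2) c'(2) by auto
    then have "f (scale w s r) + g (scale w s r) \<le> (C + C') * s powi (min d e)"
      using c(4)[OF s] c'(4)[OF s] by (simp add: distrib_right)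
    moreover have "min c c' * s powi (min d e) \<le> c * s powi d + c' * s powi e"
    proof (cases "d \<le> e")
      case True
      then have "min c c' * s powi (min d e) \<le> c * s powi d"
        using p c(1) c'(1) by (intro mult_mono) (auto simp: min_def)
      then show ?thesis using c'(1) p by (smt (verit) mult_pos_pos)
    next
      case False
      then have "min c c' * s powi (min d e) \<le> c' * s powi e"
        using p c(1) c'(1) by (intro mult_mono) (auto simp: min_def)
      then show ?thesis using c(1) p by (smt (verit) mult_pos_pos)
    qed
    ultimately show ?thesis using c(3)[OF s] c'(3)[OF s] by linarith
  qed
  then show "\<exists>c C. c > 0 \<and> (\<forall>s. 0 < s \<and> s < 1 \<longrightarrow>
      c * s powi (min d e) \<le> f (scale w s r) + g (scale w s r) \<and>
      f (scale w s r) + g (scale w s r) \<le> C * s powi (min d e))"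
    using c(1) c'(1) by (intro exI[of _ "min c c'"] exI[of _ "C + C'"]) auto
qed

lemma growth_homogeneous:
  assumes "homogeneous w d f" "\<And>r. pos r \<Longrightarrow> f r > 0" shows "growth w f d"
  unfolding growth_def
proof (intro allI impI)
  fix r :: "'a \<Rightarrow> real" assume r: "pos r"
  have "f (scale w s r) = f r * s powi d" if "0 < s" for s
    using assms(1) that r by (simp add: homogeneous_def)
  then show "\<exists>c C. c > 0 \<and> (\<forall>s. 0 < s \<and> s < 1 \<longrightarrow>
      c * s powi d \<le> f (scale w s r) \<and> f (scale w s r) \<le> C * s powi d)"
    using assms(2)[OF r] by (intro exI[of _ "f r"]) auto
qed

lemma growth_lmon: "growth w (lmon m) (dot w m)"
  by (rule growth_homogeneous[OF homogeneous_lmon lmon_pos])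

lemma growth_one: "growth w (\<lambda>r. 1) 0"
  using growth_homogeneous[of w 0 "\<lambda>r. 1"] by (simp add: homogeneous_def)

lemma growth_cong: "growth w f d \<Longrightarrow> (\<And>r. pos r \<Longrightarrow> f r = g r) \<Longrightarrow> growth w g d"
  unfolding growth_def by (metis scale_pos)

lemma growth_power: "growth w f d \<Longrightarrow> growth w (\<lambda>r. f r ^ n) (int n * d)"
  by (induction n) (simp_all add: distrib_right growth_one growth_mult)

lemma growth_prod:
  "(\<And>i. i \<in> A \<Longrightarrow> growth w (f i) (d i)) \<Longrightarrow> growth w (\<lambda>r. \<Prod>i\<in>A. f i r) (\<Sum>i\<in>A. d i)"
  by (induction A rule: infinite_finite_induct) (simp_all add: growth_one growth_mult)

lemma bounded_le_zero:
  fixes a C :: real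
  assumes "\<And>s. 0 < s \<Longrightarrow> s < 1 \<Longrightarrow> a \<le> C * s" shows "a \<le> 0"
proof (rule ccontr)
  assume "\<not> a \<le> 0"
  then have a: "a > 0" by simp
  define s where "s = min (1/2) (a / (2 * (\<bar>C\<bar> + 1)))"
  have s: "0 < s" "s < 1" using a by (auto simp: s_def)
  have "C * s \<le> (\<bar>C\<bar> + 1) * s" using s by (intro mult_right_mono) auto
  also have "\<dots> \<le> (\<bar>C\<bar> + 1) * (a / (2 * (\<bar>C\<bar> + 1)))"
    by (intro mult_left_mono) (auto simp: s_def)
  also have "\<dots> = a / 2" by (simp add: field_simps)
  finally show False using assms[OF s] a by linarith
qed

lemma growth_unique:
  fixes f :: "('m \<Rightarrow> real) \<Rightarrow> real"
  assumes "growth w f d" "growth w f e" shows "d = e"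
proof -
  have *: "e \<le> d" if gd: "growth w f d" and ge: "growth w f e" for d e
  proof (rule ccontr)
    assume "\<not> e \<le> d"
    have r: "pos (\<lambda>_::'m. 1::real)" by simp
    obtain c C where c: "c > 0" "C > 0"
        "\<And>s. 0 < s \<Longrightarrow> s < 1 \<Longrightarrow> c * s powi d \<le> f (scale w s (\<lambda>_. 1))"
        "\<And>s. 0 < s \<Longrightarrow> s < 1 \<Longrightarrow> f (scale w s (\<lambda>_. 1)) \<le> C * s powi d"
      using growthD[OF gd r] by blast
    obtain c' C' where c': "c' > 0" "C' > 0"
        "\<And>s. 0 < s \<Longrightarrow> s < 1 \<Longrightarrow> c' * s powi e \<le> f (scale w s (\<lambda>_. 1))"
        "\<And>s. 0 < s \<Longrightarrow> s < 1 \<Longrightarrow> f (scale w s (\<lambda>_. 1)) \<le> C' * s powi e"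
      using growthD[OF ge r] by blast
    have "c \<le> C' * s" if s: "0 < s" "s < 1" for s
    proof -
      have "c * s powi d \<le> C' * s powi e" using c(3)[OF s] c'(4)[OF s] by linarith
      also have "\<dots> \<le> C' * s powi (d + 1)"
        using c'(2) s \<open>\<not> e \<le> d\<close> by (intro mult_left_mono power_int_decreasing) auto
      also have "\<dots> = (C' * s) * s powi d" using s by (simp add: power_int_add)
      finally show ?thesis using s by simp
    qed
    then have "c \<le> 0" by (rule bounded_le_zero)
    then show False using c(1) by simp
  qed
  show ?thesis using *[OF assms] *[OF assms(2,1)] by simp
qed

text \<open>Dividing by the lowest power of \<open>s\<close> that occurs, its coefficient is bounded by a multiple of
  \<open>s\<close>, for all \<open>s\<close> between 0 and 1.\<close>

lemma powi_sum_coeff_zero: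
  fixes a :: "int \<Rightarrow> real"
  assumes "finite I" and b: "\<And>s. 0 < s \<Longrightarrow> s < 1 \<Longrightarrow> \<bar>\<Sum>i\<in>I. a i * s powi i\<bar> \<le> C * s powi e"
    and "k \<in> I" "k < e"
  shows "a k = 0"
proof (rule ccontr)
  assume "a k \<noteq> 0"
  define J where "J = {i \<in> I. a i \<noteq> 0}"
  have J: "finite J" "k \<in> J" using assms \<open>a k \<noteq> 0\<close> by (auto simp: J_def)
  have ne: "J \<noteq> {}" using J(2) by blast
  define m where "m = Min J"
  have m: "m \<in> J" "\<And>i. i \<in> J \<Longrightarrow> m \<le> i" "m < e"
    using J Min_in[OF J(1) ne] Min_le[OF J(1)] le_less_trans[OF Min_le[OF J] \<open>k < e\<close>]
    by (auto simp: m_def)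
  have "C \<ge> 0"
    using b[of "1/2"] abs_ge_zero[of "\<Sum>i\<in>I. a i * (1/2) powi i"]
    by (smt (verit) mult_neg_pos zero_less_power_int zero_less_divide_1_iff half_gt_zero_iff field_sum_of_halves)
  have "\<bar>a m\<bar> \<le> (C + (\<Sum>i\<in>J - {m}. \<bar>a i\<bar>)) * s" if s: "0 < s" "s < 1" for s
  proof -
    have "(\<Sum>i\<in>I. a i * s powi i) = (\<Sum>i\<in>J. a i * s powi i)"
      using assms(1) by (intro sum.mono_neutral_right) (auto simp: J_def)
    also have "\<dots> = a m * s powi m + (\<Sum>i\<in>J - {m}. a i * s powi i)"
      using J(1) m(1) by (simp add: sum.remove)
    finally have "\<bar>a m * s powi m\<bar> \<le> C * s powi e + \<bar>\<Sum>i\<in>J - {m}. a i * s powi i\<bar>"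
      using b[OF s] by linarith
    also have "\<bar>\<Sum>i\<in>J - {m}. a i * s powi i\<bar> \<le> (\<Sum>i\<in>J - {m}. \<bar>a i\<bar> * s powi (m + 1))"
    proof (rule order_trans[OF sum_abs sum_mono])
      fix i assume "i \<in> J - {m}"
      then have "m + 1 \<le> i" using m(2)[of i] by force
      then have "s powi i \<le> s powi (m + 1)" using s by (intro power_int_decreasing) auto
      then show "\<bar>a i * s powi i\<bar> \<le> \<bar>a i\<bar> * s powi (m + 1)"
        using s by (auto simp: abs_mult intro!: mult_left_mono)
    qed
    also have "C * s powi e \<le> C * s powi (m + 1)"
      using \<open>C \<ge> 0\<close> s m(3) by (intro mult_left_mono power_int_decreasing) auto
    finally have "\<bar>a m\<bar> * s powi m \<le> (C + (\<Sum>i\<in>J - {m}. \<bar>a i\<bar>)) * s powi (m + 1)"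
      using s by (simp add: abs_mult sum_distrib_right[symmetric] distrib_right)
    also have "\<dots> = ((C + (\<Sum>i\<in>J - {m}. \<bar>a i\<bar>)) * s) * s powi m"
      using s by (simp add: power_int_add)
    finally show ?thesis using s by simp
  qed
  then have "\<bar>a m\<bar> \<le> 0" by (rule bounded_le_zero)
  then show False using m(1) by (simp add: J_def)
qed

text \<open>The growth exponent in direction \<open>w\<close> bounds the \<open>w\<close>-degrees of a Laurent function below;
  the growth exponent in direction \<open>-w\<close> bounds them above.\<close>

lemma growth_component_zero:
  assumes "growth w f e" "finite I" "\<And>i. i \<in> I \<Longrightarrow> homogeneous w i (F i)"
    and f: "\<And>r. pos r \<Longrightarrow> f r = (\<Sum>i\<in>I. F i r)" and "k \<in> I" "k < e" "pos r"
  shows "F k r = 0"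
proof -
  obtain c C where c: "c > 0" "C > 0" "\<And>s. 0 < s \<Longrightarrow> s < 1 \<Longrightarrow> c * s powi e \<le> f (scale w s r)"
    "\<And>s. 0 < s \<Longrightarrow> s < 1 \<Longrightarrow> f (scale w s r) \<le> C * s powi e"
    using growthD[OF assms(1) \<open>pos r\<close>] by blast
  have "\<bar>\<Sum>i\<in>I. F i r * s powi i\<bar> \<le> C * s powi e" if s: "0 < s" "s < 1" for s
  proof -
    have "(\<Sum>i\<in>I. F i r * s powi i) = (\<Sum>i\<in>I. F i (scale w s r))"
      using assms(3) s \<open>pos r\<close> by (intro sum.cong) (auto simp: homogeneous_def)
    also have "\<dots> = f (scale w s r)" using f[OF scale_pos[OF \<open>pos r\<close> s(1)]] by simp
    finally have "(\<Sum>i\<in>I. F i r * s powi i) = f (scale w s r)" .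
    moreover have "0 \<le> c * s powi e" using c(1) s by simp
    ultimately show ?thesis using c(3,4)[OF s] by simp
  qed
  then show ?thesis by (rule powi_sum_coeff_zero[OF assms(2) _ assms(5,6)])
qed

lemma homogeneous_neg: "homogeneous w d f \<Longrightarrow> homogeneous (\<lambda>i. - w i) (- d) f"
  unfolding homogeneous_def
proof (intro allI impI)
  fix r :: "'a \<Rightarrow> real" and s :: real
  assume *: "\<forall>r s. pos r \<longrightarrow> s > 0 \<longrightarrow> f (scale w s r) = s powi d * f r" "pos r" "s > 0"
  have "scale (\<lambda>i. - w i) s r = scale w (inverse s) r"
    by (simp add: scale_def power_int_minus power_int_inverse)
  then show "f (scale (\<lambda>i. - w i) s r) = s powi - d * f r"
    using * by (simp add: power_int_minus power_int_inverse)
qed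

lemma laurent_growth_opposite:
  assumes f: "laurent f" "growth w f p" "growth (\<lambda>i. - w i) f q"
  shows "p \<le> - q" and "p = - q \<Longrightarrow> homogeneous w p f"
proof -
  obtain I F where F: "finite I" "\<And>i. homogeneous w i (F i)"
    "\<And>r. pos r \<Longrightarrow> f r = (\<Sum>i\<in>I. F i r)"
    using laurent_components[OF f(1)] by metis
  have low: "F i r = 0" if "i \<in> I" "i < p" "pos r" for i r
    using growth_component_zero[OF f(2) F(1) F(2) F(3) that(1,2,3)] by blast
  have high: "F i r = 0" if "i \<in> I" "i > - q" "pos r" for i r
  proof -
    have "homogeneous (\<lambda>i. - w i) j (F (- j))" for j
      using homogeneous_neg[OF F(2)[of "- j"]] by simp
    moreover have "f r = (\<Sum>j\<in>uminus ` I. F (- j) r)" if "pos r" for r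
      using F(3)[OF that] by (subst sum.reindex) auto
    ultimately have "F (- (- i)) r = 0"
      using growth_component_zero[of "\<lambda>i. - w i" f q "uminus ` I" "\<lambda>j. F (- j)" "- i" r] f(3) F(1) that
      by auto
    then show ?thesis by simp
  qed
  have fpos: "f (scale w (1/2) (\<lambda>_. 1)) > 0"
  proof -
    have one: "pos (\<lambda>_::'a. 1::real)" by simp
    obtain c C where c: "c > 0" "C > 0"
        "\<And>s. 0 < s \<Longrightarrow> s < 1 \<Longrightarrow> c * s powi p \<le> f (scale w s (\<lambda>_. 1))"
        "\<And>s. 0 < s \<Longrightarrow> s < 1 \<Longrightarrow> f (scale w s (\<lambda>_. 1)) \<le> C * s powi p"
      using growthD[OF f(2) one] by blast
    have "0 < c * (1/2) powi p" using c(1) by simp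
    also have "\<dots> \<le> f (scale w (1/2) (\<lambda>_. 1))" using c(3)[of "1/2"] by simp
    finally show ?thesis .
  qed
  show "p \<le> - q"
  proof (rule ccontr)
    assume "\<not> p \<le> - q"
    then have "F i (scale w (1/2) (\<lambda>_. 1)) = 0" if "i \<in> I" for i
      using low[OF that] high[OF that] scale_pos[of "\<lambda>_. 1" "1/2" w] by (cases "i < p") auto
    then show False
      using fpos F(3)[OF scale_pos[of "\<lambda>_. 1" "1/2" w]] by simp
  qed
  show "homogeneous w p f" if "p = - q"
  proof -
    have eq: "f r = (if p \<in> I then F p r else 0)" if "pos r" for r
    proof -
      have "F i r = 0" if "i \<in> I" "i \<noteq> p" for i
        using low[of i r] high[of i r] that \<open>pos r\<close> \<open>p = - q\<close> by (cases "i < p") auto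
      then have "(\<Sum>i\<in>I. F i r) = (\<Sum>i\<in>I. if i = p then F p r else 0)"
        by (intro sum.cong) auto
      then show ?thesis using F(3)[OF that] F(1) by simp
    qed
    then show ?thesis
      using F(2)[of p] by (auto simp: homogeneous_def scale_pos)
  qed
qed

section \<open>The Laurent phenomenon\<close>

text \<open>Membership in the localization at the powers of \<open>P\<close>. Substitutions that send every coordinate
  and its inverse into the localization send all Laurent functions into it.\<close>

definition laurent_localized :: "(('m::finite \<Rightarrow> real) \<Rightarrow> real) \<Rightarrow> (('m \<Rightarrow> real) \<Rightarrow> real) \<Rightarrow> bool" where
  "laurent_localized P f \<longleftrightarrow> (\<exists>N. laurent (\<lambda>r. P r ^ N * f r))"

lemma localized_laurent: "laurent f \<Longrightarrow> laurent_localized P f"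
  unfolding laurent_localized_def by (rule exI[of _ 0]) simp

lemma localized_more:
  assumes "laurent P" "laurent (\<lambda>r. P r ^ N * f r)" "N \<le> N'"
  shows "laurent (\<lambda>r. P r ^ N' * f r)"
proof -
  have "P r ^ N' = P r ^ (N' - N) * P r ^ N" for r
    using assms(3) by (simp add: power_add[symmetric])
  then have "P r ^ (N' - N) * (P r ^ N * f r) = P r ^ N' * f r" for r by simp
  with laurent_mult[OF laurent_power[OF assms(1), of "N' - N"] assms(2)] show ?thesis by simp
qed

lemma localized_add:
  assumes "laurent P" "laurent_localized P f" "laurent_localized P g"
  shows "laurent_localized P (\<lambda>r. f r + g r)"
proof -
  obtain N N' where N: "laurent (\<lambda>r. P r ^ N * f r)" "laurent (\<lambda>r. P r ^ N' * g r)"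
    using assms(2,3) by (auto simp: laurent_localized_def)
  have "laurent (\<lambda>r. P r ^ max N N' * f r + P r ^ max N N' * g r)"
    by (intro laurent.add localized_more[OF assms(1) N(1)] localized_more[OF assms(1) N(2)]) auto
  then show ?thesis unfolding laurent_localized_def by (auto simp: distrib_left)
qed

lemma localized_mult:
  assumes "laurent_localized P f" "laurent_localized P g"
  shows "laurent_localized P (\<lambda>r. f r * g r)"
proof -
  obtain N N' where N: "laurent (\<lambda>r. P r ^ N * f r)" "laurent (\<lambda>r. P r ^ N' * g r)"
    using assms by (auto simp: laurent_localized_def)
  have "(P r ^ N * f r) * (P r ^ N' * g r) = P r ^ (N + N') * (f r * g r)" for r
    by (simp add: power_add algebra_simps)
  with laurent_mult[OF N] show ?thesis unfolding laurent_localized_def by auto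
qed

lemma localized_cong:
  assumes "laurent_localized P f" "\<And>r. pos r \<Longrightarrow> f r = g r"
  shows "laurent_localized P g"
proof -
  obtain N where "laurent (\<lambda>r. P r ^ N * f r)" using assms(1) by (auto simp: laurent_localized_def)
  then have "laurent (\<lambda>r. P r ^ N * g r)" by (rule laurent.cong) (simp add: assms(2))
  then show ?thesis by (auto simp: laurent_localized_def)
qed

lemma localized_power: "laurent_localized P f \<Longrightarrow> laurent_localized P (\<lambda>r. f r ^ n)"
  by (induction n) (simp_all add: localized_laurent laurent_one localized_mult)

lemma localized_sum:
  "laurent P \<Longrightarrow> (\<And>i. i \<in> A \<Longrightarrow> laurent_localized P (f i)) \<Longrightarrow> laurent_localized P (\<lambda>r. \<Sum>i\<in>A. f i r)"
  by (induction A rule: infinite_finite_induct)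
     (simp_all add: localized_laurent laurent_zero localized_add)

lemma localized_prod:
  "(\<And>i. i \<in> A \<Longrightarrow> laurent_localized P (f i)) \<Longrightarrow> laurent_localized P (\<lambda>r. \<Prod>i\<in>A. f i r)"
  by (induction A rule: infinite_finite_induct)
     (simp_all add: localized_laurent laurent_one localized_mult)

lemma localized_powi:
  assumes "laurent_localized P f" "laurent_localized P (\<lambda>r. inverse (f r))"
  shows "laurent_localized P (\<lambda>r. f r powi n)"
proof (cases "n \<ge> 0")
  case True
  then show ?thesis using localized_power[OF assms(1), of "nat n"] by (simp add: power_int_nonneg_exp)
next
  case False
  then show ?thesis using localized_power[OF assms(2), of "nat (- n)"]
    by (simp add: power_int_def)
qed

lemma localized_compose:
  fixes p :: "('n::finite \<Rightarrow> real) \<Rightarrow> 'm::finite \<Rightarrow> real"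
  assumes "laurent f" "laurent P" "\<And>r. pos r \<Longrightarrow> pos (p r)"
    and "\<And>i. laurent_localized P (\<lambda>r. p r i)" "\<And>i. laurent_localized P (\<lambda>r. inverse (p r i))"
  shows "laurent_localized P (\<lambda>r. f (p r))"
  using assms(1)
proof (induction f)
  case (monomial c m)
  have "laurent_localized P (\<lambda>r. of_int c * (\<Prod>i\<in>UNIV. p r i powi m i))"
    by (intro localized_mult localized_prod localized_powi assms localized_laurent laurent_const)
  then show ?case by (simp add: lmon_def)
next
  case (add f g)
  then show ?case by (intro localized_add assms(2))
next
  case (cong f g)
  show ?case by (rule localized_cong[OF cong.IH]) (simp add: cong(2) assms(3))
qed

lemma laurent_compose:
  fixes p :: "('n::finite \<Rightarrow> real) \<Rightarrow> 'm::finite \<Rightarrow> real"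
  assumes "laurent f" "\<And>r. pos r \<Longrightarrow> pos (p r)"
    and "\<And>i. laurent (\<lambda>r. p r i)" "\<And>i. laurent (\<lambda>r. inverse (p r i))"
  shows "laurent (\<lambda>r. f (p r))"
proof -
  have "laurent_localized (\<lambda>r. 1) (\<lambda>r. f (p r))"
    by (rule localized_compose[OF assms(1) laurent_one assms(2)])
       (simp_all add: localized_laurent assms(3,4))
  then show ?thesis by (auto simp: laurent_localized_def)
qed

text \<open>If multiplication by two functions detects Laurent functions, so does multiplication by
  powers of them: descend on the exponents one at a time.\<close>

definition coprime_functions :: "(('m::finite \<Rightarrow> real) \<Rightarrow> real) \<Rightarrow> (('m \<Rightarrow> real) \<Rightarrow> real) \<Rightarrow> bool" where
  "coprime_functions P Q \<longleftrightarrow>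
     (\<forall>f. laurent (\<lambda>r. P r * f r) \<longrightarrow> laurent (\<lambda>r. Q r * f r) \<longrightarrow> laurent f)"

lemma coprime_localized:
  assumes "coprime_functions P Q" "laurent P" "laurent Q"
    and "laurent_localized P f" "laurent_localized Q f"
  shows "laurent f"
proof -
  obtain N M where NM: "laurent (\<lambda>r. P r ^ N * f r)" "laurent (\<lambda>r. Q r ^ M * f r)"
    using assms(4,5) by (auto simp: laurent_localized_def)
  have "laurent (\<lambda>r. P r ^ a * Q r ^ b * f r)" if "a + b + n = N + M" for a b n
    using that
  proof (induction n arbitrary: a b)
    case 0
    then consider "a \<ge> N" | "b \<ge> M" by linarith
    then show ?case
    proof cases
      case 1
      from laurent_mult[OF laurent_power[OF assms(3), of b] localized_more[OF assms(2) NM(1) 1]]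
      show ?thesis by (simp add: mult.assoc mult.left_commute)
    next
      case 2
      from laurent_mult[OF laurent_power[OF assms(2), of a] localized_more[OF assms(3) NM(2) 2]]
      show ?thesis by (simp add: mult.assoc mult.left_commute)
    qed
  next
    case (Suc n)
    have "laurent (\<lambda>r. P r ^ Suc a * Q r ^ b * f r)" "laurent (\<lambda>r. P r ^ a * Q r ^ Suc b * f r)"
      using Suc.IH[of "Suc a" b] Suc.IH[of a "Suc b"] Suc.prems by simp_all
    then have "laurent (\<lambda>r. P r * (P r ^ a * Q r ^ b * f r))" "laurent (\<lambda>r. Q r * (P r ^ a * Q r ^ b * f r))"
      by (simp_all add: mult.assoc mult.left_commute)
    then show ?case by (rule assms(1)[unfolded coprime_functions_def, THEN spec, THEN mp, THEN mp])
  qed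
  from this[of 0 0 "N + M"] show ?thesis by simp
qed

text \<open>Two binomials \<open>1 + x\<^sup>u\<close> and \<open>1 + x\<^sup>v\<close> with non-proportional exponents are coprime. Grade by a
  direction orthogonal to \<open>u\<close> but not to \<open>v\<close>: then the first binomial has degree 0, and the
  components of \<open>f\<close> come out one after the other, starting from the lowest degree.\<close>

lemma coprime_binomials:
  fixes u v :: "'m::finite \<Rightarrow> int"
  assumes "u p * v q \<noteq> u q * v p"
  shows "coprime_functions (\<lambda>r. 1 + lmon u r) (\<lambda>r. 1 + lmon v r)"
  unfolding coprime_functions_def
proof (intro allI impI)
  fix f :: "('m \<Rightarrow> real) \<Rightarrow> real"
  assume f: "laurent (\<lambda>r. (1 + lmon u r) * f r)" "laurent (\<lambda>r. (1 + lmon v r) * f r)"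
  have "\<exists>w. dot w u = 0 \<and> dot w v > 0"
  proof -
    define w where "w = (\<lambda>i. u q * unit_vec p i - u p * unit_vec q i)"
    have dot: "dot w m = u q * m p - u p * m q" for m
    proof -
      have "(\<Sum>i\<in>UNIV. unit_vec j i * m i) = m j" for j
      proof -
        have "(\<Sum>i\<in>UNIV. unit_vec j i * m i) = (\<Sum>i\<in>UNIV. if i = j then m i else 0)"
          by (rule sum.cong) (auto simp: unit_vec_def)
        then show ?thesis by simp
      qed
      then show ?thesis
        by (simp add: dot_def w_def left_diff_distrib sum_subtractf mult.assoc sum_distrib_left[symmetric])
    qed
    have neg: "dot (\<lambda>i. - w i) m = - dot w m" for m by (simp add: dot_def sum_negf)
    have "dot w u = 0" "dot w v \<noteq> 0" using assms by (auto simp: dot)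
    then show ?thesis
      by (cases "dot w v > 0") (auto intro: exI[of _ w] exI[of _ "\<lambda>i. - w i"] simp: neg)
  qed
  then obtain w where w: "dot w u = 0" "dot w v > 0" by blast
  define \<delta> where "\<delta> = dot w v"
  obtain I G where G: "finite I" "\<And>i. laurent (G i)" "\<And>i. homogeneous w i (G i)"
    "\<And>i r. i \<notin> I \<Longrightarrow> G i r = 0" "\<And>r. pos r \<Longrightarrow> (1 + lmon u r) * f r = (\<Sum>i\<in>I. G i r)"
    using laurent_components[OF f(1), of w] by blast
  define g where "g = (\<lambda>i r. G i r / (1 + lmon u r))"
  have u1: "1 + lmon u r \<noteq> 0" if "pos r" for r using lmon_pos[OF that, of u] by linarith
  have hom: "homogeneous w i (g i)" for i
    using G(3)[of i] homogeneous_lmon[of w u] by (simp add: homogeneous_def g_def w(1))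
  have fg: "f r = (\<Sum>i\<in>I. g i r)" if "pos r" for r
    using G(5)[OF that] u1[OF that] by (simp add: g_def sum_divide_distrib[symmetric] field_simps)
  have g0: "g i r = 0" if "i \<notin> I" for i r using G(4)[OF that] by (simp add: g_def)
  define J where "J = I \<union> (\<lambda>i. i + \<delta>) ` I"
  have J: "finite J" using G(1) by (simp add: J_def)
  have homJ: "homogeneous w i (\<lambda>r. g i r + lmon v r * g (i - \<delta>) r)" for i
    using homogeneous_add[OF hom[of i] homogeneous_mult[OF homogeneous_lmon[of w v] hom[of "i - \<delta>"],
          folded \<delta>_def, simplified]] by simp
  have sumJ: "(1 + lmon v r) * f r = (\<Sum>i\<in>J. g i r + lmon v r * g (i - \<delta>) r)" if "pos r" for r
  proof -
    have "(\<Sum>i\<in>I. g i r) = (\<Sum>i\<in>J. g i r)"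
      using J g0 by (intro sum.mono_neutral_left) (auto simp: J_def)
    moreover have "(\<Sum>i\<in>I. g i r) = (\<Sum>i\<in>(\<lambda>i. i + \<delta>) ` I. g (i - \<delta>) r)"
      by (subst sum.reindex) (auto simp: inj_on_def)
    moreover have "(\<Sum>i\<in>(\<lambda>i. i + \<delta>) ` I. g (i - \<delta>) r) = (\<Sum>i\<in>J. g (i - \<delta>) r)"
    proof (rule sum.mono_neutral_left[OF J])
      show "\<forall>i\<in>J - (\<lambda>i. i + \<delta>) ` I. g (i - \<delta>) r = 0"
      proof
        fix i assume "i \<in> J - (\<lambda>i. i + \<delta>) ` I"
        then have "i - \<delta> \<notin> I" by force
        then show "g (i - \<delta>) r = 0" by (rule g0)
      qed
    qed (auto simp: J_def)
    ultimately show ?thesis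
      using fg[OF that] by (simp add: sum.distrib sum_distrib_left[symmetric] distrib_right)
  qed
  have step: "laurent (\<lambda>r. g i r + lmon v r * g (i - \<delta>) r)" for i
  proof (cases "i \<in> J")
    case True
    show ?thesis by (rule laurent_component[OF f(2) J homJ sumJ True])
  next
    case False
    then have "i \<notin> I" "i - \<delta> \<notin> I" by (auto simp: J_def image_iff algebra_simps)
    then show ?thesis using laurent_zero by (simp add: g0)
  qed
  obtain m where m: "\<And>i. i \<in> I \<Longrightarrow> m \<le> i"
  proof (cases "I = {}")
    case False
    then show ?thesis using that[of "Min I"] G(1) by simp
  qed blast
  have gl: "laurent (g i)" for i
  proof (induction "nat (i - m + 1)" arbitrary: i rule: less_induct)
    case less
    show ?case
    proof (cases "i < m")
      case True
      then have "i \<notin> I" using m[of i] by auto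
      then have "g i = (\<lambda>r. 0)" using g0 by auto
      then show ?thesis using laurent_zero by simp
    next
      case False
      then have "laurent (g (i - \<delta>))" using w(2) by (intro less) (simp add: \<delta>_def)
      from laurent_diff[OF step[of i] laurent_mult[OF laurent_lmon[of v] this]] show ?thesis by simp
    qed
  qed
  show "laurent f"
    by (rule laurent.cong[OF laurent_sum[of I g]]) (simp_all add: gl fg)
qed

subsection \<open>Exchange binomials\<close>

lemma laurent_exchange_numerator: "laurent (exchange_numerator k B)"
  unfolding exchange_numerator_def
  by (intro laurent.add laurent_prod laurent_power laurent_coord)

lemma exchange_numerator_lmon:
  "exchange_numerator k B r = lmon (\<lambda>i. pos_part (B $ i $ k)) r + lmon (\<lambda>i. pos_part (- B $ i $ k)) r"
proof -
  have "r i ^ nat (pos_part a) = r i powi pos_part a" for i a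
    by (simp add: power_int_nonneg_exp pos_part_def)
  then show ?thesis by (simp add: exchange_numerator_def lmon_def)
qed

lemma exchange_numerator_binomial:
  assumes "pos r"
  shows "exchange_numerator k B r =
    lmon (\<lambda>i. pos_part (- B $ i $ k)) r * (1 + lmon (\<lambda>i. B $ i $ k) r)"
proof -
  have "pos_part (B $ i $ k) = pos_part (- B $ i $ k) + B $ i $ k" for i
    by (simp add: pos_part_def)
  then show ?thesis
    using lmon_add[OF assms, of "\<lambda>i. pos_part (- B $ i $ k)" "\<lambda>i. B $ i $ k"]
    by (simp add: exchange_numerator_lmon distrib_left)
qed

lemma laurent_exchange_binomial_iff:
  "laurent (\<lambda>r. exchange_numerator k B r * f r) \<longleftrightarrow> laurent (\<lambda>r. (1 + lmon (\<lambda>i. B $ i $ k) r) * f r)"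
  (is "laurent ?f \<longleftrightarrow> laurent ?g")
proof
  let ?m = "\<lambda>i. pos_part (- B $ i $ k)"
  assume "laurent ?f"
  from laurent_mult[OF laurent_lmon[of "\<lambda>i. - ?m i"] this] show "laurent ?g"
    by (rule laurent.cong)
       (use lmon_pos[of _ ?m] in \<open>simp add: exchange_numerator_binomial lmon_uminus less_imp_neq[symmetric]\<close>)
next
  let ?m = "\<lambda>i. pos_part (- B $ i $ k)"
  assume "laurent ?g"
  from laurent_mult[OF laurent_lmon[of ?m] this] show "laurent ?f"
    by (rule laurent.cong) (simp add: exchange_numerator_binomial mult.assoc)
qed

lemma homogeneous_exchange_numerator:
  assumes "B $ k $ k = 0" shows "homogeneous (unit_vec k) 0 (exchange_numerator k B)"
  unfolding homogeneous_def
proof (intro allI impI)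
  fix r :: "'a \<Rightarrow> real" and s :: real
  have "exchange_numerator k B (scale (unit_vec k) s r) = exchange_numerator k B r"
    by (rule exchange_numerator_cong) (use assms in \<open>auto simp: scale_def unit_vec_def\<close>)
  then show "exchange_numerator k B (scale (unit_vec k) s r) = s powi 0 * exchange_numerator k B r"
    by simp
qed

lemma cluster_step_mutation: "cluster_step k (matrix_mutation k B) x = cluster_step k B x"
  by (simp add: cluster_step_def mutated_variable_eq exchange_numerator_mutation)

lemma lmon_upd:
  "lmon m (r(j := a)) = lmon (m(j := 0)) r * a powi m j"
proof -
  have "lmon m (r(j := a)) = a powi m j * (\<Prod>i\<in>UNIV - {j}. r i powi m i)"
    by (simp add: lmon_def prod.remove[of UNIV j])
  moreover have "lmon (m(j := 0)) r = (\<Prod>i\<in>UNIV - {j}. r i powi m i)"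
    by (simp add: lmon_def prod.remove[of UNIV j])
  ultimately show ?thesis by simp
qed

lemma power_congruent:
  fixes a a0 P :: "('m::finite \<Rightarrow> real) \<Rightarrow> real"
  assumes "laurent a0" "laurent e" "laurent P" "\<And>r. pos r \<Longrightarrow> a r = a0 r + e r * P r"
  shows "\<exists>e'. laurent e' \<and> (\<forall>r. pos r \<longrightarrow> a r ^ n = a0 r ^ n + e' r * P r)"
proof (induction n)
  case 0
  then show ?case by (intro exI[of _ "\<lambda>r. 0"]) (simp add: laurent_zero)
next
  case (Suc n)
  then obtain e' where e': "laurent e'" "\<And>r. pos r \<Longrightarrow> a r ^ n = a0 r ^ n + e' r * P r" by blast
  let ?e = "\<lambda>r. a0 r * e' r + e r * (a0 r ^ n + e' r * P r)"
  have "laurent ?e"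
    by (intro laurent.add laurent_mult laurent_power assms(1-3) e'(1))
  moreover have "a r ^ Suc n = a0 r ^ Suc n + ?e r * P r" if "pos r" for r
    using e'(2)[OF that] assms(4)[OF that] by (simp add: algebra_simps)
  ultimately show ?case by (intro exI[of _ ?e]) blast
qed

text \<open>If \<open>b\<^sub>k\<^sub>j > 0\<close>, the numerator at \<open>k\<close> has the form \<open>\<alpha>x\<^sub>j\<^sup>c + \<beta>\<close> with monomials \<open>\<alpha>\<close>, \<open>\<beta>\<close> and
  \<open>c > 0\<close>. In the coordinates of the final seed \<open>x\<^sub>j\<close> is a multiple of the numerator at \<open>j\<close>, so modulo
  the latter the numerator at \<open>k\<close> is the unit \<open>\<beta>\<close>. The second claim follows by the same reduction: the
  numerator at \<open>j\<close> in the original seed turns out to be a multiple of that in the final seed.\<close>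

lemma exchange_pair_positive:
  fixes B :: "int ^ 'm ^ 'm" and j k :: "'m::finite"
  assumes B: "skew_symmetrizable B" and jk: "B $ k $ j > 0"
  defines "P \<equiv> exchange_numerator j (matrix_mutation k B)"
  defines "s \<equiv> cluster_step j (matrix_mutation k B)"
  defines "Q \<equiv> \<lambda>r. exchange_numerator k B (s r)"
  shows "coprime_functions P Q"
    and "laurent (\<lambda>r. exchange_numerator j B (cluster_step k B (s r)) / cluster_step k B (s r) j)"
proof -
  have jnk: "j \<noteq> k" using jk skew_symmetrizable_diag[OF B, of k] by auto
  have kj: "B $ j $ k < 0" using skew_symmetrizable_iffs(2)[OF B] jk by blast
  have diag: "B $ j $ j = 0" "B $ k $ k = 0" using skew_symmetrizable_diag[OF B] by auto
  define c where "c = nat (- B $ j $ k)"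
  define d where "d = nat (B $ k $ j)"
  have c: "int c = - B $ j $ k" "c > 0" and d: "int d = B $ k $ j" "d > 0"
    using jk kj by (auto simp: c_def d_def)
  define \<mu> where "\<mu> = (\<lambda>i. pos_part (B $ i $ k))"
  define \<alpha> where "\<alpha> = (\<lambda>i. pos_part (- B $ i $ k))(j := 0)"
  have \<mu>: "\<mu> j = 0" "\<mu> k = 0" using kj diag by (auto simp: \<mu>_def pos_part_def)
  have P: "laurent P" by (simp add: P_def laurent_exchange_numerator)
  have Ppos: "P r > 0" if "pos r" for r using exchange_numerator_pos[OF that] by (simp add: P_def)
  have s: "s r = r(j := P r / r j)" for r
    by (simp add: s_def P_def cluster_step_def mutated_variable_eq)
  define e where "e = (\<lambda>r. lmon \<alpha> r * ((P r * inverse (r j)) ^ (c - 1) * inverse (r j)))"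
  have inv: "laurent (\<lambda>r. inverse (r i))" for i
    by (rule laurent.cong[OF laurent_lmon[of "\<lambda>l. - unit_vec i l"]]) (simp add: lmon_uminus)
  have e: "laurent e"
    unfolding e_def by (intro laurent_mult laurent_lmon laurent_power P inv)
  (* The numerator at k reduces to the monomial lmon mu modulo the numerator at j. *)
  have Q: "Q r = lmon \<mu> r + e r * P r" for r
  proof -
    have "lmon (\<lambda>i. pos_part (- B $ i $ k)) (r(j := P r / r j)) = lmon \<alpha> r * (P r / r j) ^ c"
      using c kj by (simp add: lmon_upd \<alpha>_def pos_part_def power_int_nonneg_exp c_def)
    also have "(P r / r j) ^ c = (P r * inverse (r j)) ^ (c - 1) * inverse (r j) * P r"
      using c(2) by (subst power_eq_if) (simp add: divide_inverse)
    finally have "lmon (\<lambda>i. pos_part (- B $ i $ k)) (r(j := P r / r j)) = e r * P r"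
      unfolding e_def by (simp only: mult.assoc)
    moreover have "lmon \<mu> (r(j := P r / r j)) = lmon \<mu> r"
      using \<mu>(1) by (simp add: lmon_upd fun_upd_idem)
    ultimately show ?thesis
      by (simp add: Q_def s exchange_numerator_lmon \<mu>_def)
  qed
  show "coprime_functions P Q"
    unfolding coprime_functions_def
  proof (intro allI impI)
    fix f assume f: "laurent (\<lambda>r. P r * f r)" "laurent (\<lambda>r. Q r * f r)"
    have "laurent (\<lambda>r. lmon (\<lambda>i. - \<mu> i) r * (Q r * f r - e r * (P r * f r)))"
      by (intro laurent_mult laurent_diff laurent_lmon f e)
    then show "laurent f"
    proof (rule laurent.cong)
      fix r :: "'m \<Rightarrow> real" assume "pos r"
      then show "lmon (\<lambda>i. - \<mu> i) r * (Q r * f r - e r * (P r * f r)) = f r"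
        using lmon_pos[of r \<mu>] by (simp add: Q lmon_uminus distrib_right)
    qed
  qed
  define a where "a = (\<lambda>r. Q r / r k)"
  define a0 where "a0 = (\<lambda>r. lmon \<mu> r * inverse (r k))"
  have "laurent a0" unfolding a0_def by (intro laurent_mult laurent_lmon inv)
  moreover have "laurent (\<lambda>r. e r * inverse (r k))" by (intro laurent_mult e inv)
  moreover have "a r = a0 r + (e r * inverse (r k)) * P r" for r
    by (simp add: a_def a0_def Q divide_inverse distrib_right)
  ultimately obtain e' where e': "laurent e'" "\<And>r. pos r \<Longrightarrow> a r ^ d = a0 r ^ d + e' r * P r"
    using power_congruent[of a0 "\<lambda>r. e r * inverse (r k)" P a d] P by blast
  define \<nu> where "\<nu> = (\<lambda>i. pos_part (B $ i $ j))(k := 0)"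
  define \<kappa> where "\<kappa> = (\<lambda>i. pos_part (- B $ i $ j))"
  define b where "b = (\<lambda>i. matrix_mutation k B $ i $ j)"
  have \<nu>j: "\<nu> j = 0" "\<kappa> j = 0" "\<kappa> k = 0"
    using diag jk jnk by (auto simp: \<nu>_def \<kappa>_def pos_part_def)
  have q: "cluster_step k B (s r) = (r(j := P r / r j))(k := a r)" for r
    using jnk by (simp add: cluster_step_def mutated_variable_eq Q_def a_def s)
  have num: "exchange_numerator j B (cluster_step k B (s r)) = lmon \<nu> r * a r ^ d + lmon \<kappa> r" for r
  proof -
    have "lmon (\<lambda>i. pos_part (B $ i $ j)) ((r(j := P r / r j))(k := a r))
        = lmon \<nu> (r(j := P r / r j)) * a r ^ d"
      using jk by (simp add: lmon_upd[of _ _ k] \<nu>_def pos_part_def power_int_nonneg_exp d_def)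
    moreover have "lmon \<nu> (r(j := P r / r j)) = lmon \<nu> r"
      using \<nu>j by (simp add: lmon_upd fun_upd_idem)
    moreover have "lmon \<kappa> ((r(j := P r / r j))(k := a r)) = lmon \<kappa> r"
      using \<nu>j by (simp add: lmon_upd fun_upd_idem)
    ultimately show ?thesis by (simp add: q exchange_numerator_lmon \<kappa>_def)
  qed
  (* The leading part is the numerator at j of the matrix mutated at k, up to a monomial. *)
  have main: "lmon \<nu> r * a0 r ^ d + lmon \<kappa> r = lmon (\<lambda>i. \<kappa> i - pos_part (- b i)) r * P r"
    if r: "pos r" for r
  proof -
    have bi: "b i = \<nu> i + int d * (\<mu> i - unit_vec k i) - \<kappa> i" for i
      using jnk jk d diag \<mu> by (auto simp: b_def \<nu>_def \<mu>_def \<kappa>_def unit_vec_def matrix_mutation_nth pos_part_def)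
    have "a0 r = lmon (\<lambda>i. \<mu> i - unit_vec k i) r"
      using lmon_add[OF r, of \<mu> "\<lambda>i. - unit_vec k i"] r by (simp add: a0_def lmon_uminus)
    then have "lmon \<nu> r * a0 r ^ d = lmon (\<lambda>i. \<nu> i + int d * (\<mu> i - unit_vec k i)) r"
      using lmon_add[OF r, of \<nu> "\<lambda>i. int d * (\<mu> i - unit_vec k i)"]
      by (simp add: lmon_mult_left)
    also have "\<dots> = lmon (\<lambda>i. b i + \<kappa> i) r" by (simp add: bi)
    also have "\<dots> = lmon b r * lmon \<kappa> r" by (rule lmon_add[OF r])
    finally have 0: "lmon \<nu> r * a0 r ^ d + lmon \<kappa> r = lmon \<kappa> r * (1 + lmon b r)"
      by (simp add: algebra_simps)
    have 1: "lmon \<kappa> r = lmon (\<lambda>i. \<kappa> i - pos_part (- b i)) r * lmon (\<lambda>i. pos_part (- b i)) r"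
      using lmon_add[OF r, of "\<lambda>i. \<kappa> i - pos_part (- b i)" "\<lambda>i. pos_part (- b i)"] by simp
    have 2: "P r = lmon (\<lambda>i. pos_part (- b i)) r * (1 + lmon b r)"
      using exchange_numerator_binomial[OF r, of j "matrix_mutation k B"] by (simp add: P_def b_def)
    have 3: "lmon \<kappa> r * (1 + lmon b r) = lmon (\<lambda>i. \<kappa> i - pos_part (- b i)) r * P r"
      by (simp only: 2 mult.assoc[symmetric] 1[symmetric])
    show ?thesis by (rule trans[OF 0 3])
  qed
  have "laurent (\<lambda>r. (lmon (\<lambda>i. \<kappa> i - pos_part (- b i)) r + lmon \<nu> r * e' r) * r j)"
    by (intro laurent_mult laurent.add laurent_lmon laurent_coord e'(1))
  then show "laurent (\<lambda>r. exchange_numerator j B (cluster_step k B (s r)) / cluster_step k B (s r) j)"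
  proof (rule laurent.cong)
    fix r :: "'m \<Rightarrow> real" assume r: "pos r"
    have "exchange_numerator j B (cluster_step k B (s r))
        = (lmon (\<lambda>i. \<kappa> i - pos_part (- b i)) r + lmon \<nu> r * e' r) * P r"
      using main[OF r] e'(2)[OF r] by (simp add: num algebra_simps)
    moreover have "cluster_step k B (s r) j = P r / r j" using jnk by (simp add: q)
    moreover have "r j \<noteq> 0" using r by (simp add: less_imp_neq[symmetric])
    ultimately show "(lmon (\<lambda>i. \<kappa> i - pos_part (- b i)) r + lmon \<nu> r * e' r) * r j =
        exchange_numerator j B (cluster_step k B (s r)) / cluster_step k B (s r) j"
      using Ppos[OF r] by simp
  qed
qed

lemma matrix_mutation_uminus: "matrix_mutation k (- B) = - matrix_mutation k B"
  by (simp add: vec_eq_iff matrix_mutation_def sgn_if)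

lemma exchange_numerator_uminus: "exchange_numerator k (- B) = exchange_numerator k B"
  by (simp add: fun_eq_iff exchange_numerator_def add.commute)

lemma cluster_step_uminus: "cluster_step k (- B) = cluster_step k B"
  by (simp add: fun_eq_iff cluster_step_def mutated_variable_eq exchange_numerator_uminus)

lemma skew_symmetrizable_uminus: "skew_symmetrizable B \<Longrightarrow> skew_symmetrizable (- B)"
  unfolding skew_symmetrizable_def
proof (elim exE conjE)
  fix d :: "'a \<Rightarrow> int"
  assume d: "\<forall>i. 0 < d i" "\<forall>i j. d i * B $ i $ j = - (d j * B $ j $ i)"
  have "d i * (- B) $ i $ j = - (d j * (- B) $ j $ i)" for i j
    using d(2)[rule_format, of i j] by simp
  then show "\<exists>d. (\<forall>i. 0 < d i) \<and> (\<forall>i j. d i * (- B) $ i $ j = - (d j * (- B) $ j $ i))"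
    using d(1) by (intro exI[of _ d]) blast
qed

text \<open>Coprimality of exchange numerators needs columns that are not proportional, in every seed.
  Linear independence of all mutable columns provides this and is preserved by mutation, because
  mutation composes invertible row and column operations.\<close>

definition independent_columns :: "int ^ 'm ^ 'm \<Rightarrow> 'm::finite set \<Rightarrow> bool" where
  "independent_columns B M \<longleftrightarrow>
     (\<forall>v :: 'm \<Rightarrow> int. (\<forall>i. (\<Sum>j\<in>M. B $ i $ j * v j) = 0) \<longrightarrow> (\<forall>j\<in>M. v j = 0))"

lemma independent_columns_nonzero:
  assumes "independent_columns B M" "j \<in> M" obtains p where "B $ p $ j \<noteq> 0"
proof -
  have "\<exists>i. (\<Sum>l\<in>M. B $ i $ l * (if l = j then 1 else 0)) \<noteq> 0"
    using assms unfolding independent_columns_def by fastforce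
  moreover have "(\<Sum>l\<in>M. B $ i $ l * (if l = j then 1 else 0)) = B $ i $ j" for i
    using assms(2) by (simp add: if_distrib cong: if_cong)
  ultimately show ?thesis using that by auto
qed

lemma independent_columns_minor:
  assumes "independent_columns B M" "j \<in> M" "k \<in> M" "j \<noteq> k"
  obtains p q where "B $ p $ j * B $ q $ k \<noteq> B $ q $ j * B $ p $ k"
proof (rule ccontr)
  assume "\<not> thesis"
  then have eq: "B $ p $ j * B $ q $ k = B $ q $ j * B $ p $ k" for p q using that by blast
  obtain p where p: "B $ p $ j \<noteq> 0" using independent_columns_nonzero[OF assms(1,2)] .
  let ?l = "\<lambda>l. if l = k then B $ p $ j else if l = j then - B $ p $ k else 0"
  have "(\<Sum>l\<in>M. B $ i $ l * ?l l) = 0" for i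
  proof -
    have "(\<Sum>l\<in>M. B $ i $ l * ?l l) = (\<Sum>l\<in>{j, k}. B $ i $ l * ?l l)"
      using assms(2,3) by (intro sum.mono_neutral_right) auto
    also have "\<dots> = 0" using assms(4) eq[of p i] by (simp add: algebra_simps)
    finally show ?thesis .
  qed
  then have "\<forall>l\<in>M. ?l l = 0"
    using assms(1)[unfolded independent_columns_def, THEN spec[of _ ?l]] by blast
  from bspec[OF this assms(3)] show False using p by simp
qed

lemma independent_columns_mutation:
  assumes "independent_columns B M" "skew_symmetrizable B" "k \<in> M"
  shows "independent_columns (matrix_mutation k B) M"
  unfolding independent_columns_def
proof (intro allI impI)
  fix v :: "'a \<Rightarrow> int"
  assume *: "\<forall>i. (\<Sum>j\<in>M. matrix_mutation k B $ i $ j * v j) = 0"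
  let ?N = "M - {k}"
  have kk: "B $ k $ k = 0" using skew_symmetrizable_diag[OF assms(2)] by blast
  have split: "(\<Sum>j\<in>M. f j) = f k + (\<Sum>j\<in>?N. f j)" for f :: "'a \<Rightarrow> int"
    using assms(3) by (simp add: sum.remove)
  have rowk: "(\<Sum>j\<in>?N. B $ k $ j * v j) = 0"
    using *[rule_format, of k] by (simp add: split matrix_mutation_def kk sum_negf)
  (* The coefficients of the corresponding relation between the columns of B. *)
  define v' where "v' = v(k := (\<Sum>j\<in>?N. pos_part (- B $ k $ j) * v j) - v k)"
  have "(\<Sum>j\<in>M. B $ i $ j * v' j) = 0" for i
  proof (cases "i = k")
    case True
    have "(\<Sum>j\<in>?N. B $ k $ j * v' j) = (\<Sum>j\<in>?N. B $ k $ j * v j)"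
      by (rule sum.cong) (auto simp: v'_def)
    then show ?thesis using True rowk kk by (simp add: split)
  next
    case False
    have "(\<Sum>j\<in>?N. matrix_mutation k B $ i $ j * v j)
        = (\<Sum>j\<in>?N. B $ i $ j * v j + pos_part (B $ i $ k) * (B $ k $ j * v j)
            + B $ i $ k * (pos_part (- B $ k $ j) * v j))"
      using False by (intro sum.cong refl) (simp add: matrix_mutation_nth algebra_simps)
    also have "\<dots> = (\<Sum>j\<in>?N. B $ i $ j * v j) + B $ i $ k * (\<Sum>j\<in>?N. pos_part (- B $ k $ j) * v j)"
      using rowk by (simp add: sum.distrib sum_distrib_left[symmetric])
    also have "(\<Sum>j\<in>?N. B $ i $ j * v j) = (\<Sum>j\<in>?N. B $ i $ j * v' j)"
      by (rule sum.cong) (auto simp: v'_def)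
    finally show ?thesis
      using *[rule_format, of i] False
      by (simp add: split matrix_mutation_def[of k B] v'_def algebra_simps)
  qed
  then have "\<forall>j\<in>M. v' j = 0" using assms(1) unfolding independent_columns_def by blast
  then have N: "\<forall>j\<in>?N. v j = 0" and "v' k = 0" using assms(3) by (auto simp: v'_def split: if_splits)
  then have "v k = 0" by (simp add: v'_def)
  then show "\<forall>j\<in>M. v j = 0" using N by auto
qed

text \<open>Mutating first at \<open>k\<close> and then at \<open>j\<close>, the two exchange numerators are coprime in the
  coordinates of the final seed, and the \<open>j\<close>-th variable of the seed mutated at \<open>j\<close> alone is a Laurent
  function of the final coordinates. The remaining case is \<open>b\<^sub>k\<^sub>j = 0\<close>, where the two mutations commute
  and neither numerator involves \<open>x\<^sub>j\<close> or \<open>x\<^sub>k\<close>.\<close>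

lemma exchange_pair:
  fixes B :: "int ^ 'm ^ 'm" and j k :: "'m::finite"
  assumes B: "skew_symmetrizable B" "independent_columns B M" "j \<in> M" "k \<in> M" "j \<noteq> k"
  defines "P \<equiv> exchange_numerator j (matrix_mutation k B)"
  defines "s \<equiv> cluster_step j (matrix_mutation k B)"
  defines "Q \<equiv> \<lambda>r. exchange_numerator k B (s r)"
  shows "coprime_functions P Q"
    and "laurent (\<lambda>r. exchange_numerator j B (cluster_step k B (s r)) / cluster_step k B (s r) j)"
proof -
  consider "B $ k $ j > 0" | "B $ k $ j < 0" | "B $ k $ j = 0" by linarith
  then have "coprime_functions P Q \<and>
    laurent (\<lambda>r. exchange_numerator j B (cluster_step k B (s r)) / cluster_step k B (s r) j)"
  proof cases
    case 1
    then show ?thesis unfolding P_def s_def Q_def by (intro conjI exchange_pair_positive B(1))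
  next
    case 2
    then have "(- B) $ k $ j > 0" by simp
    from exchange_pair_positive[OF skew_symmetrizable_uminus[OF B(1)] this]
    show ?thesis
      unfolding P_def s_def Q_def
      by (simp add: matrix_mutation_uminus exchange_numerator_uminus cluster_step_uminus)
  next
    case 3
    have jk: "B $ j $ k = 0" using 3 skew_symmetrizable_iffs(1)[OF B(1)] by blast
    have jj: "B $ j $ j = 0" using skew_symmetrizable_diag[OF B(1)] .
    have "matrix_mutation k B $ i $ j = B $ i $ j" for i
      using 3 B(5) by (auto simp: matrix_mutation_nth pos_part_def)
    then have P: "P = exchange_numerator j B"
      by (simp add: P_def exchange_numerator_def fun_eq_iff)
    have s: "s r = r(j := P r / r j)" for r
      by (simp add: s_def P_def cluster_step_def mutated_variable_eq)
    have Q: "Q = exchange_numerator k B"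
      by (simp add: Q_def s fun_eq_iff exchange_numerator_upd[OF jk])
    obtain p q where "B $ p $ j * B $ q $ k \<noteq> B $ q $ j * B $ p $ k"
      using independent_columns_minor[OF B(2-5)] .
    then have "coprime_functions (\<lambda>r. 1 + lmon (\<lambda>i. B $ i $ j) r) (\<lambda>r. 1 + lmon (\<lambda>i. B $ i $ k) r)"
      by (rule coprime_binomials)
    then have "coprime_functions P Q"
      unfolding coprime_functions_def P Q laurent_exchange_binomial_iff .
    moreover have "laurent (\<lambda>r. exchange_numerator j B (cluster_step k B (s r)) / cluster_step k B (s r) j)"
    proof (rule laurent.cong[OF laurent_coord[of j]])
      fix r :: "'m \<Rightarrow> real" assume r: "pos r"
      have "exchange_numerator j B (cluster_step k B (s r)) = P r"
        by (simp add: P cluster_step_def s exchange_numerator_upd[OF 3] exchange_numerator_upd[OF jj])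
      moreover have "cluster_step k B (s r) j = P r / r j" using B(5) by (simp add: cluster_step_def s)
      moreover have "P r > 0" using exchange_numerator_pos[OF r] by (simp add: P)
      ultimately show "r j = exchange_numerator j B (cluster_step k B (s r)) / cluster_step k B (s r) j"
        by simp
    qed
    ultimately show ?thesis by blast
  qed
  then show "coprime_functions P Q"
    and "laurent (\<lambda>r. exchange_numerator j B (cluster_step k B (s r)) / cluster_step k B (s r) j)"
    by blast+
qed

text \<open>The upper bound of a seed in the sense of Berenstein, Fomin and Zelevinsky, in the coordinates
  of the seed: the functions that are Laurent in the seed and in its neighbours in the directions
  \<open>M\<close>. The remaining directions are frozen.\<close>

definition upper_bound :: "int ^ 'm ^ 'm \<Rightarrow> 'm::finite set \<Rightarrow> (('m \<Rightarrow> real) \<Rightarrow> real) \<Rightarrow> bool" where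
  "upper_bound B M g \<longleftrightarrow> laurent g \<and> (\<forall>k\<in>M. laurent (\<lambda>r. g (cluster_step k B r)))"

lemma laurent_inverse_coord: "laurent (\<lambda>r. inverse (r i))"
  by (rule laurent.cong[OF laurent_lmon[of "\<lambda>l. - unit_vec i l"]]) (simp add: lmon_uminus)

lemma laurent_powi_coord: "laurent (\<lambda>r. r i powi n)"
proof -
  show ?thesis
    by (rule laurent.cong[OF laurent_lmon[of "\<lambda>l. n * unit_vec i l"]]) (simp add: lmon_mult_left)
qed

text \<open>Mutation at \<open>j\<close> reverses the degree in \<open>x\<^sub>j\<close>, so being Laurent in the mutated seed as well is a
  condition on each homogeneous component: the component of degree \<open>n\<close> stays Laurent after
  multiplication by the \<open>n\<close>-th power of the exchange numerator, which matters for negative \<open>n\<close>.\<close>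

lemma exchange_components:
  assumes B: "skew_symmetrizable B" and g: "laurent g" "laurent (\<lambda>r. g (cluster_step j B r))"
  obtains I F where "finite I" "\<And>n. laurent (F n)" "\<And>n. homogeneous (unit_vec j) n (F n)"
    "\<And>r. pos r \<Longrightarrow> g r = (\<Sum>n\<in>I. F n r)"
    "\<And>n. n \<in> I \<Longrightarrow> laurent (\<lambda>r. F n r * exchange_numerator j B r powi n)"
proof -
  obtain I F where F: "finite I" "\<And>n. laurent (F n)" "\<And>n. homogeneous (unit_vec j) n (F n)"
    "\<And>n r. n \<notin> I \<Longrightarrow> F n r = 0" "\<And>r. pos r \<Longrightarrow> g r = (\<Sum>n\<in>I. F n r)"
    using laurent_components[OF g(1), of "unit_vec j"] by blast
  let ?P = "exchange_numerator j B"
  have jj: "B $ j $ j = 0" using skew_symmetrizable_diag[OF B] .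
  define H where "H = (\<lambda>n r. F (- n) r * (?P r powi (- n) * r j powi (2 * n)))"
  have hX: "homogeneous (unit_vec j) 0 ?P" by (rule homogeneous_exchange_numerator[OF jj])
  have hj: "homogeneous (unit_vec j) 1 (\<lambda>r. r j)" using homogeneous_coord[of j j] by simp
  have hom: "homogeneous (unit_vec j) n (H n)" for n
  proof -
    have "homogeneous (unit_vec j) (- n + (- n * 0 + 2 * n * 1)) (H n)"
      unfolding H_def
      by (rule homogeneous_mult[OF F(3) homogeneous_mult[OF homogeneous_powi[OF hX] homogeneous_powi[OF hj]]])
    then show ?thesis by simp
  qed
  have sum: "g (cluster_step j B r) = (\<Sum>n\<in>uminus ` I. H n r)" if r: "pos r" for r
  proof -
    have Pr: "?P r > 0" and rj: "r j > 0" using exchange_numerator_pos[OF r] r by auto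
    have "F n (cluster_step j B r) = H (- n) r" for n
    proof -
      have "F n (cluster_step j B r) = F n r * (?P r / r j / r j) powi n"
        using homogeneous_unit_vec[OF F(3)[of n] r divide_pos_pos[OF Pr rj]]
        by (simp only: cluster_step_def mutated_variable_eq)
      also have "(?P r / r j / r j) powi n = ?P r powi n / r j powi n / r j powi n"
        by (simp only: power_int_divide_distrib)
      finally have 1: "F n (cluster_step j B r) = F n r * (?P r powi n / r j powi n / r j powi n)" .
      have "r j powi (- n + - n) = r j powi (- n) * r j powi (- n)"
        by (rule power_int_add) (use rj in simp)
      then have 2: "r j powi (2 * - n) = inverse (r j powi n) * inverse (r j powi n)"
        by (simp only: mult_2 power_int_minus)
      show ?thesis unfolding 1 H_def 2 minus_minus divide_inverse by (simp only: mult.assoc)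
    qed
    moreover have "(\<Sum>n\<in>uminus ` I. H n r) = (\<Sum>n\<in>I. H (- n) r)"
      by (subst sum.reindex) auto
    ultimately show ?thesis
      using F(5)[OF cluster_step_pos[OF r, of j B]] by simp
  qed
  have X: "laurent (\<lambda>r. F n r * ?P r powi n)" if n: "n \<in> I" for n
  proof -
    have "laurent (H (- n))"
      using laurent_component[OF g(2) _ hom sum, of "- n"] F(1) n by simp
    from laurent_mult[OF this laurent_powi_coord[of j "2 * n"]] show ?thesis
    proof (rule laurent.cong)
      fix r :: "'a \<Rightarrow> real" assume "pos r"
      then have "r j \<noteq> 0" by (simp add: less_imp_neq[symmetric])
      then have "r j powi (2 * - n) * r j powi (2 * n) = 1"
        by (simp add: power_int_minus)
      then show "H (- n) r * r j powi (2 * n) = F n r * ?P r powi n"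
        by (simp add: H_def mult.assoc)
    qed
  qed
  show ?thesis by (rule that[OF F(1,2,3,5) X])
qed

text \<open>The Laurent phenomenon rests on this exchange of two directions. In the coordinates of the
  final seed, the function becomes Laurent after multiplication by a power of the numerator at
  \<open>j\<close>, since it is Laurent in the seed mutated at \<open>k\<close>. It also becomes Laurent after
  multiplication by a power of the numerator at \<open>k\<close>, since it is a polynomial in \<open>x\<^sub>j\<close> and its mutation
  \<open>x\<^sub>j'\<close> over the Laurent functions in the other variables. The two numerators are coprime.\<close>

lemma laurent_two_steps:
  fixes g :: "('m::finite \<Rightarrow> real) \<Rightarrow> real"
  assumes B: "skew_symmetrizable B" "independent_columns B M" "j \<in> M" "k \<in> M" "j \<noteq> k"
    and g: "laurent g" "laurent (\<lambda>r. g (cluster_step j B r))" "laurent (\<lambda>r. g (cluster_step k B r))"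
  shows "laurent (\<lambda>r. g (cluster_step k B (cluster_step j (matrix_mutation k B) r)))"
proof -
  define P :: "('m \<Rightarrow> real) \<Rightarrow> real" where "P = exchange_numerator j (matrix_mutation k B)"
  define s :: "('m \<Rightarrow> real) \<Rightarrow> 'm \<Rightarrow> real" where "s = cluster_step j (matrix_mutation k B)"
  define Q where "Q = (\<lambda>r. exchange_numerator k B (s r))"
  define q where "q = (\<lambda>r. cluster_step k B (s r))"
  note pair = exchange_pair[OF B, folded P_def s_def, folded Q_def]
  have P: "laurent P" by (simp add: P_def laurent_exchange_numerator)
  have Ppos: "P r > 0" if "pos r" for r using exchange_numerator_pos[OF that] by (simp add: P_def)
  have s: "s r = r(j := P r / r j)" for r
    by (simp add: s_def P_def cluster_step_def mutated_variable_eq)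
  have spos: "pos (s r)" if "pos r" for r using cluster_step_pos[OF that] by (simp add: s_def)
  have Qpos: "Q r > 0" if "pos r" for r using exchange_numerator_pos[OF spos[OF that]] by (simp add: Q_def)
  have q: "q r = (s r)(k := Q r / r k)" for r
    using B(5) by (simp add: q_def Q_def cluster_step_def mutated_variable_eq s)
  have qpos: "pos (q r)" if "pos r" for r using cluster_step_pos[OF spos[OF that]] by (simp add: q_def)
  have sl: "laurent (\<lambda>r. s r i)" for i
    by (cases "i = j") (simp_all add: s divide_inverse laurent_mult laurent_coord laurent_inverse_coord P)
  have Q: "laurent Q"
    unfolding Q_def exchange_numerator_def
    by (intro laurent.add laurent_prod laurent_power sl)
  have jj: "B $ j $ j = 0" using skew_symmetrizable_diag[OF B(1)] .
  let ?h = "\<lambda>r. g (q r)"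
  have "laurent_localized P ?h"
  proof -
    have inv: "laurent_localized P (\<lambda>r. inverse (s r i))" for i
    proof (cases "i = j")
      case True
      have "laurent (\<lambda>r. P r ^ 1 * inverse (s r i))"
      proof (rule laurent.cong[OF laurent_coord[of j]])
        fix r :: "'m \<Rightarrow> real" assume "pos r"
        then show "r j = P r ^ 1 * inverse (s r i)"
          using Ppos[of r] True by (simp add: s less_imp_neq[symmetric])
      qed
      then show ?thesis unfolding laurent_localized_def by blast
    next
      case False
      then show ?thesis by (simp add: s localized_laurent laurent_inverse_coord)
    qed
    from localized_compose[OF g(3) P spos localized_laurent[OF sl] this]
    show ?thesis by (simp add: q_def)
  qed
  moreover have "laurent_localized Q ?h"
  proof -
    obtain I F where F: "finite I" "\<And>n. laurent (F n)" "\<And>n. homogeneous (unit_vec j) n (F n)"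
      "\<And>r. pos r \<Longrightarrow> g r = (\<Sum>n\<in>I. F n r)"
      "\<And>n. n \<in> I \<Longrightarrow> laurent (\<lambda>r. F n r * exchange_numerator j B r powi n)"
      using exchange_components[OF B(1) g(1,2)] by blast
    (* Functions of the coordinates other than j only see the mutation at k. *)
    have other: "laurent_localized Q (\<lambda>r. f ((q r)(j := 1)))" if f: "laurent f" for f
    proof (rule localized_compose[OF f Q])
      fix r :: "'m \<Rightarrow> real" assume "pos r"
      then show "pos ((q r)(j := 1))" using qpos by simp
    next
      fix i
      have "((q r)(j := 1)) i = (if i = j then 1 else if i = k then Q r * inverse (r k) else r i)" for r
        by (simp add: q s divide_inverse)
      then show "laurent_localized Q (\<lambda>r. ((q r)(j := 1)) i)"
        by (cases "i = j"; cases "i = k")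
           (simp_all add: localized_laurent laurent_one laurent_coord laurent_mult Q laurent_inverse_coord)
      show "laurent_localized Q (\<lambda>r. inverse (((q r)(j := 1)) i))"
      proof (cases "i = k")
        case True
        have "laurent (\<lambda>r. Q r ^ 1 * inverse (((q r)(j := 1)) i))"
        proof (rule laurent.cong[OF laurent_coord[of k]])
          fix r :: "'m \<Rightarrow> real" assume "pos r"
          then show "r k = Q r ^ 1 * inverse (((q r)(j := 1)) i)"
            using Qpos[of r] True B(5) by (simp add: q less_imp_neq[symmetric])
        qed
        then show ?thesis unfolding laurent_localized_def by blast
      next
        case False
        then show ?thesis
          by (cases "i = j") (simp_all add: q s localized_laurent laurent_one laurent_inverse_coord)
      qed
    qed
    have red: "f (q r) = f ((q r)(j := 1)) * (q r j) powi n"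
      if "homogeneous (unit_vec j) n f" "pos r" for f n r
    proof -
      have "q r j > 0" using qpos[OF that(2)] by blast
      then show ?thesis
        using homogeneous_unit_vec[OF that(1) qpos[OF that(2)], of 1]
        by (simp add: power_int_divide_distrib)
    qed
    have qj: "q r j = s r j" for r using B(5) by (simp add: q)
    have "laurent_localized Q (\<lambda>r. F n (q r))" if n: "n \<in> I" for n
    proof (cases "n \<ge> 0")
      case True
      have "laurent (\<lambda>r. (q r j) powi n)"
        using laurent_power[OF sl[of j], of "nat n"] True by (simp add: qj power_int_nonneg_exp)
      from localized_mult[OF other[OF F(2)[of n]] localized_laurent[OF this]]
      show ?thesis by (rule localized_cong) (simp add: red[OF F(3)])
    next
      case False
      let ?X = "exchange_numerator j B"
      let ?G = "\<lambda>r. F n r * ?X r powi n"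
      have hom: "homogeneous (unit_vec j) n ?G"
        using homogeneous_mult[OF F(3)[of n] homogeneous_powi[OF homogeneous_exchange_numerator[of B j, OF jj], of n]]
        by simp
      have "laurent (\<lambda>r. (?X (q r) / q r j) ^ nat (- n))"
        unfolding q_def by (rule laurent_power[OF pair(2)])
      from localized_mult[OF other[OF F(5)[OF n]] localized_laurent[OF this]]
      show ?thesis
      proof (rule localized_cong)
        fix r :: "'m \<Rightarrow> real" assume r: "pos r"
        have pos: "?X (q r) > 0" "q r j > 0"
          using exchange_numerator_pos[OF qpos[OF r]] qpos[OF r] by auto
        have "(?X (q r) / q r j) ^ nat (- n) = q r j powi n / ?X (q r) powi n"
          using False by (simp add: power_int_def power_divide divide_inverse power_inverse power_mult_distrib)
        then have "?G ((q r)(j := 1)) * (?X (q r) / q r j) ^ nat (- n)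
            = (?G ((q r)(j := 1)) * q r j powi n) / ?X (q r) powi n"
          by (simp only: times_divide_eq_right)
        also have "?G ((q r)(j := 1)) * q r j powi n = F n (q r) * ?X (q r) powi n"
          by (rule red[OF hom r, symmetric])
        also have "F n (q r) * ?X (q r) powi n / ?X (q r) powi n = F n (q r)"
          using pos(1) by simp
        finally show "?G ((q r)(j := 1)) * (?X (q r) / q r j) ^ nat (- n) = F n (q r)" .
      qed
    qed
    then have "laurent_localized Q (\<lambda>r. \<Sum>n\<in>I. F n (q r))" by (intro localized_sum Q)
    then show ?thesis by (rule localized_cong) (rule F(4)[OF qpos, symmetric])
  qed
  ultimately have "laurent ?h" by (rule coprime_localized[OF pair(1) P Q])
  then show ?thesis by (simp add: q_def s_def)
qed

text \<open>The upper bound does not depend on the seed. Since coordinates belong to the upper bound of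
  their own seed, all cluster variables are Laurent in every seed; the same holds for every other
  function in the upper bound of one seed.\<close>

theorem upper_bound_mutation:
  assumes B: "skew_symmetrizable B" "independent_columns B M" "k \<in> M" and g: "upper_bound B M g"
  shows "upper_bound (matrix_mutation k B) M (\<lambda>r. g (cluster_step k B r))"
  unfolding upper_bound_def
proof (intro conjI ballI)
  show "laurent (\<lambda>r. g (cluster_step k B r))" using g B(3) by (simp add: upper_bound_def)
  fix j assume j: "j \<in> M"
  show "laurent (\<lambda>r. g (cluster_step k B (cluster_step j (matrix_mutation k B) r)))"
  proof (cases "j = k")
    case True
    have g0: "laurent g" using g by (simp add: upper_bound_def)
    have "g r = g (cluster_step k B (cluster_step k (matrix_mutation k B) r))" if r: "pos r" for r
    proof -
      have "r k \<noteq> 0" "exchange_numerator k B r \<noteq> 0"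
        using r exchange_numerator_pos[OF r, of k B] by (metis less_irrefl)+
      from cluster_step_involutive[OF B(1) this] show ?thesis
        by (simp add: cluster_step_mutation)
    qed
    then show ?thesis unfolding True by (rule laurent.cong[OF g0])
  next
    case False
    show ?thesis
      using g j B(3) by (intro laurent_two_steps[OF B(1,2) j B(3) False]) (simp_all add: upper_bound_def)
  qed
qed

lemma independent_columns_along:
  "independent_columns B M \<Longrightarrow> skew_symmetrizable B \<Longrightarrow> set ks \<subseteq> M \<Longrightarrow>
    independent_columns (matrix_along ks B) M"
  by (induction ks arbitrary: B) (auto simp: independent_columns_mutation skew_symmetrizable_mutation)

lemma upper_bound_along:
  assumes "skew_symmetrizable B" "independent_columns B M" "set ks \<subseteq> M"
    and "upper_bound (matrix_along ks B) M g"
  shows "upper_bound B M (\<lambda>r. g (cluster_along ks B r))"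
  using assms
proof (induction ks arbitrary: B)
  case (Cons k ks)
  have k: "k \<in> M" using Cons.prems(3) by simp
  have B': "skew_symmetrizable (matrix_mutation k B)" "independent_columns (matrix_mutation k B) M"
    using Cons.prems k by (simp_all add: skew_symmetrizable_mutation independent_columns_mutation)
  have "upper_bound (matrix_mutation k B) M (\<lambda>r. g (cluster_along ks (matrix_mutation k B) r))"
    using Cons.IH[OF B'] Cons.prems by simp
  from upper_bound_mutation[OF B' k this] show ?case
    by (simp add: matrix_mutation_involutive[OF Cons.prems(1)] cluster_step_mutation)
qed simp

lemma upper_bound_coord: "upper_bound B M (\<lambda>r. r i)"
proof -
  have "laurent (\<lambda>r. cluster_step k B r i)" for k
    by (cases "i = k")
       (simp_all add: cluster_step_def mutated_variable_eq divide_inverse laurent_coord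
          laurent_mult laurent_exchange_numerator laurent_inverse_coord)
  then show ?thesis by (simp add: upper_bound_def laurent_coord)
qed

lemma upper_bound_cluster_along:
  assumes "skew_symmetrizable B" "independent_columns B M" "set ks \<subseteq> M"
  shows "upper_bound B M (\<lambda>r. cluster_along ks B r i)"
  by (rule upper_bound_along[OF assms upper_bound_coord])

section \<open>Principal coefficients\<close>

text \<open>Linear independence of the columns is forced by doubling the index set: below \<open>B\<close> stands an
  identity block, whose rows belong to frozen variables. The blocks on the right make the
  matrix skew-symmetrizable again. Setting the frozen variables to 1 gives back the mutations of
  \<open>B\<close>.\<close>

definition framed :: "int ^ 'n ^ 'n \<Rightarrow> int ^ ('n + 'n) ^ ('n + 'n::finite)" where
  "framed B = (\<chi> a b. case a of
       Inl i \<Rightarrow> (case b of Inl j \<Rightarrow> B $ i $ j | Inr j \<Rightarrow> if i = j then - 1 else 0)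
     | Inr i \<Rightarrow> (case b of Inl j \<Rightarrow> if i = j then 1 else 0 | Inr j \<Rightarrow> 0))"

definition mutable_part :: "int ^ ('n + 'n) ^ ('n + 'n) \<Rightarrow> int ^ 'n ^ 'n::finite" where
  "mutable_part B = (\<chi> i j. B $ Inl i $ Inl j)"

abbreviation with_ones :: "('n \<Rightarrow> real) \<Rightarrow> 'n + 'n \<Rightarrow> real" where
  "with_ones q \<equiv> case_sum q (\<lambda>_. 1)"

lemma mutable_part_framed [simp]: "mutable_part (framed B) = B"
  by (simp add: mutable_part_def framed_def vec_eq_iff)

lemma skew_symmetrizable_framed:
  assumes "skew_symmetrizable B" shows "skew_symmetrizable (framed B)"
proof -
  obtain d :: "'a \<Rightarrow> int" where d: "\<forall>i. d i > 0" "\<forall>i j. d i * B $ i $ j = - (d j * B $ j $ i)"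
    using assms by (auto simp: skew_symmetrizable_def)
  have "case_sum d d a * framed B $ a $ b = - (case_sum d d b * framed B $ b $ a)" for a b
    by (cases a; cases b) (auto simp: framed_def intro: d(2)[rule_format])
  moreover have "\<forall>a. case_sum d d a > 0" using d(1) by (auto split: sum.split)
  ultimately show ?thesis unfolding skew_symmetrizable_def by blast
qed

lemma independent_columns_framed:
  fixes B :: "int ^ 'n ^ 'n"
  shows "independent_columns (framed B) (range (Inl :: 'n \<Rightarrow> 'n + 'n))"
  unfolding independent_columns_def
proof (intro allI impI ballI)
  fix v :: "'n + 'n \<Rightarrow> int" and a :: "'n + 'n"
  assume v: "\<forall>i. (\<Sum>j\<in>range Inl. framed B $ i $ j * v j) = 0" and "a \<in> range Inl"
  then obtain i where a: "a = Inl i" by blast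
  have "(\<Sum>j\<in>range (Inl :: 'n \<Rightarrow> 'n + 'n). framed B $ Inr i $ j * v j) = (\<Sum>j\<in>UNIV. (if i = j then 1 else 0) * v (Inl j))"
    by (subst sum.reindex) (auto simp: framed_def)
  also have "\<dots> = (\<Sum>j\<in>UNIV. if i = j then v (Inl j) else 0)" by (rule sum.cong) auto
  also have "\<dots> = v (Inl i)" by simp
  finally show "v a = 0" using v a by simp
qed

lemma mutable_part_mutation:
  "mutable_part (matrix_mutation (Inl k) B) = matrix_mutation k (mutable_part B)"
  by (simp add: mutable_part_def matrix_mutation_def vec_eq_iff)

lemma prod_sum_type: "(\<Prod>a\<in>(UNIV :: ('n::finite + 'n) set). f a) = (\<Prod>i\<in>UNIV. f (Inl i)) * (\<Prod>i\<in>UNIV. f (Inr i))"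
  by (simp add: UNIV_Plus_UNIV[symmetric] prod.Plus del: UNIV_Plus_UNIV)

lemma cluster_step_with_ones:
  "cluster_step (Inl k) B (with_ones q) = with_ones (cluster_step k (mutable_part B) q)"
proof
  fix a
  show "cluster_step (Inl k) B (with_ones q) a = with_ones (cluster_step k (mutable_part B) q) a"
    by (cases a) (simp_all add: cluster_step_def mutated_variable_def prod_sum_type mutable_part_def)
qed

lemma cluster_along_with_ones:
  "cluster_along (map Inl ks) B (with_ones q) = with_ones (cluster_along ks (mutable_part B) q)"
  by (induction ks arbitrary: B q) (simp_all add: cluster_step_with_ones mutable_part_mutation)

lemma pos_with_ones: "pos q \<Longrightarrow> pos (with_ones q)"
  by (auto split: sum.split)

text \<open>The Laurent phenomenon for an arbitrary skew-symmetrizable matrix, by specialization of the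
  frozen variables.\<close>

theorem laurent_cluster_along:
  assumes "skew_symmetrizable B" shows "laurent (\<lambda>q. cluster_along ks B q i)"
proof -
  have "upper_bound (framed B) (range Inl) (\<lambda>r. cluster_along (map Inl ks) (framed B) r (Inl i))"
    by (rule upper_bound_cluster_along[OF skew_symmetrizable_framed[OF assms] independent_columns_framed]) auto
  then have l: "laurent (\<lambda>r. cluster_along (map Inl ks) (framed B) r (Inl i))"
    by (simp add: upper_bound_def)
  have c: "laurent (\<lambda>q. with_ones q a)" for a :: "'a + 'a"
    by (cases a) (simp_all add: laurent_coord laurent_one)
  have c': "laurent (\<lambda>q. inverse (with_ones q a))" for a :: "'a + 'a"
    by (cases a) (simp_all add: laurent_inverse_coord laurent_one)
  have "laurent (\<lambda>q. cluster_along (map Inl ks) (framed B) (with_ones q) (Inl i))"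
    by (rule laurent_compose[OF l pos_with_ones c c'])
  then show ?thesis by (simp add: cluster_along_with_ones)
qed

section \<open>Growth of cluster variables\<close>

lemma growth_coord: "growth w (\<lambda>r. r i) (w i)"
proof (rule growth_homogeneous)
  show "homogeneous w (w i) (\<lambda>r. r i)" by (simp add: homogeneous_def scale_def)
qed simp

lemma growth_exchange_numerator:
  assumes "\<And>i. growth w (\<lambda>r. p r i) (E i)"
  shows "growth w (\<lambda>r. exchange_numerator k B (p r))
    (min (\<Sum>i\<in>UNIV. pos_part (B $ i $ k) * E i) (\<Sum>i\<in>UNIV. pos_part (- B $ i $ k) * E i))"
proof -
  have eq: "int (nat (pos_part a)) = pos_part a" for a by (simp add: pos_part_def)
  have "growth w (\<lambda>r. exchange_numerator k B (p r))
    (min (\<Sum>i\<in>UNIV. int (nat (pos_part (B $ i $ k))) * E i)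
         (\<Sum>i\<in>UNIV. int (nat (pos_part (- B $ i $ k))) * E i))"
    unfolding exchange_numerator_def
    by (intro growth_add growth_prod growth_power assms)
  then show ?thesis by (simp only: eq)
qed

text \<open>Growth exponents change by tropical mutation.\<close>

lemma growth_cluster_step:
  assumes "\<And>i. growth w (\<lambda>r. p r i) (E i)"
  shows "growth w (\<lambda>r. cluster_step k B (p r) i) (if i = k then
     min (\<Sum>i\<in>UNIV. pos_part (B $ i $ k) * E i) (\<Sum>i\<in>UNIV. pos_part (- B $ i $ k) * E i) - E k else E i)"
proof (cases "i = k")
  case True
  from growth_mult[OF growth_exchange_numerator[OF assms, where k = k and B = B] growth_inverse[OF assms[of k]]]
  show ?thesis using True by (simp add: cluster_step_def mutated_variable_eq divide_inverse)
next
  case False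
  then show ?thesis using assms[of i] by (simp add: cluster_step_def)
qed

lemma growth_cluster_along:
  assumes "\<And>i. growth w (\<lambda>r. p r i) (E i)"
  obtains E' where "\<And>i. growth w (\<lambda>r. cluster_along ks B (p r) i) (E' i)"
proof -
  have "\<exists>E'. \<forall>i. growth w (\<lambda>r. cluster_along ks B (p r) i) (E' i)"
    using assms
  proof (induction ks arbitrary: B p E)
    case Nil
    then show ?case by auto
  next
    case (Cons k ks)
    show ?case using Cons.IH[OF growth_cluster_step[OF Cons.prems, where k = k and B = B]] by simp
  qed
  then show ?thesis using that by blast
qed

corollary growth_cluster_variable:
  fixes B :: "int ^ 'm ^ 'm" and w :: "'m::finite \<Rightarrow> int"
  obtains e where "growth w (\<lambda>r. cluster_along ks B r i) e"
proof -
  obtain E where "\<And>i. growth w (\<lambda>r. cluster_along ks B r i) (E i)"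
    using growth_cluster_along[of w "\<lambda>r. r" w ks B, OF growth_coord] by blast
  from that[OF this] show ?thesis .
qed

lemma dot_unit_vec: "dot w (unit_vec i) = w i"
proof -
  have "dot w (unit_vec i) = (\<Sum>j\<in>UNIV. if j = i then w j else 0)"
    unfolding dot_def by (rule sum.cong) (auto simp: unit_vec_def)
  then show ?thesis by simp
qed

text \<open>If the product of two Laurent functions is a coordinate, then the factors are homogeneous in
  every direction: their degrees spread over two intervals whose lengths add up to zero.\<close>

lemma laurent_factor_of_coord:
  assumes f: "laurent f" "laurent g" "\<And>r. pos r \<Longrightarrow> f r * g r = r j"
    and E: "growth w f a" "growth (\<lambda>i. - w i) f b" and fpos: "\<And>r. pos r \<Longrightarrow> f r > 0"
  shows "homogeneous w a f"
proof -
  have g: "r j * inverse (f r) = g r" if "pos r" for r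
    using f(3)[OF that, symmetric] fpos[OF that] by simp
  have "growth w g (w j + - a)"
    by (rule growth_cong[OF growth_mult[OF growth_coord growth_inverse[OF E(1)]] g])
  moreover have "growth (\<lambda>i. - w i) g (- w j + - b)"
    by (rule growth_cong[OF growth_mult[OF growth_coord growth_inverse[OF E(2)]] g])
  ultimately have "w j + - a \<le> - (- w j + - b)" by (rule laurent_growth_opposite(1)[OF f(2)])
  moreover have "a \<le> - b" by (rule laurent_growth_opposite(1)[OF f(1) E])
  ultimately have "a = - b" by simp
  then show ?thesis by (rule laurent_growth_opposite(2)[OF f(1) E])
qed

lemma homogeneous_all_monomial:
  fixes f :: "('m::finite \<Rightarrow> real) \<Rightarrow> real"
  assumes "\<And>i. homogeneous (unit_vec i) (m i) f" "pos r"
  shows "f r = f (\<lambda>_. 1) * lmon m r"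
proof -
  have "f (\<lambda>i. if i \<in> A then r i else 1) = f (\<lambda>_. 1) * (\<Prod>i\<in>A. r i powi m i)" if "finite A" for A
    using that
  proof (induction A)
    case (insert k A)
    let ?p = "\<lambda>i. if i \<in> A then r i else 1"
    have "(\<lambda>i. if i \<in> insert k A then r i else 1) = ?p(k := r k)" by auto
    moreover have "f (?p(k := r k)) = f ?p * (r k / ?p k) powi m k"
      using assms(2) by (intro homogeneous_unit_vec assms(1)) auto
    ultimately show ?case using insert by simp
  qed simp
  from this[of UNIV] show ?thesis by (simp add: lmon_def)
qed

text \<open>A negative exponent of \<open>x\<^sub>k\<close> would make a negative power of the exchange numerator at \<open>k\<close> a
  Laurent function. In the direction of the column, however, the two monomials of the numerator
  have different degrees, and the top degree of the inverse would be smaller than its lowest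
  degree.\<close>

lemma upper_bound_monomial:
  assumes B: "skew_symmetrizable B" "B $ p $ k \<noteq> 0" "k \<in> M"
    and g: "upper_bound B M g" "\<And>r. pos r \<Longrightarrow> g r = lmon m r"
  shows "m k \<ge> 0"
proof (rule ccontr)
  assume neg: "\<not> m k \<ge> 0"
  define n where "n = nat (- m k)"
  have n: "m k = - int n" "n > 0" using neg by (auto simp: n_def)
  let ?P = "exchange_numerator k B"
  define m' where "m' = m(k := - m k)"
  have "laurent (\<lambda>r. g (cluster_step k B r))" using g(1) B(3) by (simp add: upper_bound_def)
  from laurent_mult[OF this laurent_lmon[of "\<lambda>i. - m' i"]]
  have "laurent (\<lambda>r. inverse (?P r) ^ n)"
  proof (rule laurent.cong)
    fix r :: "'a \<Rightarrow> real" assume r: "pos r"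
    have rk: "r k > 0" and P: "?P r > 0" using r exchange_numerator_pos[OF r] by auto
    have 1: "g (cluster_step k B r) = lmon (m(k := 0)) r * (?P r / r k) powi m k"
      using g(2)[OF cluster_step_pos[OF r, of k B]]
      by (simp only: cluster_step_def mutated_variable_eq lmon_upd)
    have "lmon m' r = lmon (m(k := 0)) r * r k powi (- m k)"
      using lmon_upd[of m' r k "r k"] by (simp add: m'_def)
    then have 2: "lmon (\<lambda>i. - m' i) r = inverse (lmon (m(k := 0)) r * r k powi (- m k))"
      using lmon_uminus[OF r, of "m'"] by simp
    have "lmon (m(k := 0)) r > 0" using lmon_pos[OF r] .
    then show "g (cluster_step k B r) * lmon (\<lambda>i. - m' i) r = inverse (?P r) ^ n"
      unfolding 1 2 n(1) using rk P
      by (simp add: power_int_minus power_divide divide_inverse power_inverse power_mult_distrib)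
         (simp add: field_simps)
  qed
  moreover define u where "u = (\<lambda>i. B $ i $ k)"
  define a where "a = (\<Sum>i\<in>UNIV. pos_part (B $ i $ k) * u i)"
  define b where "b = (\<Sum>i\<in>UNIV. pos_part (- B $ i $ k) * u i)"
  have "growth u (\<lambda>r. inverse (?P r) ^ n) (int n * - min a b)"
    unfolding a_def b_def
    by (intro growth_power growth_inverse growth_exchange_numerator growth_coord)
  moreover have "growth (\<lambda>i. - u i) (\<lambda>r. inverse (?P r) ^ n) (int n * - min (- a) (- b))"
  proof -
    have "growth (\<lambda>i. - u i) (\<lambda>r. inverse (?P r) ^ n) (int n * - min
        (\<Sum>i\<in>UNIV. pos_part (B $ i $ k) * - u i) (\<Sum>i\<in>UNIV. pos_part (- B $ i $ k) * - u i))"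
      by (intro growth_power growth_inverse growth_exchange_numerator growth_coord)
    then show ?thesis by (simp add: a_def b_def sum_negf)
  qed
  ultimately have "int n * - min a b \<le> - (int n * - min (- a) (- b))"
    by (rule laurent_growth_opposite(1))
  then have "int n * max a b \<le> int n * min a b" by (simp add: min_def max_def split: if_splits)
  then have "max a b \<le> min a b" using n(2) by simp
  then have "a = b" by (simp add: min_def max_def split: if_splits)
  have "a - b = (\<Sum>i\<in>UNIV. u i * u i)"
    unfolding a_def b_def sum_subtractf[symmetric]
    by (rule sum.cong) (auto simp: left_diff_distrib[symmetric] u_def pos_part_def)
  moreover have "(\<Sum>i\<in>UNIV. u i * u i) > 0"
    using B(2) by (intro sum_pos2[of _ p]) (auto simp: u_def zero_less_mult_iff)
  ultimately show False using \<open>a = b\<close> by simp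
qed

lemma scale_with_ones: "scale (unit_vec (Inl k)) s (with_ones q) = with_ones (scale (unit_vec k) s q)"
proof
  fix a show "scale (unit_vec (Inl k)) s (with_ones q) a = with_ones (scale (unit_vec k) s q) a"
    by (cases a) (simp_all add: scale_def unit_vec_def)
qed

text \<open>If a cluster variable \<open>z\<close> vanishes to positive order along \<open>y\<^sub>k = 0\<close>, then \<open>z = y\<^sub>k\<close>. For then
  \<open>z / y\<^sub>k\<close> is still Laurent in the seed of \<open>y\<close> and in all its neighbours, hence in the seed of \<open>z\<close>
  and its neighbours. So \<open>y\<^sub>k\<close> divides the coordinate \<open>z\<close> there: it is a monomial, its exponents at
  the mutable variables lie between 0 and those of \<open>z\<close>, and they are not all 0. Principal
  coefficients make the Laurent phenomenon available for quotients; the frozen variables are set to 1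
  at the end.\<close>

theorem cluster_variable_vanishing:
  fixes B :: "int ^ 'n ^ 'n" and j k :: "'n::finite"
  assumes B: "skew_symmetrizable B"
    and e: "growth (unit_vec k) (\<lambda>q. cluster_along ks B q j) e" "e > 0" and q: "pos q"
  shows "cluster_along ks B q j = q k"
proof -
  define A where "A = framed B"
  define M where "M = range (Inl :: 'n \<Rightarrow> 'n + 'n)"
  define ls where "ls = map (Inl :: 'n \<Rightarrow> 'n + 'n) ks"
  define A2 where "A2 = matrix_along ls A"
  have A: "skew_symmetrizable A" "independent_columns A M" and ls: "set ls \<subseteq> M" "set (rev ls) \<subseteq> M"
    using skew_symmetrizable_framed[OF B] independent_columns_framed[of B]
    by (auto simp: A_def M_def ls_def)
  have A2: "skew_symmetrizable A2" "independent_columns A2 M"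
    using skew_symmetrizable_along[OF A(1)] independent_columns_along[OF A(2,1) ls(1)]
    by (auto simp: A2_def)
  have inverse_path: "matrix_along (rev ls) A2 = A"
    unfolding A2_def by (rule matrix_along_rev[OF A(1)])
  define Z where "Z = (\<lambda>r :: 'n + 'n \<Rightarrow> real. cluster_along ls A r (Inl j))"
  have Z: "upper_bound A M Z" unfolding Z_def by (rule upper_bound_cluster_along[OF A ls(1)])
  let ?k = "Inl k :: 'n + 'n"
  let ?w = "unit_vec ?k"
  obtain e' where "growth ?w (\<lambda>r. cluster_along ls A r (Inl j)) e'"
    by (rule growth_cluster_variable)
  then have ZE: "growth ?w Z e'" by (simp add: Z_def)
  have "growth (unit_vec k) (\<lambda>q. Z (with_ones q)) e'"
    unfolding growth_def
  proof (intro allI impI)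
    fix q :: "'n \<Rightarrow> real" assume "pos q"
    then have "pos (with_ones q)" by (rule pos_with_ones)
    from mp[OF spec[OF ZE[unfolded growth_def]] this] show "\<exists>c C. c > 0 \<and> (\<forall>s. 0 < s \<and> s < 1 \<longrightarrow>
        c * s powi e' \<le> Z (with_ones (scale (unit_vec k) s q)) \<and>
        Z (with_ones (scale (unit_vec k) s q)) \<le> C * s powi e')"
      unfolding scale_with_ones .
  qed
  moreover have "Z (with_ones q) = cluster_along ks B q j" for q
    by (simp add: Z_def ls_def A_def cluster_along_with_ones)
  ultimately have "growth (unit_vec k) (\<lambda>q. cluster_along ks B q j) e'" by simp
  from growth_unique[OF this e(1)] have Zgrowth: "growth ?w Z e" using ZE by simp
  define L where "L = (\<lambda>r. Z r * inverse (r ?k))"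
  have "upper_bound A M L"
    unfolding upper_bound_def
  proof (intro conjI ballI)
    show "laurent L"
      unfolding L_def using Z by (intro laurent_mult laurent_inverse_coord) (simp add: upper_bound_def)
    fix i assume i: "i \<in> M"
    show "laurent (\<lambda>r. L (cluster_step i A r))"
    proof (cases "i = ?k")
      case False
      then have "cluster_step i A r ?k = r ?k" for r :: "'n + 'n \<Rightarrow> real" by (simp add: cluster_step_def)
      then show ?thesis
        unfolding L_def using Z i
        by (simp add: upper_bound_def laurent_mult laurent_inverse_coord)
    next
      case True
      obtain I F where F: "finite I" "\<And>n. laurent (F n)" "\<And>n. homogeneous ?w n (F n)"
        "\<And>n r. n \<notin> I \<Longrightarrow> F n r = 0" "\<And>r. pos r \<Longrightarrow> Z r = (\<Sum>n\<in>I. F n r)"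
        using laurent_components[of Z ?w] Z unfolding upper_bound_def by blast
      let ?P = "exchange_numerator ?k A"
      have "laurent (\<lambda>r. \<Sum>n\<in>{n \<in> I. n \<ge> e}. F n r * (?P r ^ nat (n - 1) * r ?k powi (1 - 2 * n)))"
        by (intro laurent_sum laurent_mult F(2) laurent_power laurent_exchange_numerator laurent_powi_coord)
      then show ?thesis
      proof (rule laurent.cong)
        fix r :: "'n + 'n \<Rightarrow> real" assume r: "pos r"
        have P: "?P r > 0" and rk: "r ?k > 0" using exchange_numerator_pos[OF r] r by auto
        have step: "cluster_step i A r = r(?k := ?P r / r ?k)"
          using True by (simp add: cluster_step_def mutated_variable_eq)
        have spos: "pos (cluster_step i A r)" by (rule cluster_step_pos[OF r])
        have L: "L (cluster_step i A r) = Z (cluster_step i A r) * inverse (?P r / r ?k)"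
          unfolding L_def by (simp add: step)
        have "Z (cluster_step i A r) = (\<Sum>n\<in>I. F n (cluster_step i A r))" by (rule F(5)[OF spos])
        also have "\<dots> = (\<Sum>n\<in>{n \<in> I. n \<ge> e}. F n (cluster_step i A r))"
        proof (rule sum.mono_neutral_right[OF F(1)])
          show "\<forall>n\<in>I - {n \<in> I. e \<le> n}. F n (cluster_step i A r) = 0"
          proof
            fix n assume "n \<in> I - {n \<in> I. e \<le> n}"
            then have "n \<in> I" "n < e" by auto
            from growth_component_zero[OF Zgrowth F(1) F(3) F(5) this spos]
            show "F n (cluster_step i A r) = 0" .
          qed
        qed blast
        finally have Zs: "Z (cluster_step i A r) = (\<Sum>n\<in>{n \<in> I. n \<ge> e}. F n (cluster_step i A r))" .
        have "L (cluster_step i A r) =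
            (\<Sum>n\<in>{n \<in> I. n \<ge> e}. F n (cluster_step i A r) * inverse (?P r / r ?k))"
          by (rule trans[OF L], subst Zs, rule sum_distrib_right)
        also have "\<dots> = (\<Sum>n\<in>{n \<in> I. n \<ge> e}. F n r * (?P r ^ nat (n - 1) * r ?k powi (1 - 2 * n)))"
        proof (rule sum.cong[OF refl])
          fix n assume "n \<in> {n \<in> I. n \<ge> e}"
          then have n: "n \<ge> 1" using e(2) by simp
          have alg: "f * (a * p / R / R) * inverse (p / x) = f * (a * (x / (R * R)))"
            if "p \<noteq> 0" for f a p R x :: real using that by simp
          have 1: "F n (cluster_step i A r) = F n r * (?P r / r ?k / r ?k) powi n"
            unfolding step by (rule homogeneous_unit_vec[OF F(3) r divide_pos_pos[OF P rk]])
          have 2: "?P r powi n = ?P r ^ nat (n - 1) * ?P r"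
            using n power_int_add[of "?P r" "n - 1" 1] P by (simp add: power_int_nonneg_exp)
          have 3: "r ?k powi (1 - 2 * n) = r ?k / (r ?k powi n * r ?k powi n)"
          proof -
            have "r ?k powi (1 - (n + n)) = r ?k powi 1 / r ?k powi (n + n)"
              by (rule power_int_diff) (use rk in simp)
            also have "r ?k powi (n + n) = r ?k powi n * r ?k powi n"
              by (rule power_int_add) (use rk in simp)
            finally show ?thesis by simp
          qed
          show "F n (cluster_step i A r) * inverse (?P r / r ?k) =
              F n r * (?P r ^ nat (n - 1) * r ?k powi (1 - 2 * n))"
            unfolding 1 power_int_divide_distrib 2 3 by (rule alg) (use P in simp)
        qed
        finally show "(\<Sum>n\<in>{n \<in> I. n \<ge> e}. F n r * (?P r ^ nat (n - 1) * r ?k powi (1 - 2 * n)))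
            = L (cluster_step i A r)" by (rule sym)
      qed
    qed
  qed
  (* Now pass to the coordinates of the seed that contains z. *)
  then have L2: "upper_bound A2 M (\<lambda>r. L (cluster_along (rev ls) A2 r))"
    by (intro upper_bound_along[OF A2 ls(2)]) (simp add: inverse_path)
  define Y where "Y = (\<lambda>r :: 'n + 'n \<Rightarrow> real. cluster_along (rev ls) A2 r ?k)"
  have Y: "upper_bound A2 M Y" unfolding Y_def by (rule upper_bound_cluster_along[OF A2 ls(2)])
  have Ypos: "Y r > 0" if "pos r" for r using cluster_along_pos[OF that] by (simp add: Y_def)
  have rev: "cluster_along ls A (cluster_along (rev ls) A2 r) = r" if "pos r" for r
    using cluster_along_rev_pos[OF A2(1) that, of "rev ls"] by (simp add: inverse_path)
  have LY: "L (cluster_along (rev ls) A2 r) = r (Inl j) * inverse (Y r)" if "pos r" for r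
    by (simp add: L_def Z_def Y_def rev[OF that])
  have prod: "Y r * L (cluster_along (rev ls) A2 r) = r (Inl j)" if "pos r" for r
    using LY[OF that] Ypos[OF that] by simp
  have "\<exists>a. homogeneous (unit_vec i) a Y" for i
  proof -
    obtain a where "growth (unit_vec i) (\<lambda>r. cluster_along (rev ls) A2 r ?k) a"
      by (rule growth_cluster_variable)
    then have a: "growth (unit_vec i) Y a" by (simp add: Y_def)
    obtain b where "growth (\<lambda>l. - unit_vec i l) (\<lambda>r. cluster_along (rev ls) A2 r ?k) b"
      by (rule growth_cluster_variable)
    then have b: "growth (\<lambda>l. - unit_vec i l) Y b" by (simp add: Y_def)
    have "laurent Y" "laurent (\<lambda>r. L (cluster_along (rev ls) A2 r))"
      using Y L2 by (simp_all add: upper_bound_def)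
    from laurent_factor_of_coord[OF this prod a b Ypos] show ?thesis by blast
  qed
  then obtain m where m: "\<And>i. homogeneous (unit_vec i) (m i) Y" by metis
  (* A positive integer with an integral inverse. *)
  have "Y (\<lambda>_. 1) = 1"
  proof -
    let ?l = "L (cluster_along (rev ls) A2 (\<lambda>_. 1))"
    have "Y (\<lambda>_. 1) \<in> \<int>" "?l \<in> \<int>"
      using Y L2 laurent_at_one_Ints unfolding upper_bound_def by blast+
    then obtain a b where ab: "Y (\<lambda>_. 1) = of_int a" "?l = of_int b" by (metis Ints_cases)
    have "of_int (a * b) = (1 :: real)" using prod[of "\<lambda>_. 1"] by (simp add: ab)
    then have "a * b = 1" by linarith
    moreover have "a > 0" using Ypos[of "\<lambda>_. 1"] by (simp add: ab)
    ultimately have "a = 1" by (simp add: pos_zmult_eq_1_iff)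
    then show ?thesis by (simp add: ab)
  qed
  then have Ym: "Y r = lmon m r" if "pos r" for r
    using homogeneous_all_monomial[OF m that] by simp
  have Lm: "L (cluster_along (rev ls) A2 r) = lmon (\<lambda>i. unit_vec (Inl j) i + - m i) r" if "pos r" for r
    using LY[OF that] lmon_add[OF that, of "unit_vec (Inl j)" "\<lambda>i. - m i"]
    by (simp add: Ym[OF that] lmon_uminus[OF that])
  have range_m: "0 \<le> m (Inl i)" "m (Inl i) \<le> unit_vec (Inl j) (Inl i :: 'n + 'n)" for i
  proof -
    have i: "Inl i \<in> M" by (simp add: M_def)
    obtain p where p: "A2 $ p $ Inl i \<noteq> 0" using independent_columns_nonzero[OF A2(2) i] .
    show "0 \<le> m (Inl i)" by (rule upper_bound_monomial[OF A2(1) p i Y Ym])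
    have "0 \<le> unit_vec (Inl j) (Inl i :: 'n + 'n) + - m (Inl i)"
      by (rule upper_bound_monomial[OF A2(1) p i L2, where m = "\<lambda>i. unit_vec (Inl j) i + - m i"]) (rule Lm)
    then show "m (Inl i) \<le> unit_vec (Inl j) (Inl i :: 'n + 'n)" by simp
  qed
  have eq: "q k = cluster_along ks B q j powi m (Inl j)" if q: "pos q" for q
  proof -
    let ?r = "cluster_along ls A (with_ones q)"
    have r: "?r = with_ones (cluster_along ks B q)"
      by (simp add: ls_def A_def cluster_along_with_ones)
    have rpos: "pos ?r" by (rule cluster_along_pos[OF pos_with_ones[OF q]])
    have "cluster_along (rev ls) A2 ?r = with_ones q"
      unfolding A2_def by (rule cluster_along_rev_pos[OF A(1) pos_with_ones[OF q]])
    then have "q k = Y ?r" by (simp add: Y_def)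
    also have "\<dots> = (\<Prod>i\<in>UNIV. cluster_along ks B q i powi m (Inl i))"
      unfolding Ym[OF rpos] by (simp add: r lmon_def prod_sum_type)
    also have "\<dots> = (\<Prod>i\<in>UNIV. if i = j then cluster_along ks B q j powi m (Inl j) else 1)"
    proof (rule prod.cong[OF refl])
      fix i
      have "m (Inl i) = 0" if "i \<noteq> j" using range_m[of i] that by (simp add: unit_vec_def)
      then show "cluster_along ks B q i powi m (Inl i)
          = (if i = j then cluster_along ks B q j powi m (Inl j) else 1)" by simp
    qed
    finally show ?thesis by simp
  qed
  (* Otherwise the k-th coordinate would be constant. *)
  have "m (Inl j) \<noteq> 0" using eq[of "\<lambda>_. 2"] by auto
  then have "m (Inl j) = 1" using range_m[of j] by (simp add: unit_vec_def)
  then show ?thesis using eq[OF q] by simp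
qed

section \<open>Exchange relations are determined by the cluster\<close>

lemma lmon_permuted:
  assumes "bij \<sigma>" shows "lmon m (\<lambda>i. r (\<sigma> i)) = lmon (\<lambda>i. m (inv \<sigma> i)) r"
proof -
  have "lmon (\<lambda>i. m (inv \<sigma> i)) r = (\<Prod>i\<in>range \<sigma>. r i powi m (inv \<sigma> i))"
    using bij_is_surj[OF assms] by (simp add: lmon_def)
  also have "\<dots> = (\<Prod>i\<in>UNIV. r (\<sigma> i) powi m (inv \<sigma> (\<sigma> i)))"
    by (rule prod.reindex_cong[OF bij_is_inj[OF assms]]) auto
  also have "\<dots> = lmon m (\<lambda>i. r (\<sigma> i))"
    using bij_is_inj[OF assms] by (simp add: lmon_def)
  finally show ?thesis by simp
qed

lemma dot_permuted:
  assumes "bij \<sigma>" shows "dot w (\<lambda>i. m (inv \<sigma> i)) = (\<Sum>i\<in>UNIV. w (\<sigma> i) * m i)"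
proof -
  have "dot w (\<lambda>i. m (inv \<sigma> i)) = (\<Sum>i\<in>range \<sigma>. w i * m (inv \<sigma> i))"
    using bij_is_surj[OF assms] by (simp add: dot_def)
  also have "\<dots> = (\<Sum>i\<in>UNIV. w (\<sigma> i) * m (inv \<sigma> (\<sigma> i)))"
    by (rule sum.reindex_cong[OF bij_is_inj[OF assms]]) auto
  finally show ?thesis using bij_is_inj[OF assms] by simp
qed

text \<open>Suppose that two seeds have the same cluster. By the Laurent phenomenon the new variable of
  the second seed at \<open>u\<close> is Laurent in the first seed mutated at \<open>u\<close>. So the exchange numerator of
  the first seed divides that of the second one, and the difference of the degrees of its two
  monomials is at most as large in every direction.\<close>

lemma column_dot_le:
  fixes B :: "int ^ 'n ^ 'n" and \<sigma> :: "'n::finite \<Rightarrow> 'n"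
  assumes B: "skew_symmetrizable B" and \<sigma>: "bij \<sigma>"
    and eq: "\<And>q i. pos q \<Longrightarrow> cluster_along ks B q i = q (\<sigma> i)"
  shows "\<bar>dot w (\<lambda>i. B $ i $ \<sigma> l)\<bar> \<le> \<bar>\<Sum>i\<in>UNIV. w (\<sigma> i) * matrix_along ks B $ i $ l\<bar>"
proof -
  define B2 where "B2 = matrix_along ks B"
  define k where "k = \<sigma> l"
  define N where "N = (\<lambda>q :: 'n \<Rightarrow> real. exchange_numerator l B2 (\<lambda>i. q (\<sigma> i)))"
  let ?P = "exchange_numerator k B"
  have ll: "B2 $ l $ l = 0"
    using skew_symmetrizable_diag[OF skew_symmetrizable_along[OF B]] by (simp add: B2_def)
  (* In the seed mutated at k, take the path back to B and on to the new variable. *)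
  have "laurent (\<lambda>q. cluster_along (k # ks @ [l]) (matrix_mutation k B) q l)"
    by (rule laurent_cluster_along[OF skew_symmetrizable_mutation[OF B]])
  from laurent_mult[OF this laurent_inverse_coord[of k]]
  have "laurent (\<lambda>q. N q * inverse (?P q))"
  proof (rule laurent.cong)
    fix q :: "'n \<Rightarrow> real" assume q: "pos q"
    define p where "p = cluster_step k B q"
    have p: "pos p" unfolding p_def by (rule cluster_step_pos[OF q])
    have "N p = N q"
      unfolding N_def
    proof (rule exchange_numerator_cong)
      fix i assume "B2 $ i $ l \<noteq> 0"
      then have "i \<noteq> l" using ll by auto
      then have "\<sigma> i \<noteq> k" using bij_is_inj[OF \<sigma>] by (auto simp: k_def dest: injD)
      then show "p (\<sigma> i) = q (\<sigma> i)" by (simp add: p_def cluster_step_def)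
    qed
    have "cluster_along ks B p = (\<lambda>i. p (\<sigma> i))" using eq[OF p] by auto
    then have "cluster_along (k # ks @ [l]) (matrix_mutation k B) q l = N p / p k"
      by (simp add: cluster_step_mutation matrix_mutation_involutive[OF B] cluster_along_append
          p_def[symmetric] B2_def[symmetric])
         (simp add: cluster_step_def mutated_variable_eq N_def k_def)
    also have "\<dots> = N q / (?P q / q k)"
      by (simp only: \<open>N p = N q\<close>) (simp add: p_def cluster_step_def mutated_variable_eq)
    finally have f: "cluster_along (k # ks @ [l]) (matrix_mutation k B) q l = N q / (?P q / q k)" .
    have "q k \<noteq> 0" using q by (simp add: less_imp_neq[symmetric])
    then show "cluster_along (k # ks @ [l]) (matrix_mutation k B) q l * inverse (q k) = N q * inverse (?P q)"
      unfolding f by (simp add: divide_inverse)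
  qed
  moreover define a1 where "a1 = (\<lambda>i. pos_part (B2 $ i $ l))"
  define a2 where "a2 = (\<lambda>i. pos_part (- B2 $ i $ l))"
  define b1 where "b1 = (\<lambda>i. pos_part (B $ i $ k))"
  define b2 where "b2 = (\<lambda>i. pos_part (- B $ i $ k))"
  define da where "da = (\<lambda>w a. \<Sum>i\<in>UNIV. w (\<sigma> i) * (a i :: int))"
  have N: "N = (\<lambda>q. lmon (\<lambda>i. a1 (inv \<sigma> i)) q + lmon (\<lambda>i. a2 (inv \<sigma> i)) q)"
    by (simp add: N_def exchange_numerator_lmon a1_def a2_def lmon_permuted[OF \<sigma>])
  have P: "?P = (\<lambda>q. lmon b1 q + lmon b2 q)"
    by (simp add: fun_eq_iff exchange_numerator_lmon b1_def b2_def)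
  have growth: "growth w (\<lambda>q. N q * inverse (?P q))
      (min (da w a1) (da w a2) + - min (dot w b1) (dot w b2))" for w
    unfolding N P da_def dot_permuted[OF \<sigma>, symmetric]
    by (intro growth_mult growth_inverse growth_add growth_lmon)
  have neg: "da (\<lambda>i. - w i) a = - da w a" "dot (\<lambda>i. - w i) a = - dot w a" for a
    by (simp_all add: da_def dot_def sum_negf)
  from laurent_growth_opposite(1)[OF calculation growth[of w] growth[of "\<lambda>i. - w i"]]
  have "\<bar>dot w b1 - dot w b2\<bar> \<le> \<bar>da w a1 - da w a2\<bar>"
    unfolding neg by (auto simp: min_def split: if_splits)
  moreover have "pos_part a - pos_part (- a) = a" for a by (simp add: pos_part_def)
  then have "da w a1 - da w a2 = (\<Sum>i\<in>UNIV. w (\<sigma> i) * B2 $ i $ l)"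
    "dot w b1 - dot w b2 = dot w (\<lambda>i. B $ i $ k)"
    by (simp_all add: da_def dot_def a1_def a2_def b1_def b2_def
        sum_subtractf[symmetric] right_diff_distrib[symmetric])
  ultimately show ?thesis by (simp add: B2_def k_def)
qed

lemma eq_or_neg_if_abs_dot_eq:
  fixes u v :: "'m::finite \<Rightarrow> int"
  assumes "\<And>w. \<bar>dot w u\<bar> = \<bar>dot w v\<bar>"
  shows "u = v \<or> u = (\<lambda>i. - v i)"
proof (rule ccontr)
  assume "\<not> ?thesis"
  then obtain i j where ij: "u i \<noteq> v i" "u j \<noteq> - v j" by (auto simp: fun_eq_iff)
  have u: "dot (unit_vec l) m = m l" for l m
    using dot_unit_vec[of m l] by (simp add: dot_def mult.commute)
  have "\<bar>u i\<bar> = \<bar>v i\<bar>" "\<bar>u j\<bar> = \<bar>v j\<bar>" using assms[of "unit_vec i"] assms[of "unit_vec j"] by (simp_all add: u)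
  then have "u i = - v i" "v i \<noteq> 0" "u j = v j" "v j \<noteq> 0" using ij by linarith+
  moreover have "dot (\<lambda>l. unit_vec i l + unit_vec j l) m = m i + m j" for m
    using u[of i m] u[of j m] by (simp add: dot_def distrib_right sum.distrib)
  then have "\<bar>u i + u j\<bar> = \<bar>v i + v j\<bar>" using assms[of "\<lambda>l. unit_vec i l + unit_vec j l"] by simp
  ultimately show False by linarith
qed

text \<open>Exchanging the roles of the two seeds gives the reverse inequality. Hence corresponding columns
  agree up to sign, and the sign does not affect the exchange numerator.\<close>

lemma exchange_numerator_same_cluster:
  fixes B :: "int ^ 'n ^ 'n" and \<sigma> :: "'n::finite \<Rightarrow> 'n" and x :: "'n \<Rightarrow> 'a::field_char_0"
  assumes B: "skew_symmetrizable B" and \<sigma>: "bij \<sigma>"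
    and eq: "\<And>q i. pos q \<Longrightarrow> cluster_along ks B q i = q (\<sigma> i)"
  shows "exchange_numerator l (matrix_along ks B) (\<lambda>i. x (\<sigma> i)) = exchange_numerator (\<sigma> l) B x"
proof -
  define B2 where "B2 = matrix_along ks B"
  define b where "b = (\<lambda>i. B2 $ inv \<sigma> i $ l)"
  have B2: "skew_symmetrizable B2" unfolding B2_def by (rule skew_symmetrizable_along[OF B])
  have inv: "inv \<sigma> (\<sigma> i) = i" "\<sigma> (inv \<sigma> i) = i" for i
    using \<sigma> by (simp_all add: bij_is_inj bij_is_surj surj_f_inv_f)
  have eq': "cluster_along (rev ks) B2 q i = q (inv \<sigma> i)" if q: "pos q" for q i
  proof -
    have p: "pos (\<lambda>i. q (inv \<sigma> i))" using q by simp
    have "cluster_along ks B (\<lambda>i. q (inv \<sigma> i)) = q" using eq[OF p] by (auto simp: inv)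
    then show ?thesis
      using cluster_along_rev_pos[OF B p, of ks] by (simp add: B2_def)
  qed
  have "\<bar>dot w (\<lambda>i. B $ i $ \<sigma> l)\<bar> = \<bar>dot w b\<bar>" for w
  proof (rule antisym)
    show "\<bar>dot w (\<lambda>i. B $ i $ \<sigma> l)\<bar> \<le> \<bar>dot w b\<bar>"
      using column_dot_le[OF B \<sigma> eq, of w l] dot_permuted[OF \<sigma>, of w "\<lambda>i. B2 $ i $ l"]
      by (simp add: b_def B2_def)
    have inverse_path: "matrix_along (rev ks) B2 = B" unfolding B2_def by (rule matrix_along_rev[OF B])
    have "\<bar>dot (\<lambda>i. w (\<sigma> i)) (\<lambda>i. B2 $ i $ inv \<sigma> (\<sigma> l))\<bar>
        \<le> \<bar>\<Sum>i\<in>UNIV. w (\<sigma> (inv \<sigma> i)) * matrix_along (rev ks) B2 $ i $ \<sigma> l\<bar>"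
      by (rule column_dot_le[OF B2 bij_imp_bij_inv[OF \<sigma>] eq', of "\<lambda>i. w (\<sigma> i)" "\<sigma> l"])
    then show "\<bar>dot w b\<bar> \<le> \<bar>dot w (\<lambda>i. B $ i $ \<sigma> l)\<bar>"
      using dot_permuted[OF \<sigma>, of w "\<lambda>i. B2 $ i $ l"]
      by (simp add: b_def dot_def inv inverse_path)
  qed
  then have "(\<lambda>i. B $ i $ \<sigma> l) = b \<or> (\<lambda>i. B $ i $ \<sigma> l) = (\<lambda>i. - b i)"
    by (rule eq_or_neg_if_abs_dot_eq)
  moreover have "b (\<sigma> i) = B2 $ i $ l" for i by (simp add: b_def inv)
  ultimately have col: "(\<forall>i. B $ \<sigma> i $ \<sigma> l = B2 $ i $ l) \<or> (\<forall>i. B $ \<sigma> i $ \<sigma> l = - B2 $ i $ l)"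
    by (metis (no_types, lifting))
  have reindex: "(\<Prod>i\<in>UNIV. x i ^ f i) = (\<Prod>i\<in>UNIV. x (\<sigma> i) ^ f (\<sigma> i))" for f
    using prod.reindex_bij_betw[OF \<sigma>, of "\<lambda>i. x i ^ f i"] by simp
  show ?thesis
    using col unfolding exchange_numerator_def reindex B2_def[symmetric]
    by (auto simp: add.commute)
qed

section \<open>Rational functions and their values at positive points\<close>

lemma mpoly_eval_superset:
  assumes "finite S" "Poly_Mapping.keys p \<subseteq> S"
  shows "mpoly_eval p x = (\<Sum>m\<in>S. of_rat (Poly_Mapping.lookup p m) * (\<Prod>i\<in>UNIV. x i ^ Poly_Mapping.lookup m i))"
  unfolding mpoly_eval_def
  by (rule sum.mono_neutral_left) (use assms in \<open>auto simp: in_keys_iff\<close>)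

lemma mpoly_eval_zero [simp]: "mpoly_eval 0 x = 0"
  by (simp add: mpoly_eval_def)

lemma mpoly_eval_single:
  "mpoly_eval (Poly_Mapping.single m c) x = of_rat c * (\<Prod>i\<in>UNIV. x i ^ Poly_Mapping.lookup m i)"
  using mpoly_eval_superset[of "{m}" "Poly_Mapping.single m c" x] by simp

lemma mpoly_eval_add: "mpoly_eval (p + q) x = mpoly_eval p x + mpoly_eval q x"
proof -
  let ?S = "Poly_Mapping.keys p \<union> Poly_Mapping.keys q"
  have 1: "mpoly_eval (p + q) x = (\<Sum>m\<in>?S. of_rat (Poly_Mapping.lookup (p + q) m) * (\<Prod>i\<in>UNIV. x i ^ Poly_Mapping.lookup m i))"
    by (rule mpoly_eval_superset) (auto simp: Poly_Mapping.keys_add)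
  have 2: "mpoly_eval p x = (\<Sum>m\<in>?S. of_rat (Poly_Mapping.lookup p m) * (\<Prod>i\<in>UNIV. x i ^ Poly_Mapping.lookup m i))"
    by (rule mpoly_eval_superset) auto
  have 3: "mpoly_eval q x = (\<Sum>m\<in>?S. of_rat (Poly_Mapping.lookup q m) * (\<Prod>i\<in>UNIV. x i ^ Poly_Mapping.lookup m i))"
    by (rule mpoly_eval_superset) auto
  show ?thesis
    unfolding 1 2 3 by (simp add: lookup_add of_rat_add distrib_right sum.distrib)
qed

lemma mpoly_induct [case_names zero add]:
  assumes "P 0" "\<And>m c p. P p \<Longrightarrow> P (Poly_Mapping.single m c + p)" shows "P p"
proof (induction p rule: update_induct)
  case (update f a b)
  have "Poly_Mapping.update a b f = Poly_Mapping.single a b + f"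
    using update(1) by (intro poly_mapping_eqI) (auto simp: lookup_update lookup_add lookup_single in_keys_iff when_def)
  then show ?case using assms(2)[OF update(3)] by simp
qed (rule assms(1))

lemma mpoly_eval_mult: "mpoly_eval (p * q) x = mpoly_eval p x * mpoly_eval q x"
proof (induction p rule: mpoly_induct)
  case (add m c p)
  have "mpoly_eval (Poly_Mapping.single m c * q) x = mpoly_eval (Poly_Mapping.single m c) x * mpoly_eval q x"
  proof (induction q rule: mpoly_induct)
    case (add n d q)
    then show ?case
      by (simp add: distrib_left mult_single mpoly_eval_add mpoly_eval_single lookup_add power_add
          prod.distrib of_rat_mult algebra_simps)
  qed simp
  then show ?case using add by (simp add: distrib_right mpoly_eval_add)
qed simp

lemma mpoly_eval_const: "mpoly_eval (Poly_Mapping.single 0 c) x = of_rat c"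
  by (simp add: mpoly_eval_single)

lemma mpoly_eval_one [simp]: "mpoly_eval 1 x = 1"
  using mpoly_eval_const[of 1 x] by (simp add: single_one)

lemma mpoly_eval_uminus: "mpoly_eval (- p) x = - mpoly_eval p x"
  using mpoly_eval_add[of p "- p" x] by (simp add: eq_neg_iff_add_eq_0 add.commute)

lemma mpoly_eval_diff: "mpoly_eval (p - q) x = mpoly_eval p x - mpoly_eval q x"
  using mpoly_eval_add[of p "- q" x] by (simp add: mpoly_eval_uminus)

lemma mpoly_eval_coord:
  "mpoly_eval (Poly_Mapping.single (Poly_Mapping.single j 1) 1) x = x j"
proof -
  have "(\<Prod>i\<in>UNIV. x i ^ Poly_Mapping.lookup (Poly_Mapping.single j 1) i) = (\<Prod>i\<in>UNIV. if i = j then x i else 1)"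
    by (rule prod.cong) (auto simp: lookup_single when_def)
  then show ?thesis by (simp add: mpoly_eval_single)
qed

text \<open>Doubling one coordinate multiplies distinct monomials by distinct factors, if the coordinate is
  one where the exponents differ, and eliminates one of them.\<close>

lemma monomials_independent:
  fixes c :: "('n::finite \<Rightarrow>\<^sub>0 nat) \<Rightarrow> real"
  assumes "finite S" "\<And>r. pos r \<Longrightarrow> (\<Sum>m\<in>S. c m * (\<Prod>i\<in>UNIV. r i ^ Poly_Mapping.lookup m i)) = 0"
  shows "\<forall>m\<in>S. c m = 0"
  using assms
proof (induction S arbitrary: c rule: finite_induct)
  case (insert k S)
  let ?mon = "\<lambda>m r. \<Prod>i\<in>UNIV. (r i :: real) ^ Poly_Mapping.lookup m i"
  have S: "c m = 0" if m: "m \<in> S" for m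
  proof -
    have "m \<noteq> k" using m insert.hyps by auto
    then obtain j where j: "Poly_Mapping.lookup m j \<noteq> Poly_Mapping.lookup k j"
      using poly_mapping_eqI[of m k] by blast
    let ?e = "\<lambda>n. Poly_Mapping.lookup n j"
    have sc: "?mon n (r(j := 2 * r j)) = 2 ^ ?e n * ?mon n r" for n r
      by (simp add: prod.remove[of UNIV j] power_mult_distrib)
    have "(\<Sum>n\<in>S. (c n * (2 ^ ?e n - 2 ^ ?e k)) * ?mon n r) = 0" if r: "pos r" for r
    proof -
      have r': "pos (r(j := 2 * r j))" using r by simp
      have "(\<Sum>n\<in>insert k S. c n * (2 ^ ?e n * ?mon n r)) = 0"
        using insert.prems[OF r'] unfolding sc .
      moreover have "(\<Sum>n\<in>insert k S. 2 ^ ?e k * (c n * ?mon n r)) = 0"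
        unfolding sum_distrib_left[symmetric] insert.prems[OF r] by simp
      ultimately have "(\<Sum>n\<in>insert k S. c n * (2 ^ ?e n * ?mon n r) - 2 ^ ?e k * (c n * ?mon n r)) = 0"
        unfolding sum_subtractf by simp
      moreover have "c n * (2 ^ ?e n * ?mon n r) - 2 ^ ?e k * (c n * ?mon n r)
          = (c n * (2 ^ ?e n - 2 ^ ?e k)) * ?mon n r" for n
        by (simp only: right_diff_distrib left_diff_distrib mult.assoc mult.left_commute)
      ultimately show ?thesis using insert.hyps by simp
    qed
    from bspec[OF insert.IH[OF this] m] have "c m * (2 ^ ?e m - 2 ^ ?e k) = 0" .
    then show ?thesis using j by simp
  qed
  then have "c k * ?mon k (\<lambda>_. 1) = 0"
    using insert.prems[of "\<lambda>_. 1"] insert.hyps by simp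
  then show ?case using S by simp
qed simp

lemma mpoly_zero_if_zero_on_pos:
  fixes p :: "('n::finite \<Rightarrow>\<^sub>0 nat) \<Rightarrow>\<^sub>0 rat"
  assumes "\<And>r :: 'n \<Rightarrow> real. pos r \<Longrightarrow> mpoly_eval p r = 0" shows "p = 0"
proof (rule poly_mapping_eqI)
  fix m
  have "\<forall>m\<in>Poly_Mapping.keys p. (of_rat (Poly_Mapping.lookup p m) :: real) = 0"
    by (rule monomials_independent[OF finite_keys]) (rule assms[unfolded mpoly_eval_def])
  then show "Poly_Mapping.lookup p m = Poly_Mapping.lookup 0 m"
    by (cases "m \<in> Poly_Mapping.keys p") (auto simp: in_keys_iff)
qed

text \<open>An element \<open>z\<close> of the field and a real function \<open>g\<close> are two faces of one rational function in
  the free generators, with a denominator that is positive on the positive orthant. Identities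
  between such elements can then be checked at positive real points.\<close>

definition rational_pair ::
    "('n::finite \<Rightarrow> 'a::field_char_0) \<Rightarrow> 'a \<Rightarrow> (('n \<Rightarrow> real) \<Rightarrow> real) \<Rightarrow> bool" where
  "rational_pair x z g \<longleftrightarrow> (\<exists>p q. z * mpoly_eval q x = mpoly_eval p x \<and>
     (\<forall>r. pos r \<longrightarrow> mpoly_eval q r > 0 \<and> g r * mpoly_eval q r = mpoly_eval p r))"

lemma rational_pairI:
  assumes "z * mpoly_eval q x = mpoly_eval p x"
    "\<And>r. pos r \<Longrightarrow> mpoly_eval q r > 0" "\<And>r. pos r \<Longrightarrow> g r * mpoly_eval q r = mpoly_eval p r"
  shows "rational_pair x z g"
  unfolding rational_pair_def using assms by blast

lemma rational_pair_of_rat: "rational_pair x (of_rat c) (\<lambda>r. of_rat c)"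
  by (rule rational_pairI[where q = 1 and p = "Poly_Mapping.single 0 c"]) (simp_all add: mpoly_eval_const)

lemma rational_pair_one: "rational_pair x 1 (\<lambda>r. 1)"
  using rational_pair_of_rat[of x 1] by simp

lemma rational_pair_coord: "rational_pair x (x j) (\<lambda>r. r j)"
  by (rule rational_pairI[where q = 1 and p = "Poly_Mapping.single (Poly_Mapping.single j 1) 1"])
     (simp_all only: mpoly_eval_coord mpoly_eval_one mult_1_right zero_less_one)

lemma rational_pair_add:
  assumes "rational_pair x z g" "rational_pair x w h"
  shows "rational_pair x (z + w) (\<lambda>r. g r + h r)"
proof -
  obtain p q p' q' where 1: "z * mpoly_eval q x = mpoly_eval p x"
      "\<forall>r. pos r \<longrightarrow> mpoly_eval q r > 0 \<and> g r * mpoly_eval q r = mpoly_eval p r"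
    and 2: "w * mpoly_eval q' x = mpoly_eval p' x"
      "\<forall>r. pos r \<longrightarrow> mpoly_eval q' r > 0 \<and> h r * mpoly_eval q' r = mpoly_eval p' r"
    using assms unfolding rational_pair_def by blast
  show ?thesis
  proof (rule rational_pairI[where q = "q * q'" and p = "p * q' + p' * q"])
    show "(z + w) * mpoly_eval (q * q') x = mpoly_eval (p * q' + p' * q) x"
      by (simp add: mpoly_eval_add mpoly_eval_mult 1(1)[symmetric] 2(1)[symmetric] algebra_simps)
  next
    fix r :: "'a \<Rightarrow> real" assume r: "pos r"
    show "mpoly_eval (q * q') r > 0" using 1(2) 2(2) r by (simp add: mpoly_eval_mult)
    have "g r * mpoly_eval q r = mpoly_eval p r" "h r * mpoly_eval q' r = mpoly_eval p' r"
      using 1(2) 2(2) r by blast+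
    then show "(g r + h r) * mpoly_eval (q * q') r = mpoly_eval (p * q' + p' * q) r"
      by (simp add: mpoly_eval_add mpoly_eval_mult algebra_simps flip: mult.assoc)
  qed
qed

lemma rational_pair_mult:
  assumes "rational_pair x z g" "rational_pair x w h"
  shows "rational_pair x (z * w) (\<lambda>r. g r * h r)"
proof -
  obtain p q p' q' where 1: "z * mpoly_eval q x = mpoly_eval p x"
      "\<forall>r. pos r \<longrightarrow> mpoly_eval q r > 0 \<and> g r * mpoly_eval q r = mpoly_eval p r"
    and 2: "w * mpoly_eval q' x = mpoly_eval p' x"
      "\<forall>r. pos r \<longrightarrow> mpoly_eval q' r > 0 \<and> h r * mpoly_eval q' r = mpoly_eval p' r"
    using assms unfolding rational_pair_def by blast
  show ?thesis
  proof (rule rational_pairI[where q = "q * q'" and p = "p * p'"])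
    show "(z * w) * mpoly_eval (q * q') x = mpoly_eval (p * p') x"
      by (simp add: mpoly_eval_mult 1(1)[symmetric] 2(1)[symmetric])
  next
    fix r :: "'a \<Rightarrow> real" assume r: "pos r"
    show "mpoly_eval (q * q') r > 0" using 1(2) 2(2) r by (simp add: mpoly_eval_mult)
    have "mpoly_eval p r = g r * mpoly_eval q r" "mpoly_eval p' r = h r * mpoly_eval q' r"
      using 1(2) 2(2) r by auto
    then show "(g r * h r) * mpoly_eval (q * q') r = mpoly_eval (p * p') r"
      by (simp add: mpoly_eval_mult)
  qed
qed

lemma rational_pair_zero_iff:
  fixes x :: "'n::finite \<Rightarrow> 'a::field_char_0"
  assumes x: "algebraically_independent x" and z: "rational_pair x z g"
  shows "z = 0 \<longleftrightarrow> (\<forall>r. pos r \<longrightarrow> g r = 0)"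
proof -
  obtain p q where pq: "z * mpoly_eval q x = mpoly_eval p x"
      "\<And>r. pos r \<Longrightarrow> mpoly_eval q r > 0" "\<And>r. pos r \<Longrightarrow> g r * mpoly_eval q r = mpoly_eval p r"
    using z unfolding rational_pair_def by blast
  have "mpoly_eval q (\<lambda>_::'n. 1::real) > 0" by (rule pq(2)) simp
  then have "q \<noteq> 0" by auto
  then have qx: "mpoly_eval q x \<noteq> 0" using x by (auto simp: algebraically_independent_def)
  show ?thesis
  proof
    assume "z = 0"
    then have "p = 0" using pq(1) x by (auto simp: algebraically_independent_def)
    then have "g r = 0" if "pos r" for r using pq(2,3)[OF that] by simp
    then show "\<forall>r. pos r \<longrightarrow> g r = 0" by blast
  next
    assume "\<forall>r. pos r \<longrightarrow> g r = 0"
    then have "mpoly_eval p r = 0" if "pos r" for r :: "'n \<Rightarrow> real" using pq(3)[OF that] that by simp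
    then have "p = 0" by (rule mpoly_zero_if_zero_on_pos)
    then show "z = 0" using pq(1) qx by simp
  qed
qed

lemma rational_pair_inverse:
  assumes x: "algebraically_independent x" and z: "rational_pair x z g" "\<And>r. pos r \<Longrightarrow> g r > 0"
  shows "rational_pair x (inverse z) (\<lambda>r. inverse (g r))"
proof -
  obtain p q where pq: "z * mpoly_eval q x = mpoly_eval p x"
      "\<And>r. pos r \<Longrightarrow> mpoly_eval q r > 0" "\<And>r. pos r \<Longrightarrow> g r * mpoly_eval q r = mpoly_eval p r"
    using z(1) unfolding rational_pair_def by blast
  have "\<not> (\<forall>r. pos r \<longrightarrow> g r = 0)"
    using z(2)[of "\<lambda>_. 1"] by (metis less_irrefl zero_less_one)
  then have "z \<noteq> 0" using rational_pair_zero_iff[OF x z(1)] by blast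
  show ?thesis
  proof (rule rational_pairI[where q = p and p = q])
    show "inverse z * mpoly_eval p x = mpoly_eval q x"
      using \<open>z \<noteq> 0\<close> by (simp add: pq(1)[symmetric])
  next
    fix r :: "'a \<Rightarrow> real" assume r: "pos r"
    show "mpoly_eval p r > 0" unfolding pq(3)[OF r, symmetric] by (rule mult_pos_pos[OF z(2)[OF r] pq(2)[OF r]])
    show "inverse (g r) * mpoly_eval p r = mpoly_eval q r"
      unfolding pq(3)[OF r, symmetric] using z(2)[OF r] by simp
  qed
qed

lemma rational_pair_eq_iff:
  assumes x: "algebraically_independent x" and "rational_pair x z g" "rational_pair x w h"
  shows "z = w \<longleftrightarrow> (\<forall>r. pos r \<longrightarrow> g r = h r)"
proof -
  have "rational_pair x (z + of_rat (- 1) * w) (\<lambda>r. g r + of_rat (- 1) * h r)"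
    by (intro rational_pair_add rational_pair_mult rational_pair_of_rat assms)
  from rational_pair_zero_iff[OF x this] show ?thesis by (simp add: of_rat_minus)
qed

lemma rational_pair_power: "rational_pair x z g \<Longrightarrow> rational_pair x (z ^ n) (\<lambda>r. g r ^ n)"
  by (induction n) (simp_all add: rational_pair_one rational_pair_mult)

lemma rational_pair_prod:
  "(\<And>i. i \<in> A \<Longrightarrow> rational_pair x (z i) (g i)) \<Longrightarrow> rational_pair x (\<Prod>i\<in>A. z i) (\<lambda>r. \<Prod>i\<in>A. g i r)"
  by (induction A rule: infinite_finite_induct) (simp_all add: rational_pair_one rational_pair_mult)

lemma rational_pair_sum:
  "(\<And>i. i \<in> A \<Longrightarrow> rational_pair x (z i) (g i)) \<Longrightarrow> rational_pair x (\<Sum>i\<in>A. z i) (\<lambda>r. \<Sum>i\<in>A. g i r)"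
  by (induction A rule: infinite_finite_induct)
     (use rational_pair_of_rat[of x 0] in \<open>simp_all add: rational_pair_add\<close>)

lemma rational_pair_mpoly_eval:
  assumes "\<And>i. rational_pair x (y i) (\<lambda>r. p r i)"
  shows "rational_pair x (mpoly_eval f y) (\<lambda>r. mpoly_eval f (p r))"
  unfolding mpoly_eval_def
  by (intro rational_pair_sum rational_pair_mult rational_pair_prod rational_pair_power
      rational_pair_of_rat assms)

lemma rational_pair_cluster_along:
  assumes x: "algebraically_independent x"
    and "\<And>i. rational_pair x (y i) (\<lambda>r. p r i)" "\<And>r. pos r \<Longrightarrow> pos (p r)"
  shows "rational_pair x (cluster_along ks B y i) (\<lambda>r. cluster_along ks B (p r) i)"
  using assms(2,3)
proof (induction ks arbitrary: B y p)
  case (Cons k ks)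
  have num: "rational_pair x (exchange_numerator k B y) (\<lambda>r. exchange_numerator k B (p r))"
    unfolding exchange_numerator_def
    by (intro rational_pair_add rational_pair_prod rational_pair_power Cons.prems(1))
  have inv: "rational_pair x (inverse (y k)) (\<lambda>r. inverse (p r k))"
    using Cons.prems(2) by (intro rational_pair_inverse[OF x] Cons.prems(1)) blast
  have "rational_pair x (cluster_step k B y i) (\<lambda>r. cluster_step k B (p r) i)" for i
    using rational_pair_mult[OF num inv] Cons.prems(1)[of i]
    by (simp add: cluster_step_def mutated_variable_eq divide_inverse)
  moreover have "pos (cluster_step k B (p r))" if "pos r" for r
    by (rule cluster_step_pos[OF Cons.prems(2)[OF that]])
  ultimately show ?case
    using Cons.IH[of "cluster_step k B y" "\<lambda>r. cluster_step k B (p r)"] by simp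
qed simp

corollary rational_pair_cluster_variable:
  assumes "algebraically_independent x"
  shows "rational_pair x (cluster_along ks B x i) (\<lambda>r. cluster_along ks B r i)"
  by (rule rational_pair_cluster_along[OF assms rational_pair_coord])

corollary cluster_variable_eq_iff:
  fixes x :: "'n::finite \<Rightarrow> 'a::field_char_0"
  assumes "algebraically_independent x"
  shows "cluster_along ks B x i = cluster_along ls C x j \<longleftrightarrow>
    (\<forall>r :: 'n \<Rightarrow> real. pos r \<longrightarrow> cluster_along ks B r i = cluster_along ls C r j)"
  by (rule rational_pair_eq_iff[OF assms rational_pair_cluster_variable[OF assms]
        rational_pair_cluster_variable[OF assms]])

subsection \<open>Every seed consists of free generators\<close>

lemma cluster_along_rev:
  fixes x :: "'n::finite \<Rightarrow> 'a::field_char_0"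
  assumes "algebraically_independent x" "skew_symmetrizable B"
  shows "cluster_along (rev ks) (matrix_along ks B) (cluster_along ks B x) = x"
proof
  fix i
  have "cluster_along (ks @ rev ks) B x i = cluster_along [] B x i"
    unfolding cluster_variable_eq_iff[OF assms(1)]
    unfolding cluster_along_append
    by (simp add: cluster_along_rev_pos[OF assms(2)])
  then show "cluster_along (rev ks) (matrix_along ks B) (cluster_along ks B x) i = x i"
    by (simp add: cluster_along_append)
qed

text \<open>A polynomial relation in a seed vanishes on all points of the positive orthant, because every
  such point is the value of the seed at a suitable positive point.\<close>

lemma algebraically_independent_along:
  fixes x :: "'n::finite \<Rightarrow> 'a::field_char_0"
  assumes x: "algebraically_independent x" and B: "skew_symmetrizable B"
  shows "algebraically_independent (cluster_along ks B x)"
  unfolding algebraically_independent_def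
proof (intro allI impI)
  fix p assume "mpoly_eval p (cluster_along ks B x) = 0"
  moreover have "rational_pair x (mpoly_eval p (cluster_along ks B x)) (\<lambda>r. mpoly_eval p (cluster_along ks B r))"
    by (rule rational_pair_mpoly_eval[OF rational_pair_cluster_variable[OF x]])
  ultimately have zero: "mpoly_eval p (cluster_along ks B r) = 0" if "pos r" for r :: "'n \<Rightarrow> real"
    using rational_pair_zero_iff[OF x] that by blast
  have "mpoly_eval p r = 0" if r: "pos r" for r :: "'n \<Rightarrow> real"
  proof -
    let ?r = "cluster_along (rev ks) (matrix_along ks B) r"
    have "cluster_along ks B ?r = r"
      using cluster_along_rev_pos[OF skew_symmetrizable_along[OF B] r, of "rev ks" ks]
      by (simp add: matrix_along_rev[OF B])
    then show ?thesis using zero[OF cluster_along_pos[OF r, of "rev ks" "matrix_along ks B"]] by simp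
  qed
  then show "p = 0" by (rule mpoly_zero_if_zero_on_pos)
qed

lemma is_subring_zero: "is_subring S \<Longrightarrow> 0 \<in> S"
  unfolding is_subring_def by (metis diff_self)

lemma is_subring_add: "is_subring S \<Longrightarrow> a \<in> S \<Longrightarrow> b \<in> S \<Longrightarrow> a + b \<in> S"
proof -
  assume S: "is_subring S" and ab: "a \<in> S" "b \<in> S"
  have "0 - b \<in> S" using S ab is_subring_zero[OF S] unfolding is_subring_def by blast
  then have "a - (0 - b) \<in> S" using S ab unfolding is_subring_def by blast
  then show ?thesis by simp
qed

lemma is_subring_mult: "is_subring S \<Longrightarrow> a \<in> S \<Longrightarrow> b \<in> S \<Longrightarrow> a * b \<in> S"
  by (simp add: is_subring_def)

lemma is_subring_power: "is_subring S \<Longrightarrow> a \<in> S \<Longrightarrow> a ^ n \<in> S"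
  by (induction n) (simp_all add: is_subring_def)

lemma is_subring_prod:
  fixes f :: "'b \<Rightarrow> 'a::field_char_0"
  shows "is_subring S \<Longrightarrow> (\<And>i. i \<in> A \<Longrightarrow> f i \<in> S) \<Longrightarrow> (\<Prod>i\<in>A. f i) \<in> S"
  by (induction A rule: infinite_finite_induct) (simp_all add: is_subring_def)

lemma is_subring_hull: "is_subring (is_subring hull S)"
  by (rule hull_in) (auto simp: is_subring_def)

lemma cluster_along_in_subfield:
  assumes S: "is_subfield S" and x: "\<And>i. x i \<in> S"
  shows "cluster_along ks B x i \<in> S"
  using x
proof (induction ks arbitrary: B x)
  case (Cons k ks)
  have R: "is_subring S" using S by (simp add: is_subfield_def)
  have "exchange_numerator k B x \<in> S"
    unfolding exchange_numerator_def
    by (intro is_subring_add[OF R] is_subring_prod[OF R] is_subring_power[OF R] Cons.prems)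
  moreover have "inverse (x k) \<in> S" using S Cons.prems by (simp add: is_subfield_def)
  ultimately have "cluster_step k B x i \<in> S" for i
    using Cons.prems is_subring_mult[OF R]
    by (simp add: cluster_step_def mutated_variable_eq divide_inverse)
  then show ?case using Cons.IH by simp
qed simp

lemma free_generators_along:
  assumes x: "free_generators x" and B: "skew_symmetrizable B"
  shows "free_generators (cluster_along ks B x)"
  unfolding free_generators_def
proof
  have a: "algebraically_independent x" using x by (simp add: free_generators_def)
  then show "algebraically_independent (cluster_along ks B x)"
    by (rule algebraically_independent_along[OF _ B])
  let ?y = "cluster_along ks B x"
  let ?S = "is_subfield hull (range ?y)"
  have S: "is_subfield ?S"
    by (rule hull_in) (auto simp: is_subfield_def is_subring_def)
  have "?y i \<in> ?S" for i by (rule hull_inc) simp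
  then have "cluster_along (rev ks) (matrix_along ks B) ?y i \<in> ?S" for i
    by (rule cluster_along_in_subfield[OF S])
  then have "range x \<subseteq> ?S" using cluster_along_rev[OF a B] by auto
  then have "is_subfield hull (range x) \<subseteq> ?S" using S by (rule hull_minimal)
  then show "?S = UNIV" using x by (auto simp: free_generators_def)
qed

lemma algebraically_independent_inj:
  assumes "algebraically_independent x" shows "inj x"
proof (rule injI)
  fix i j assume ij: "x i = x j"
  have "rational_pair x (x i) (\<lambda>r. r i)" "rational_pair x (x j) (\<lambda>r. r j)"
    by (rule rational_pair_coord)+
  from rational_pair_eq_iff[OF assms this] ij have eq: "\<forall>r. pos r \<longrightarrow> r i = r j" by blast
  have "pos (\<lambda>l. if l = i then 2 else 1)" by simp
  from mp[OF spec[OF eq] this] show "i = j" by (simp split: if_splits)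
qed

subsection \<open>Field automorphisms between seeds\<close>

lemma subfield_of_free_generators:
  fixes y :: "'n::finite \<Rightarrow> 'a::field_char_0"
  assumes "free_generators y" "is_subfield S" "range y \<subseteq> S" shows "S = UNIV"
  using hull_minimal[of "range y" S is_subfield] assms by (auto simp: free_generators_def)

text \<open>The field automorphism that sends one tuple of free generators to another evaluates the same
  quotient of polynomials at the other tuple. As a relation it is symmetric in the two tuples,
  which makes it bijective.\<close>

definition same_quotient ::
    "('n::finite \<Rightarrow> 'a::field_char_0) \<Rightarrow> ('n \<Rightarrow> 'a) \<Rightarrow> 'a \<Rightarrow> 'a \<Rightarrow> bool" where
  "same_quotient y y' a b \<longleftrightarrow> (\<exists>p q. q \<noteq> 0 \<and> a * mpoly_eval q y = mpoly_eval p y \<and>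
     b * mpoly_eval q y' = mpoly_eval p y')"

lemma same_quotient_sym: "same_quotient y y' a b \<longleftrightarrow> same_quotient y' y b a"
  by (auto simp: same_quotient_def)

context
  fixes y y' :: "'n::finite \<Rightarrow> 'a::field_char_0"
  assumes y: "free_generators y" and y': "free_generators y'"
begin

lemma same_quotient_eval_nonzero:
  assumes "q \<noteq> 0" shows "mpoly_eval q y \<noteq> 0" "mpoly_eval q y' \<noteq> 0"
  using assms y y' by (auto simp: free_generators_def algebraically_independent_def)

lemma same_quotientI:
  assumes "mpoly_eval q y \<noteq> 0" "a * mpoly_eval q y = mpoly_eval p y" "b * mpoly_eval q y' = mpoly_eval p y'"
  shows "same_quotient y y' a b"
proof -
  have "q \<noteq> 0" using assms(1) by auto
  then show ?thesis using assms(2,3) unfolding same_quotient_def by blast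
qed

lemma same_quotientE:
  assumes "same_quotient y y' a b"
  obtains p q where "mpoly_eval q y \<noteq> 0" "mpoly_eval q y' \<noteq> 0"
    "a * mpoly_eval q y = mpoly_eval p y" "b * mpoly_eval q y' = mpoly_eval p y'"
  using assms same_quotient_eval_nonzero unfolding same_quotient_def by blast

lemma same_quotient_coord: "same_quotient y y' (y i) (y' i)"
  by (rule same_quotientI[of 1 _ "Poly_Mapping.single (Poly_Mapping.single i 1) 1"])
     (simp_all only: mpoly_eval_coord mpoly_eval_one mult_1_right one_neq_zero not_False_eq_True)

lemma same_quotient_one: "same_quotient y y' 1 1"
  by (rule same_quotientI[of 1 _ 1]) simp_all

lemma same_quotient_diff:
  assumes "same_quotient y y' a b" "same_quotient y y' c d"
  shows "same_quotient y y' (a - c) (b - d)"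
proof -
  obtain p q where 1: "mpoly_eval q y \<noteq> 0" "mpoly_eval q y' \<noteq> 0"
    "a * mpoly_eval q y = mpoly_eval p y" "b * mpoly_eval q y' = mpoly_eval p y'"
    using same_quotientE[OF assms(1)] .
  obtain p' q' where 2: "mpoly_eval q' y \<noteq> 0" "mpoly_eval q' y' \<noteq> 0"
    "c * mpoly_eval q' y = mpoly_eval p' y" "d * mpoly_eval q' y' = mpoly_eval p' y'"
    using same_quotientE[OF assms(2)] .
  show ?thesis
    by (rule same_quotientI[of "q * q'" _ "p * q' - p' * q"])
       (use 1(1) 2(1) in \<open>simp_all add: mpoly_eval_mult mpoly_eval_diff 1(3,4)[symmetric] 2(3,4)[symmetric] algebra_simps\<close>)
qed

lemma same_quotient_mult:
  assumes "same_quotient y y' a b" "same_quotient y y' c d"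
  shows "same_quotient y y' (a * c) (b * d)"
proof -
  obtain p q where 1: "mpoly_eval q y \<noteq> 0" "mpoly_eval q y' \<noteq> 0"
    "a * mpoly_eval q y = mpoly_eval p y" "b * mpoly_eval q y' = mpoly_eval p y'"
    using same_quotientE[OF assms(1)] .
  obtain p' q' where 2: "mpoly_eval q' y \<noteq> 0" "mpoly_eval q' y' \<noteq> 0"
    "c * mpoly_eval q' y = mpoly_eval p' y" "d * mpoly_eval q' y' = mpoly_eval p' y'"
    using same_quotientE[OF assms(2)] .
  show ?thesis
    by (rule same_quotientI[of "q * q'" _ "p * p'"])
       (use 1(1) 2(1) in \<open>simp_all add: mpoly_eval_mult 1(3,4)[symmetric] 2(3,4)[symmetric]\<close>)
qed

lemma same_quotient_unique:
  assumes "same_quotient y y' a b" "same_quotient y y' a d" shows "b = d"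
proof -
  obtain p q where 1: "mpoly_eval q y \<noteq> 0" "mpoly_eval q y' \<noteq> 0"
    "a * mpoly_eval q y = mpoly_eval p y" "b * mpoly_eval q y' = mpoly_eval p y'"
    using same_quotientE[OF assms(1)] .
  obtain p' q' where 2: "mpoly_eval q' y \<noteq> 0" "mpoly_eval q' y' \<noteq> 0"
    "a * mpoly_eval q' y = mpoly_eval p' y" "d * mpoly_eval q' y' = mpoly_eval p' y'"
    using same_quotientE[OF assms(2)] .
  have "mpoly_eval (p * q' - p' * q) y = 0"
    by (simp add: mpoly_eval_diff mpoly_eval_mult 1(3)[symmetric] 2(3)[symmetric])
  then have "p * q' - p' * q = 0"
    using y by (auto simp: free_generators_def algebraically_independent_def)
  then have "mpoly_eval (p * q' - p' * q) y' = 0" by simp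
  then have "(b - d) * (mpoly_eval q y' * mpoly_eval q' y') = 0"
    by (simp add: mpoly_eval_diff mpoly_eval_mult 1(4)[symmetric] 2(4)[symmetric] algebra_simps)
  then show ?thesis using 1(2) 2(2) by simp
qed

lemma same_quotient_inverse:
  assumes "same_quotient y y' a b" shows "same_quotient y y' (inverse a) (inverse b)"
proof (cases "a = 0")
  case True
  have "same_quotient y y' 0 0" using same_quotient_diff[OF assms assms] by simp
  then show ?thesis using True assms same_quotient_unique[of 0 b 0] by auto
next
  case False
  obtain p q where 1: "mpoly_eval q y \<noteq> 0" "mpoly_eval q y' \<noteq> 0"
    "a * mpoly_eval q y = mpoly_eval p y" "b * mpoly_eval q y' = mpoly_eval p y'"
    using same_quotientE[OF assms(1)] .
  have p: "mpoly_eval p y \<noteq> 0" using 1(1) False by (simp add: 1(3)[symmetric])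
  then have "p \<noteq> 0" by auto
  then have "b \<noteq> 0" using same_quotient_eval_nonzero(2)[of p] by (auto simp: 1(4)[symmetric])
  then show ?thesis
    by (intro same_quotientI[of p _ q]) (use p False in \<open>simp_all add: 1(3,4)[symmetric]\<close>)
qed

lemma same_quotient_total: "\<exists>b. same_quotient y y' a b"
proof -
  have "is_subfield {a. \<exists>b. same_quotient y y' a b}"
    unfolding is_subfield_def is_subring_def
    using same_quotient_one same_quotient_diff same_quotient_mult same_quotient_inverse by blast
  then have "{a. \<exists>b. same_quotient y y' a b} = UNIV"
    by (rule subfield_of_free_generators[OF y]) (use same_quotient_coord in blast)
  then show ?thesis by blast
qed

end

definition field_automorphism :: "('a::field \<Rightarrow> 'a) \<Rightarrow> bool" where
  "field_automorphism f \<longleftrightarrow> bij f \<and> f 1 = 1 \<and> (\<forall>a b. f (a + b) = f a + f b \<and> f (a * b) = f a * f b)"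

lemma field_automorphism_simps:
  assumes "field_automorphism f"
  shows "f 0 = 0" "f 1 = 1" "f (a + b) = f a + f b" "f (a * b) = f a * f b" "f (a - b) = f a - f b"
    "f (a / b) = f a / f b" "f (a ^ n) = f a ^ n" "inj f" "surj f"
proof -
  have f: "f 1 = 1" "\<And>a b. f (a + b) = f a + f b" "\<And>a b. f (a * b) = f a * f b" "inj f" "surj f"
    using assms by (auto simp: field_automorphism_def bij_def)
  show "f 1 = 1" "f (a + b) = f a + f b" "f (a * b) = f a * f b" "inj f" "surj f" by (fact f)+
  have "f 0 + 0 = f 0 + f 0" using f(2)[of 0 0] by (simp only: add_0_right)
  then show f0: "f 0 = 0" by (simp only: add_left_cancel)
  show "f (a - b) = f a - f b" using f(2)[of "a - b" b] by simp
  show "f (a / b) = f a / f b"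
  proof (cases "b = 0")
    case False
    then have "f b \<noteq> 0" using f0 f(4) by (metis injD)
    then show ?thesis using f(3)[of "a / b" b] False by (simp add: field_simps)
  qed (simp add: f0)
  show "f (a ^ n) = f a ^ n" by (induction n) (simp_all add: f)
qed

lemma field_automorphism_prod:
  assumes "field_automorphism f" shows "f (\<Prod>i\<in>A. g i) = (\<Prod>i\<in>A. f (g i))"
  by (induction A rule: infinite_finite_induct) (simp_all add: field_automorphism_simps[OF assms])

lemma ex_field_automorphism:
  fixes y y' :: "'n::finite \<Rightarrow> 'a::field_char_0"
  assumes y: "free_generators y" and y': "free_generators y'"
  obtains f where "field_automorphism f" "\<And>i. f (y i) = y' i"
proof -
  note fwd = same_quotient_unique[OF y y'] and total = same_quotient_total[OF y y']
  define f where "f = (\<lambda>a. SOME b. same_quotient y y' a b)"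
  have f: "same_quotient y y' a (f a)" for a
    unfolding f_def by (rule someI_ex[OF total])
  have eq: "f a = b" if "same_quotient y y' a b" for a b by (rule fwd[OF f that])
  have one: "f 1 = 1" by (rule eq[OF same_quotient_one[OF y y']])
  have diff: "f (a - b) = f a - f b" for a b by (rule eq[OF same_quotient_diff[OF y y' f f]])
  have mult: "f (a * b) = f a * f b" for a b by (rule eq[OF same_quotient_mult[OF y y' f f]])
  have zero: "f 0 = 0" using diff[of 0 0] by simp
  have "f (a + b) = f a + f b" for a b using diff[of a "0 - b"] diff[of 0 b] zero by simp
  moreover have "inj f"
  proof (rule injI)
    fix a c assume "f a = f c"
    then have "same_quotient y' y (f a) a" "same_quotient y' y (f a) c"
      using f[of a] f[of c] by (simp_all add: same_quotient_sym[of y'])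
    then show "a = c" by (rule same_quotient_unique[OF y' y])
  qed
  moreover have "surj f"
  proof (rule surjI)
    fix b
    have "same_quotient y' y b (SOME a. same_quotient y' y b a)"
      by (rule someI_ex[OF same_quotient_total[OF y' y]])
    then show "f (SOME a. same_quotient y' y b a) = b"
      using eq by (simp add: same_quotient_sym[of y'])
  qed
  ultimately have "field_automorphism f" by (simp add: field_automorphism_def bij_def one mult)
  moreover have "f (y i) = y' i" for i by (rule eq[OF same_quotient_coord[OF y y']])
  ultimately show ?thesis by (rule that)
qed

lemma field_automorphism_cluster_along:
  assumes f: "field_automorphism f" and "\<And>i. f (y i) = y' i"
  shows "f (cluster_along ks B y i) = cluster_along ks B y' i"
  using assms(2)
proof (induction ks arbitrary: B y y' i)
  case (Cons k ks)
  have "f (cluster_step k B y i) = cluster_step k B y' i" for i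
    by (simp add: cluster_step_def mutated_variable_eq exchange_numerator_def
        field_automorphism_simps[OF f] field_automorphism_prod[OF f] Cons.prems)
  then show ?case using Cons.IH by simp
qed simp

section \<open>Cluster automorphisms\<close>

context
  fixes x :: "'n::finite \<Rightarrow> 'a::field_char_0" and B :: "int ^ 'n ^ 'n"
  assumes xB: "labeled_seed x B"
begin

lemma seed_props:
  assumes "(y, C) \<in> seeds x B"
  shows "free_generators y" "algebraically_independent y" "skew_symmetrizable C"
proof -
  have x: "free_generators x" "skew_symmetrizable B" using xB by (auto simp: labeled_seed_def)
  obtain ks where "y = cluster_along ks B x" "C = matrix_along ks B" using assms seeds_iff by blast
  then show "free_generators y" "skew_symmetrizable C"
    using free_generators_along[OF x] skew_symmetrizable_along[OF x(2)] by auto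
  then show "algebraically_independent y" by (simp add: free_generators_def)
qed

lemma seed_along:
  assumes "(y, C) \<in> seeds x B" shows "(cluster_along ms C y, matrix_along ms C) \<in> seeds x B"
proof -
  obtain ks where "y = cluster_along ks B x" "C = matrix_along ks B" using assms seeds_iff by blast
  then show ?thesis
    unfolding seeds_iff by (intro exI[of _ "ks @ ms"]) (simp add: cluster_along_append matrix_along_append)
qed

lemma seed_connected:
  assumes "(y, C) \<in> seeds x B" "(y', C') \<in> seeds x B"
  obtains ms where "y' = cluster_along ms C y" "C' = matrix_along ms C"
proof -
  obtain ks where ks: "y = cluster_along ks B x" "C = matrix_along ks B" using assms(1) seeds_iff by blast
  obtain ls where ls: "y' = cluster_along ls B x" "C' = matrix_along ls B" using assms(2) seeds_iff by blast
  have x: "algebraically_independent x" "skew_symmetrizable B"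
    using xB by (auto simp: labeled_seed_def free_generators_def)
  have "y' = cluster_along (rev ks @ ls) C y" "C' = matrix_along (rev ks @ ls) C"
    by (simp_all add: cluster_along_append matrix_along_append ks ls cluster_along_rev[OF x]
        matrix_along_rev[OF x(2)])
  then show ?thesis by (rule that)
qed

text \<open>Equality of the clusters in the field becomes equality of functions on the positive orthant,
  where \<open>exchange_numerator_same_cluster\<close> applies. So mutation of a cluster at one of its elements
  is well defined.\<close>

lemma mutated_variable_same_cluster:
  assumes y: "(y, C) \<in> seeds x B" and y': "(y', C') \<in> seeds x B"
    and same: "range y' = range y" "y' l = y k"
  shows "mutated_variable l y' C' = mutated_variable k y C"
proof -
  obtain ms where ms: "y' = cluster_along ms C y" "C' = matrix_along ms C"
    by (rule seed_connected[OF y y'])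
  have inj: "inj y" "inj y'"
    using algebraically_independent_inj seed_props(2)[OF y] seed_props(2)[OF y'] by blast+
  define \<sigma> where "\<sigma> = (\<lambda>i. inv y (y' i))"
  have \<sigma>: "y (\<sigma> i) = y' i" for i
  proof -
    have "y' i \<in> range y" using same(1) by blast
    then show ?thesis by (simp add: \<sigma>_def f_inv_into_f)
  qed
  have "inj \<sigma>" by (rule injI) (metis \<sigma> inj(2) injD)
  then have bij: "bij \<sigma>" by (simp add: bij_def finite_UNIV_inj_surj)
  have "\<sigma> l = k" using inj(1) \<sigma>[of l] same(2) by (metis injD)
  have "cluster_along ms C q i = q (\<sigma> i)" if "pos q" for q i
  proof -
    have "cluster_along ms C y i = cluster_along [] C y (\<sigma> i)" by (simp add: \<sigma> ms)
    then have "cluster_along ms C q i = cluster_along [] C q (\<sigma> i)"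
      using that unfolding cluster_variable_eq_iff[OF seed_props(2)[OF y]] by blast
    then show ?thesis by simp
  qed
  from exchange_numerator_same_cluster[OF seed_props(3)[OF y] bij this, of l y]
  have "exchange_numerator l C' y' = exchange_numerator k C y"
    by (simp add: ms(2)[symmetric] \<sigma> \<open>\<sigma> l = k\<close>)
  then show ?thesis by (simp add: mutated_variable_eq same(2))
qed

lemma cluster_mutation_eq:
  assumes y: "(y, C) \<in> seeds x B"
  shows "cluster_mutation x B (range y) (y k) = mutated_variable k y C"
  unfolding cluster_mutation_def
proof (rule the_equality)
  show "\<exists>x' B' l. (x', B') \<in> seeds x B \<and> range x' = range y \<and> x' l = y k \<and>
      mutated_variable k y C = mutated_variable l x' B'"
    using y by blast
next
  fix v
  assume "\<exists>x' B' l. (x', B') \<in> seeds x B \<and> range x' = range y \<and> x' l = y k \<and> v = mutated_variable l x' B'"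
  then show "v = mutated_variable k y C" using mutated_variable_same_cluster[OF y] by blast
qed

lemma cluster_variables_eq:
  assumes y: "(y, C) \<in> seeds x B"
  shows "cluster_variables x B = {cluster_along ms C y i | ms i. True}"
proof -
  have "cluster_variables x B = {z. \<exists>y' C' i. (y', C') \<in> seeds x B \<and> z = y' i}"
    by (auto simp: cluster_variables_def clusters_def)
  also have "\<dots> = {cluster_along ms C y i | ms i. True}"
  proof (intro equalityI subsetI)
    fix z assume "z \<in> {z. \<exists>y' C' i. (y', C') \<in> seeds x B \<and> z = y' i}"
    then obtain y' C' i where z: "(y', C') \<in> seeds x B" "z = y' i" by blast
    obtain ms where "y' = cluster_along ms C y" by (rule seed_connected[OF y z(1)])
    then show "z \<in> {cluster_along ms C y i | ms i. True}" using z(2) by blast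
  next
    fix z assume "z \<in> {cluster_along ms C y i | ms i. True}"
    then show "z \<in> {z. \<exists>y' C' i. (y', C') \<in> seeds x B \<and> z = y' i}"
      using seed_along[OF y] by blast
  qed
  finally show ?thesis .
qed

lemma cluster_variable_in_algebra: "cluster_variables x B \<subseteq> cluster_algebra x B"
  unfolding cluster_algebra_def by (rule hull_subset)

lemma seed_in_cluster_variables:
  assumes "(y, C) \<in> seeds x B" shows "y i \<in> cluster_variables x B"
  using assms by (auto simp: cluster_variables_def clusters_def)

text \<open>Two seeds with the same exchange matrix differ by a cluster automorphism: the field
  automorphism that matches the clusters commutes with all further mutations.\<close>

lemma ex_cluster_automorphism:
  assumes y: "(y, C) \<in> seeds x B" and y': "(y', C) \<in> seeds x B"
  obtains g where "g \<in> cluster_automorphisms x B" "\<And>i. g (y i) = y' i"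
proof -
  obtain f where f: "field_automorphism f" and fy: "\<And>i. f (y i) = y' i"
    using ex_field_automorphism[OF seed_props(1)[OF y] seed_props(1)[OF y']] by blast
  note simps = field_automorphism_simps[OF f]
  let ?V = "cluster_variables x B" and ?A = "cluster_algebra x B"
  have along: "f (cluster_along ms C y i) = cluster_along ms C y' i" for ms i
    by (rule field_automorphism_cluster_along[OF f fy])
  have fV: "f ` ?V = ?V"
  proof -
    have "f ` ?V = {cluster_along ms C y' i | ms i. True}"
      unfolding cluster_variables_eq[OF y] using along by (auto simp: image_iff) (metis along)
    then show ?thesis using cluster_variables_eq[OF y'] by simp
  qed
  have A: "is_subring ?A" unfolding cluster_algebra_def by (rule is_subring_hull)
  have VA: "?V \<subseteq> ?A" by (rule cluster_variable_in_algebra)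
  have fA: "f ` ?A = ?A"
  proof
    have "is_subring {a. f a \<in> ?A}"
      using A unfolding is_subring_def by (simp add: simps)
    moreover have "?V \<subseteq> {a. f a \<in> ?A}" using fV VA by blast
    ultimately have "?A \<subseteq> {a. f a \<in> ?A}"
      unfolding cluster_algebra_def[of x B] by (intro hull_minimal)
    then show "f ` ?A \<subseteq> ?A" by blast
    have "is_subring (f ` ?A)"
      unfolding is_subring_def
    proof (intro conjI ballI)
      show "1 \<in> f ` ?A" using A simps(2) unfolding is_subring_def by force
      fix a b assume "a \<in> f ` ?A" "b \<in> f ` ?A"
      then obtain c d where cd: "c \<in> ?A" "d \<in> ?A" "a = f c" "b = f d" by blast
      then have "c - d \<in> ?A" "c * d \<in> ?A" using A by (auto simp: is_subring_def)
      then show "a - b \<in> f ` ?A" "a * b \<in> f ` ?A" using cd(3,4) by (force simp: simps)+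
    qed
    moreover have "?V \<subseteq> f ` ?A" using fV VA by blast
    ultimately show "?A \<subseteq> f ` ?A"
      by (subst (1) cluster_algebra_def) (rule hull_minimal)
  qed
  define g where "g = restrict f ?A"
  have yA: "y i \<in> ?A" for i using seed_in_cluster_variables[OF y] VA by blast
  have gy: "g (y i) = y' i" for i using yA by (simp add: g_def fy)
  have "g \<in> ring_automorphisms ?A"
    unfolding ring_automorphisms_def
  proof (intro CollectI conjI ballI)
    show "g \<in> extensional ?A" by (simp add: g_def)
    have "bij_betw f ?A ?A" using fA inj_on_subset[OF simps(8) subset_UNIV] by (simp add: bij_betw_def)
    then show "bij_betw g ?A ?A" unfolding g_def by (subst bij_betw_restrict_eq)
    show "g 1 = 1" using A by (simp add: g_def simps is_subring_def)
    fix a b assume ab: "a \<in> ?A" "b \<in> ?A"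
    show "g (a + b) = g a + g b"
      using ab is_subring_add[OF A ab] by (simp add: g_def simps)
    show "g (a * b) = g a * g b"
      using ab is_subring_mult[OF A ab] by (simp add: g_def simps)
  qed
  moreover have "g ` range y = range y'" by (auto simp: gy image_image)
  moreover have "range y' \<in> clusters x B" using y' by (auto simp: clusters_def)
  moreover have "g (cluster_mutation x B (range y) u) = cluster_mutation x B (range y') (g u)"
    if ru: "u \<in> range y" for u
  proof -
    obtain k where u: "u = y k" using ru by blast
    have step: "mutated_variable k z C = cluster_along [k] C z k" for z :: "'n \<Rightarrow> 'a"
      by (simp add: cluster_step_def)
    have "mutated_variable k y C \<in> ?V"
      unfolding step by (rule seed_in_cluster_variables[OF seed_along[OF y]])
    then have "g (mutated_variable k y C) = f (mutated_variable k y C)"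
      using VA by (auto simp: g_def)
    also have "\<dots> = mutated_variable k y' C" unfolding step by (rule along)
    finally show ?thesis
      by (simp add: u gy cluster_mutation_eq[OF y] cluster_mutation_eq[OF y'])
  qed
  ultimately have "g \<in> cluster_automorphisms x B"
    unfolding cluster_automorphisms_def by (intro CollectI conjI bexI[OF _ y]) auto
  then show ?thesis using gy by (rule that)
qed

corollary finite_seeds_same_matrix:
  assumes "automorphism_finite x B" and y: "(y, C) \<in> seeds x B"
  shows "finite {y'. (y', C) \<in> seeds x B}"
proof (rule finite_subset)
  show "{y'. (y', C) \<in> seeds x B} \<subseteq> (\<lambda>g i. g (y i)) ` cluster_automorphisms x B"
  proof
    fix y' assume "y' \<in> {y'. (y', C) \<in> seeds x B}"
    then obtain g where g: "g \<in> cluster_automorphisms x B" "\<And>i. g (y i) = y' i"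
      using ex_cluster_automorphism[OF y] by blast
    have "y' = (\<lambda>i. g (y i))" using g(2) by auto
    then show "y' \<in> (\<lambda>g i. g (y i)) ` cluster_automorphisms x B" using g(1) by blast
  qed
qed (use assms(1) in \<open>simp add: automorphism_finite_def\<close>)

text \<open>An automorphism is determined by its values on one cluster: the elements at which two
  automorphisms agree form a ring that contains the cluster, and every element of the field is a
  quotient of two such elements.\<close>

lemma ring_automorphism_determined:
  assumes y: "(y, C) \<in> seeds x B"
    and f: "f \<in> ring_automorphisms (cluster_algebra x B)"
    and g: "g \<in> ring_automorphisms (cluster_algebra x B)"
    and eq: "\<And>i. f (y i) = g (y i)"
  shows "f = g"
proof -
  let ?A = "cluster_algebra x B"
  have A: "is_subring ?A" unfolding cluster_algebra_def by (rule is_subring_hull)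
  have zeroA: "0 \<in> ?A" by (rule is_subring_zero[OF A])
  have hom: "h 1 = 1" "h 0 = 0" "inj_on h ?A"
    "\<And>a b. a \<in> ?A \<Longrightarrow> b \<in> ?A \<Longrightarrow> h (a * b) = h a * h b"
    "\<And>a b. a \<in> ?A \<Longrightarrow> b \<in> ?A \<Longrightarrow> h (a - b) = h a - h b"
    if h: "h \<in> ring_automorphisms ?A" for h
  proof -
    show 1: "h 1 = 1" "inj_on h ?A" and mult: "\<And>a b. a \<in> ?A \<Longrightarrow> b \<in> ?A \<Longrightarrow> h (a * b) = h a * h b"
      using h by (auto simp: ring_automorphisms_def bij_betw_def)
    have add: "h (a + b) = h a + h b" if "a \<in> ?A" "b \<in> ?A" for a b
      using h that by (auto simp: ring_automorphisms_def)
    show "h 0 = 0" using add[OF zeroA zeroA] by simp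
    show "h (a - b) = h a - h b" if ab: "a \<in> ?A" "b \<in> ?A" for a b
    proof -
      have "a - b \<in> ?A" using A ab by (simp add: is_subring_def)
      from add[OF this ab(2)] show ?thesis by simp
    qed
  qed
  note F = hom[OF f] and G = hom[OF g]
  define E where "E = {a \<in> ?A. f a = g a}"
  have E: "is_subring E"
    using A F(1,4,5) G(1,4,5) by (auto simp: E_def is_subring_def)
  define Q where "Q = {a. \<exists>b c. b \<in> E \<and> c \<in> E \<and> c \<noteq> 0 \<and> a = b / c}"
  have "is_subfield Q"
    unfolding is_subfield_def is_subring_def
  proof (intro conjI ballI)
    have oneE: "1 \<in> E" using E by (simp add: is_subring_def)
    then show "1 \<in> Q" unfolding Q_def by force
    fix a assume "a \<in> Q"
    then obtain b c where bc: "b \<in> E" "c \<in> E" "c \<noteq> 0" "a = b / c" unfolding Q_def by blast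
    show "inverse a \<in> Q"
    proof (cases "b = 0")
      case True
      have "0 = (0::'a) / 1" "0 \<in> E" using is_subring_zero[OF E] by simp_all
      then have "0 \<in> Q" using oneE unfolding Q_def by (metis (mono_tags, lifting) mem_Collect_eq zero_neq_one)
      then show ?thesis using True bc by simp
    next
      case False
      then show ?thesis using bc unfolding Q_def by force
    qed
    fix d assume "d \<in> Q"
    then obtain b' c' where bc': "b' \<in> E" "c' \<in> E" "c' \<noteq> 0" "d = b' / c'" unfolding Q_def by blast
    have "b * c' - b' * c \<in> E" "c * c' \<in> E" "b * b' \<in> E" using E bc bc' by (auto simp: is_subring_def)
    moreover have "a - d = (b * c' - b' * c) / (c * c')" by (simp add: bc(3,4) bc'(3,4) diff_frac_eq)
    moreover have "a * d = (b * b') / (c * c')" using bc bc' by simp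
    moreover have "c * c' \<noteq> 0" using bc bc' by simp
    ultimately show "a - d \<in> Q" "a * d \<in> Q" unfolding Q_def by blast+
  qed
  moreover have "range y \<subseteq> Q"
  proof
    fix z assume "z \<in> range y"
    then obtain i where z: "z = y i" by blast
    have "y i \<in> E"
      using seed_in_cluster_variables[OF y, of i] cluster_variable_in_algebra eq by (auto simp: E_def)
    moreover have "1 \<in> E" using E by (simp add: is_subring_def)
    moreover have "z = y i / 1" using z by simp
    ultimately show "z \<in> Q" unfolding Q_def by (metis (mono_tags, lifting) mem_Collect_eq zero_neq_one)
  qed
  ultimately have Q: "Q = UNIV" by (rule subfield_of_free_generators[OF seed_props(1)[OF y]])
  show "f = g"
  proof
    fix a
    show "f a = g a"
    proof (cases "a \<in> ?A")
      case False
      then show ?thesis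
        using f g by (auto simp: ring_automorphisms_def extensional_def)
    next
      case True
      have "a \<in> Q" using Q by simp
      then obtain b c where bc: "b \<in> E" "c \<in> E" "c \<noteq> 0" "a = b / c" unfolding Q_def by blast
      have cA: "c \<in> ?A" and fc: "f c = g c" and fb: "f b = g b" using bc by (auto simp: E_def)
      have "a * c = b" using bc by simp
      then have "f a * f c = g a * g c" using F(4)[OF True cA] G(4)[OF True cA] fb by simp
      moreover have "g c \<noteq> 0"
        using inj_onD[OF G(3), of c 0] G(2) cA zeroA bc(3) by auto
      ultimately show ?thesis using fc by simp
    qed
  qed
qed

lemma automorphism_finite_if_finite_type:
  assumes "finite_type x B" shows "automorphism_finite x B"
proof -
  let ?V = "cluster_variables x B"
  let ?R = "ring_automorphisms (cluster_algebra x B)"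
  define T where "T = {t :: 'n \<Rightarrow> 'a. range t \<subseteq> ?V}"
  have T: "finite T"
  proof -
    have "T = (UNIV \<rightarrow>\<^sub>E ?V)" by (auto simp: T_def PiE_def extensional_def)
    then show ?thesis using assms by (simp add: finite_type_def finite_PiE)
  qed
  define S where "S = {y. \<exists>C. (y, C) \<in> seeds x B}"
  have ST: "S \<subseteq> T" using seed_in_cluster_variables by (auto simp: S_def T_def)
  have "cluster_automorphisms x B \<subseteq> (\<Union>y\<in>S. \<Union>t\<in>T. {f \<in> ?R. \<forall>i. f (y i) = t i})"
  proof
    fix f assume "f \<in> cluster_automorphisms x B"
    then obtain y C where f: "f \<in> ?R" "(y, C) \<in> seeds x B" "f ` range y \<in> clusters x B"
      unfolding cluster_automorphisms_def by blast
    then have "y \<in> S" by (auto simp: S_def)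
    moreover have "(\<lambda>i. f (y i)) \<in> T"
      using f(3) by (auto simp: T_def cluster_variables_def)
    ultimately show "f \<in> (\<Union>y\<in>S. \<Union>t\<in>T. {f \<in> ?R. \<forall>i. f (y i) = t i})" using f(1) by blast
  qed
  moreover have "finite {f \<in> ?R. \<forall>i. f (y i) = t i}" if y: "y \<in> S" for y t
  proof (cases "{f \<in> ?R. \<forall>i. f (y i) = t i} = {}")
    case True
    show ?thesis unfolding True by simp
  next
    case False
    obtain C where C: "(y, C) \<in> seeds x B" using y by (auto simp: S_def)
    obtain g where g: "g \<in> ?R" "\<forall>i. g (y i) = t i" using False by auto
    have "{f \<in> ?R. \<forall>i. f (y i) = t i} \<subseteq> {g}"
    proof
      fix f assume "f \<in> {f \<in> ?R. \<forall>i. f (y i) = t i}"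
      then have "f = g" using g by (intro ring_automorphism_determined[OF C]) auto
      then show "f \<in> {g}" by simp
    qed
    then show ?thesis by (rule finite_subset) simp
  qed
  then have "finite (\<Union>y\<in>S. \<Union>t\<in>T. {f \<in> ?R. \<forall>i. f (y i) = t i})"
    by (intro finite_UN_I T finite_subset[OF ST T])
  ultimately show ?thesis
    unfolding automorphism_finite_def by (rule finite_subset)
qed

text \<open>With finitely many matrices and infinitely many cluster variables, some matrix would occur in
  infinitely many labeled seeds, and hence there would be infinitely many automorphisms.\<close>

lemma finite_type_if_finite_mutation_type:
  assumes "automorphism_finite x B" "finite_mutation_type x B" shows "finite_type x B"
proof -
  define M where "M = {C. \<exists>y. (y, C) \<in> seeds x B}"
  have M: "finite M" using assms(2) by (simp add: finite_mutation_type_def M_def)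
  have fin: "finite {y. (y, C) \<in> seeds x B}" for C
  proof (cases "{y. (y, C) \<in> seeds x B} = {}")
    case True
    show ?thesis unfolding True by simp
  next
    case False
    then obtain y where "(y, C) \<in> seeds x B" by auto
    then show ?thesis by (rule finite_seeds_same_matrix[OF assms(1)])
  qed
  have "finite (\<Union>C\<in>M. \<Union>y\<in>{y. (y, C) \<in> seeds x B}. range y)"
    by (intro finite_UN_I M fin) simp
  moreover have "cluster_variables x B \<subseteq> (\<Union>C\<in>M. \<Union>y\<in>{y. (y, C) \<in> seeds x B}. range y)"
    by (auto simp: cluster_variables_def clusters_def M_def)
  ultimately show ?thesis unfolding finite_type_def by (rule rev_finite_subset)
qed

end

section \<open>The bipartite belt\<close>

definition bipartition :: "int ^ 'n ^ 'n \<Rightarrow> ('n \<Rightarrow> int) \<Rightarrow> bool" where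
  "bipartition B \<epsilon> \<longleftrightarrow> skew_symmetrizable B \<and> range \<epsilon> \<subseteq> {-1, 1} \<and>
     (\<forall>i j. B $ i $ j > 0 \<longrightarrow> \<epsilon> i = 1 \<and> \<epsilon> j = -1)"

lemma bipartition_signs:
  assumes "bipartition B \<epsilon>"
  shows "\<epsilon> j = 1 \<Longrightarrow> B $ i $ j \<le> 0" "\<epsilon> i = 1 \<Longrightarrow> B $ i $ j \<ge> 0"
    "\<epsilon> i = \<epsilon> j \<Longrightarrow> B $ i $ j = 0" "\<epsilon> i = 1 \<or> \<epsilon> i = -1"
proof -
  have sk: "skew_symmetrizable B" and pos: "\<And>i j. B $ i $ j > 0 \<Longrightarrow> \<epsilon> i = 1 \<and> \<epsilon> j = -1"
    and r: "range \<epsilon> \<subseteq> {-1, 1}"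
    using assms by (auto simp: bipartition_def)
  have neg: "\<epsilon> i = -1 \<and> \<epsilon> j = 1" if "B $ i $ j < 0" for i j
    using pos[of j i] that skew_symmetrizable_iffs(2)[OF sk, of j i] by simp
  show "\<epsilon> j = 1 \<Longrightarrow> B $ i $ j \<le> 0" using pos[of i j] by (cases "B $ i $ j > 0") auto
  show "\<epsilon> i = 1 \<Longrightarrow> B $ i $ j \<ge> 0" using neg[of i j] by (cases "B $ i $ j < 0") auto
  show "\<epsilon> i = \<epsilon> j \<Longrightarrow> B $ i $ j = 0"
    using pos[of i j] neg[of i j] by (cases "B $ i $ j" "0 :: int" rule: linorder_cases) auto
  show "\<epsilon> i = 1 \<or> \<epsilon> i = -1" using r by blast
qed

lemma bipartition_uminus:
  assumes "bipartition B \<epsilon>" shows "bipartition (- B) (\<lambda>i. - \<epsilon> i)"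
proof -
  have sk: "skew_symmetrizable B" using assms by (simp add: bipartition_def)
  have "\<epsilon> i = -1 \<and> \<epsilon> j = 1" if "B $ i $ j < 0" for i j
    using assms that skew_symmetrizable_iffs(2)[OF sk, of j i] by (auto simp: bipartition_def)
  moreover have "range (\<lambda>i. - \<epsilon> i) \<subseteq> {-1, 1}"
  proof
    fix e assume "e \<in> range (\<lambda>i. - \<epsilon> i)"
    then obtain i where "e = - \<epsilon> i" by blast
    then show "e \<in> {-1, 1}" using bipartition_signs(4)[OF assms, of i] by auto
  qed
  ultimately show ?thesis
    using skew_symmetrizable_uminus[OF sk] unfolding bipartition_def by simp
qed

text \<open>The matrix in the middle of a turn, after mutation at a set \<open>T\<close> of sources. No entry of \<open>B\<close>
  joins two sources, so each nonzero entry has changed its sign at most once.\<close>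

definition flip_signs :: "'n set \<Rightarrow> int ^ 'n ^ 'n \<Rightarrow> int ^ 'n ^ 'n" where
  "flip_signs T B = (\<chi> i j. if i \<in> T \<or> j \<in> T then - B $ i $ j else B $ i $ j)"

lemma matrix_mutation_flip_signs:
  assumes B: "bipartition B \<epsilon>" and T: "\<And>i. i \<in> T \<Longrightarrow> \<epsilon> i = 1" and k: "\<epsilon> k = 1" "k \<notin> T"
  shows "matrix_mutation k (flip_signs T B) = flip_signs (insert k T) B"
proof -
  note signs = bipartition_signs[OF B]
  have "matrix_mutation k (flip_signs T B) $ i $ j = flip_signs (insert k T) B $ i $ j" for i j
  proof (cases "i = k \<or> j = k")
    case True
    then show ?thesis
      using T[of i] T[of j] k signs(3)[of i j] by (auto simp: matrix_mutation_def flip_signs_def)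
  next
    case False
    have 1: "flip_signs T B $ i $ k \<le> 0"
      using T[of i] T[of k] k signs(1)[of k i] signs(3)[of i k] by (auto simp: flip_signs_def)
    have 2: "flip_signs T B $ k $ j \<ge> 0"
      using T[of j] T[of k] k signs(2)[of k j] signs(3)[of k j] by (auto simp: flip_signs_def)
    have "flip_signs T B $ i $ k * flip_signs T B $ k $ j \<le> 0"
      using 1 2 by (rule mult_nonpos_nonneg)
    then show ?thesis using False by (simp add: matrix_mutation_def pos_part_def flip_signs_def)
  qed
  then show ?thesis by (simp add: vec_eq_iff)
qed

text \<open>The result of mutating at all \<open>i\<close> with \<open>\<epsilon> i = 1\<close>. One of the two monomials in each exchange
  relation is 1, and the variables on the right do not change during the half turn.\<close>

definition half_step :: "('n \<Rightarrow> int) \<Rightarrow> int ^ 'n ^ 'n \<Rightarrow> ('n::finite \<Rightarrow> 'a::field_char_0) \<Rightarrow> 'n \<Rightarrow> 'a" where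
  "half_step \<epsilon> B y i = (if \<epsilon> i = 1 then (1 + (\<Prod>j\<in>UNIV. y j ^ nat \<bar>B $ j $ i\<bar>)) / y i else y i)"

lemma cluster_along_half_step:
  assumes B: "bipartition B \<epsilon>" and ls: "distinct ls" "\<And>i. i \<in> set ls \<Longrightarrow> \<epsilon> i = 1"
    and T: "\<And>i. i \<in> T \<Longrightarrow> \<epsilon> i = 1" "set ls \<inter> T = {}"
  shows "matrix_along ls (flip_signs T B) = flip_signs (T \<union> set ls) B"
    and "cluster_along ls (flip_signs T B) y i =
      (if i \<in> set ls then (1 + (\<Prod>j\<in>UNIV. y j ^ nat \<bar>B $ j $ i\<bar>)) / y i else y i)"
  using ls T
proof (induction ls arbitrary: T y)
  case (Cons k ls)
  note signs = bipartition_signs[OF B]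
  {
    case 1
    then show ?case
      using Cons.IH(1)[of "insert k T"] matrix_mutation_flip_signs[OF B, of T k] by auto
  next
    case 2
    have k: "\<epsilon> k = 1" "k \<notin> T" using 2 by auto
    have col: "flip_signs T B $ j $ k = B $ j $ k" for j
      using k 2(3)[of j] signs(3)[of j k] by (auto simp: flip_signs_def)
    have "pos_part (B $ j $ k) = 0" "pos_part (- B $ j $ k) = \<bar>B $ j $ k\<bar>" for j
      using signs(1)[OF k(1), of j] by (auto simp: pos_part_def)
    then have "exchange_numerator k (flip_signs T B) y = 1 + (\<Prod>j\<in>UNIV. y j ^ nat \<bar>B $ j $ k\<bar>)"
      by (simp add: exchange_numerator_def col)
    moreover define z where "z = cluster_step k (flip_signs T B) y"
    ultimately have z: "z j = (if j = k then (1 + (\<Prod>j\<in>UNIV. y j ^ nat \<bar>B $ j $ k\<bar>)) / y k else y j)" for j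
      by (simp add: cluster_step_def mutated_variable_eq)
    have "(\<Prod>j\<in>UNIV. z j ^ nat \<bar>B $ j $ i\<bar>) = (\<Prod>j\<in>UNIV. y j ^ nat \<bar>B $ j $ i\<bar>)" if "i \<in> set ls"
    proof (rule prod.cong[OF refl])
      fix j
      have "B $ k $ i = 0" using 2(2)[of i] k that signs(3)[of k i] by simp
      then show "z j ^ nat \<bar>B $ j $ i\<bar> = y j ^ nat \<bar>B $ j $ i\<bar>" by (simp add: z)
    qed
    moreover have "k \<notin> set ls" using 2 by simp
    moreover have "cluster_along ls (flip_signs (insert k T) B) z i
        = (if i \<in> set ls then (1 + (\<Prod>j\<in>UNIV. z j ^ nat \<bar>B $ j $ i\<bar>)) / z i else z i)"
      by (rule Cons.IH(2)) (use 2 k in auto)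
    moreover have "cluster_along (k # ls) (flip_signs T B) y = cluster_along ls (flip_signs (insert k T) B) z"
      using matrix_mutation_flip_signs[OF B 2(3) k] by (simp add: z_def)
    ultimately show ?case using z[of i] by auto
  }
qed simp_all

lemma flip_signs_empty: "flip_signs {} B = B"
  by (simp add: flip_signs_def vec_eq_iff)

lemma flip_signs_all:
  assumes "bipartition B \<epsilon>" shows "flip_signs {i. \<epsilon> i = 1} B = - B"
proof -
  have "(if \<epsilon> i = 1 \<or> \<epsilon> j = 1 then - B $ i $ j else B $ i $ j) = - B $ i $ j" for i j
    using bipartition_signs(3,4)[OF assms] by (metis minus_zero)
  then show ?thesis by (simp add: flip_signs_def vec_eq_iff)
qed

lemma half_step_along:
  assumes "bipartition B \<epsilon>" "distinct ls" "set ls = {i. \<epsilon> i = 1}"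
  shows "matrix_along ls B = - B" "cluster_along ls B y = half_step \<epsilon> B y"
proof -
  have ls: "\<And>i. i \<in> set ls \<Longrightarrow> \<epsilon> i = 1" "\<And>i. i \<in> {} \<Longrightarrow> \<epsilon> i = 1" "set ls \<inter> {} = {}"
    using assms(3) by auto
  note * = cluster_along_half_step[OF assms(1,2) ls, unfolded flip_signs_empty]
  show "matrix_along ls B = - B"
    using *(1) flip_signs_all[OF assms(1)] by (simp add: assms(3))
  show "cluster_along ls B y = half_step \<epsilon> B y"
    using *(2)[of y] by (auto simp: half_step_def assms(3))
qed

text \<open>One full turn around the belt mutates at all sources and then at all sinks. It returns to the
  same matrix, and the variables before and after the turn satisfy the same two-term relation at
  sources and at sinks, except for the time at which the neighbours are read off.\<close>

lemma ex_belt: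
  assumes B: "bipartition B \<epsilon>"
  obtains ls where "matrix_along ls B = B"
    "\<And>(y :: 'n::finite \<Rightarrow> real) i. pos y \<Longrightarrow> cluster_along ls B y i * y i =
      1 + (\<Prod>j\<in>UNIV. (if \<epsilon> i = 1 then y j else cluster_along ls B y j) ^ nat \<bar>B $ j $ i\<bar>)"
proof -
  obtain ps where ps: "distinct ps" "set ps = {i. \<epsilon> i = 1}"
    using finite_distinct_list[of "{i. \<epsilon> i = 1}"] by auto
  obtain ms where ms: "distinct ms" "set ms = {i. - \<epsilon> i = 1}"
    using finite_distinct_list[of "{i. - \<epsilon> i = 1}"] by auto
  note P = half_step_along[OF B ps]
  note N = half_step_along[OF bipartition_uminus[OF B] ms]
  note signs = bipartition_signs[OF B]
  let ?Y = "\<lambda>y. half_step (\<lambda>i. - \<epsilon> i) (- B) (half_step \<epsilon> B y)"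
  have Y: "cluster_along (ps @ ms) B y = ?Y y" for y :: "'n \<Rightarrow> real"
    by (simp add: cluster_along_append P N)
  have "?Y y i * y i = 1 + (\<Prod>j\<in>UNIV. (if \<epsilon> i = 1 then y j else ?Y y j) ^ nat \<bar>B $ j $ i\<bar>)"
    if "pos y" for y :: "'n \<Rightarrow> real" and i
  proof (cases "\<epsilon> i = 1")
    case True
    then show ?thesis using that by (simp add: half_step_def less_imp_neq[symmetric])
  next
    case False
    then have i: "\<epsilon> i = -1" using signs(4) by blast
    have "(\<Prod>j\<in>UNIV. half_step \<epsilon> B y j ^ nat \<bar>B $ j $ i\<bar>) = (\<Prod>j\<in>UNIV. ?Y y j ^ nat \<bar>B $ j $ i\<bar>)"
    proof (rule prod.cong[OF refl])
      fix j
      show "half_step \<epsilon> B y j ^ nat \<bar>B $ j $ i\<bar> = ?Y y j ^ nat \<bar>B $ j $ i\<bar>"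
      proof (cases "\<epsilon> j = 1")
        case True
        then have "?Y y j = half_step \<epsilon> B y j" by (simp add: half_step_def[of "\<lambda>i. - \<epsilon> i"])
        then show ?thesis by simp
      next
        case False
        then have "B $ j $ i = 0" using i signs(3,4) by metis
        then show ?thesis by simp
      qed
    qed
    moreover have "?Y y i * y i = 1 + (\<Prod>j\<in>UNIV. half_step \<epsilon> B y j ^ nat \<bar>B $ j $ i\<bar>)"
      using i that by (simp add: half_step_def[of "\<lambda>i. - \<epsilon> i"])
        (simp add: half_step_def less_imp_neq[symmetric])
    ultimately show ?thesis using False by simp
  qed
  moreover have "matrix_along (ps @ ms) B = B"
    by (simp add: matrix_along_append P N)
  ultimately show ?thesis using that[of "ps @ ms"] unfolding Y by blast
qed

subsection \<open>A periodic belt contains all cluster variables\<close>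

text \<open>This is the maximum principle for a generalized Cartan matrix \<open>2 - c\<close> with a positive vector
  that it maps to a positive vector: compare \<open>S\<close> with \<open>\<Lambda>\<close> at an index where the ratio is largest.\<close>

lemma subharmonic_zero:
  fixes c :: "'n::finite \<Rightarrow> 'n \<Rightarrow> real"
  assumes c: "\<And>i j. c i j \<ge> 0" and L: "\<And>i. L i > 0" "\<And>i. (\<Sum>j\<in>UNIV. c i j * L j) < 2 * L i"
    and S: "\<And>i. S i \<ge> 0" "\<And>i. 2 * S i \<le> (\<Sum>j\<in>UNIV. c i j * S j)"
  shows "S i = 0"
proof -
  let ?R = "range (\<lambda>i. S i / L i)"
  have "Max ?R \<in> ?R" by (rule Max_in) auto
  then obtain k where k: "Max ?R = S k / L k" by blast
  have le: "S j \<le> S k / L k * L j" for j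
  proof -
    have "S j / L j \<le> S k / L k" unfolding k[symmetric] by (rule Max_ge) auto
    then show ?thesis using L(1)[of j] by (simp add: pos_divide_le_eq)
  qed
  have "\<not> S k > 0"
  proof
    assume "S k > 0"
    have "2 * S k \<le> (\<Sum>j\<in>UNIV. c k j * S j)" by (rule S(2))
    also have "\<dots> \<le> (\<Sum>j\<in>UNIV. c k j * (S k / L k * L j))"
      by (intro sum_mono mult_left_mono le c)
    also have "\<dots> = S k / L k * (\<Sum>j\<in>UNIV. c k j * L j)"
      by (simp add: sum_distrib_left mult.left_commute)
    also have "\<dots> < S k / L k * (2 * L k)"
      using \<open>S k > 0\<close> L(1)[of k] by (intro mult_strict_left_mono L(2)) simp
    also have "\<dots> = 2 * S k" using L(1)[of k] by simp
    finally show False by simp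
  qed
  then have "S k = 0" using S(1)[of k] by simp
  then show ?thesis using le[of i] S(1)[of i] by simp
qed

text \<open>The origin is a fixed point of tropical mutation.\<close>

lemma growth_zero_along:
  assumes "\<And>i. growth w (\<lambda>r. p r i) 0"
  shows "growth w (\<lambda>r. cluster_along ks B (p r) i) 0"
  using assms
proof (induction ks arbitrary: B p)
  case (Cons k ks)
  have "growth w (\<lambda>r. cluster_step k B (p r) i) 0" for i
    using growth_cluster_step[of w p "\<lambda>_. 0" k B i] Cons.prems by (cases "i = k") simp_all
  from Cons.IH[of "\<lambda>r. cluster_step k B (p r)", OF this] show ?case by simp
qed simp

text \<open>A solution of a belt recurrence that takes the same values at the times \<open>N\<close> and \<open>M\<close> can be
  summed over the times in between.\<close>

lemma periodic_sum:
  fixes L :: "nat \<Rightarrow> 'n::finite \<Rightarrow> real"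
  assumes "N \<le> M" "\<And>i. L N i = L M i" "\<And>n i. N \<le> n \<Longrightarrow> n < M \<Longrightarrow> L (Suc n) i + L n i = g n i"
  shows "2 * (\<Sum>n=N..<M. L n i) = (\<Sum>n=N..<M. g n i)"
    and "(\<Sum>n=N..<M. \<Sum>j\<in>UNIV. c j * L (if b then n else Suc n) j) = (\<Sum>j\<in>UNIV. c j * (\<Sum>n=N..<M. L n j))"
proof -
  have shift: "(\<Sum>n=N..<M. L (Suc n) j) = (\<Sum>n=N..<M. L n j)" for j
  proof -
    have "(\<Sum>n=N..<M. L (Suc n) j - L n j) = L M j - L N j" by (rule sum_Suc_diff'[OF assms(1)])
    then show ?thesis unfolding sum_subtractf using assms(2)[of j] by linarith
  qed
  have "(\<Sum>n=N..<M. g n i) = (\<Sum>n=N..<M. L (Suc n) i + L n i)"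
    by (rule sum.cong) (use assms(3) in auto)
  then show "2 * (\<Sum>n=N..<M. L n i) = (\<Sum>n=N..<M. g n i)"
    unfolding sum.distrib shift by linarith
  have "(\<Sum>n=N..<M. \<Sum>j\<in>UNIV. c j * L (if b then n else Suc n) j)
      = (\<Sum>j\<in>UNIV. \<Sum>n=N..<M. c j * L (if b then n else Suc n) j)"
    by (rule sum.swap)
  also have "\<dots> = (\<Sum>j\<in>UNIV. c j * (\<Sum>n=N..<M. L n j))"
    by (cases b) (simp_all only: if_True if_False sum_distrib_left[symmetric] shift)
  finally show "(\<Sum>n=N..<M. \<Sum>j\<in>UNIV. c j * L (if b then n else Suc n) j)
      = (\<Sum>j\<in>UNIV. c j * (\<Sum>n=N..<M. L n j))" .
qed

text \<open>Suppose that the belt is periodic, and let \<open>y\<^sub>k\<close> be any cluster variable. The vanishing orders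
  of the belt variables along \<open>y\<^sub>k = 0\<close> satisfy the tropical form of the belt recurrence. If none were
  positive, then their negated sums \<open>S\<close> over a period would satisfy \<open>2S\<^sub>i = \<Sum>\<^sub>j |b\<^sub>j\<^sub>i| S\<^sub>j\<close>, whereas the
  sums of the logarithms of the belt variables at a point satisfy the opposite strict inequality. So
  all orders would vanish, which is absurd as \<open>y\<^sub>k\<close> is a rational function of the belt variables.\<close>

lemma belt_variable_vanishing:
  fixes C B :: "int ^ 'n ^ 'n" and k :: "'n::finite" and X :: "nat \<Rightarrow> ('n \<Rightarrow> real) \<Rightarrow> 'n \<Rightarrow> real"
  assumes C: "skew_symmetrizable C" and "N < M"
    and X: "\<And>n q. X n q = cluster_along (path n) C q"
    and per: "\<And>q i. pos q \<Longrightarrow> X N q i = X M q i"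
    and rel: "\<And>n q i. pos q \<Longrightarrow> X (Suc n) q i * X n q i =
      1 + (\<Prod>j\<in>UNIV. X (if \<epsilon> i = 1 then n else Suc n) q j ^ nat \<bar>B $ j $ i\<bar>)"
  obtains n i e where "n \<le> M" "e > 0" "growth (unit_vec k) (\<lambda>q. X n q i) e"
proof (rule ccontr)
  assume no: "\<not> thesis"
  note witness = that
  have Xpos: "X n q i > 0" if "pos q" for n q i
    using cluster_along_pos[OF that] by (simp add: X)
  have "\<exists>e. growth (unit_vec k) (\<lambda>q. X n q i) e" for n i
  proof -
    obtain e where "growth (unit_vec k) (\<lambda>q. cluster_along (path n) C q i) e"
      by (rule growth_cluster_variable)
    then show ?thesis unfolding X by blast
  qed
  then obtain E where E: "\<And>n i. growth (unit_vec k) (\<lambda>q. X n q i) (E n i)" by metis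
  have le: "E n i \<le> 0" if nM: "n \<le> M" for n i
  proof (rule ccontr)
    assume "\<not> E n i \<le> 0"
    then have "thesis" by (intro witness[OF nM _ E[of n i]]) simp
    then show False using no by simp
  qed
  define c where "c = (\<lambda>i j. real (nat \<bar>B $ j $ i\<bar>))"
  define t where "t = (\<lambda>i n. if \<epsilon> i = 1 then n else Suc n)"
  (* Logarithms at the point all of whose coordinates are 1. *)
  define L where "L = (\<lambda>n i. ln (X n (\<lambda>_. 1) i))"
  define P where "P = (\<lambda>n i. \<Prod>j\<in>UNIV. X (t i n) (\<lambda>_. 1) j ^ nat \<bar>B $ j $ i\<bar>)"
  have one: "pos (\<lambda>_::'n. 1::real)" by simp
  have P: "P n i > 0" for n i unfolding P_def by (intro prod_pos zero_less_power Xpos[OF one]) 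
  have Lrel: "L (Suc n) i + L n i = ln (1 + P n i)" for n i
  proof -
    have "L (Suc n) i + L n i = ln (X (Suc n) (\<lambda>_. 1) i * X n (\<lambda>_. 1) i)"
      unfolding L_def by (rule ln_mult_pos[symmetric]) (rule Xpos[OF one])+
    also have "X (Suc n) (\<lambda>_. 1) i * X n (\<lambda>_. 1) i = 1 + P n i"
      unfolding P_def t_def by (rule rel[OF one])
    finally show ?thesis .
  qed
  have Lper: "L N i = L M i" for i by (simp add: L_def per[OF one])
  define \<Lambda> where "\<Lambda> = (\<lambda>i. \<Sum>n=N..<M. L n i)"
  have \<Lambda>: "2 * \<Lambda> i = (\<Sum>n=N..<M. ln (1 + P n i))" for i
    unfolding \<Lambda>_def using \<open>N < M\<close> by (intro periodic_sum(1) Lper Lrel) simp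
  have \<Lambda>pos: "\<Lambda> i > 0" for i
  proof -
    have "(\<Sum>n=N..<M. ln (1 + P n i)) > 0"
      using \<open>N < M\<close> P by (intro sum_pos) (auto intro!: ln_gt_zero)
    then show ?thesis using \<Lambda>[of i] by simp
  qed
  have \<Lambda>less: "(\<Sum>j\<in>UNIV. c i j * \<Lambda> j) < 2 * \<Lambda> i" for i
  proof -
    have lnP: "ln (P n i) = (\<Sum>j\<in>UNIV. c i j * L (t i n) j)" for n
      unfolding P_def L_def c_def
      using Xpos[OF one] by (subst ln_prod) (auto simp: ln_realpow less_imp_neq[OF Xpos[OF one], symmetric])
    have "(\<Sum>j\<in>UNIV. c i j * \<Lambda> j) = (\<Sum>n=N..<M. \<Sum>j\<in>UNIV. c i j * L (t i n) j)"
      unfolding \<Lambda>_def t_def using \<open>N < M\<close>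
      by (intro periodic_sum(2)[symmetric, where g = "\<lambda>n i. ln (1 + P n i)"] Lper Lrel) simp
    also have "\<dots> = (\<Sum>n=N..<M. ln (P n i))" by (simp add: lnP)
    also have "\<dots> < (\<Sum>n=N..<M. ln (1 + P n i))"
    proof (rule sum_strict_mono)
      fix n
      have "P n i < 1 + P n i" "0 < 1 + P n i" using P[of n i] by linarith+
      then show "ln (P n i) < ln (1 + P n i)" using P[of n i] by simp
    qed (use \<open>N < M\<close> in auto)
    finally show ?thesis using \<Lambda>[of i] by simp
  qed
  (* Vanishing orders along the k-th coordinate, with reversed sign. *)
  define D where "D = (\<lambda>n i. real_of_int (- E n i))"
  have Erel: "E (Suc n) i + E n i = min 0 (\<Sum>j\<in>UNIV. int (nat \<bar>B $ j $ i\<bar>) * E (t i n) j)" for n i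
  proof -
    have "growth (unit_vec k) (\<lambda>q. 1 + (\<Prod>j\<in>UNIV. X (t i n) q j ^ nat \<bar>B $ j $ i\<bar>))
        (min 0 (\<Sum>j\<in>UNIV. int (nat \<bar>B $ j $ i\<bar>) * E (t i n) j))"
      by (intro growth_add growth_one growth_prod growth_power E)
    then have "growth (unit_vec k) (\<lambda>q. X (Suc n) q i * X n q i)
        (min 0 (\<Sum>j\<in>UNIV. int (nat \<bar>B $ j $ i\<bar>) * E (t i n) j))"
      by (rule growth_cong) (simp add: rel t_def)
    with growth_mult[OF E E] show ?thesis by (rule growth_unique)
  qed
  have "E N i = E M i" for i
    using growth_cong[OF E[of N i], of "\<lambda>q. X M q i"] per E[of M i] growth_unique by blast
  then have Dper: "D N i = D M i" for i by (simp add: D_def)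
  have Drel: "D (Suc n) i + D n i = (\<Sum>j\<in>UNIV. c i j * D (t i n) j)" if "N \<le> n" "n < M" for n i
  proof -
    have "t i n \<le> M" using that by (auto simp: t_def)
    then have "(\<Sum>j\<in>UNIV. int (nat \<bar>B $ j $ i\<bar>) * E (t i n) j) \<le> 0"
      using le by (intro sum_nonpos mult_nonneg_nonpos) auto
    then have "E (Suc n) i + E n i = (\<Sum>j\<in>UNIV. int (nat \<bar>B $ j $ i\<bar>) * E (t i n) j)"
      using Erel[of n i] by simp
    then have "real_of_int (E (Suc n) i + E n i)
        = (\<Sum>j\<in>UNIV. c i j * real_of_int (E (t i n) j))"
      by (simp add: c_def)
    then show ?thesis by (simp add: D_def sum_negf)
  qed
  define S where "S = (\<lambda>i. \<Sum>n=N..<M. D n i)"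
  have "2 * S i = (\<Sum>j\<in>UNIV. c i j * S j)" for i
  proof -
    have "2 * S i = (\<Sum>n=N..<M. \<Sum>j\<in>UNIV. c i j * D (t i n) j)"
      unfolding S_def using \<open>N < M\<close> by (intro periodic_sum(1) Dper Drel) simp_all
    also have "\<dots> = (\<Sum>j\<in>UNIV. c i j * S j)"
      unfolding S_def t_def using \<open>N < M\<close>
      by (intro periodic_sum(2)[where g = "\<lambda>n i. \<Sum>j\<in>UNIV. c i j * D (t i n) j"] Dper Drel) simp_all
    finally show ?thesis .
  qed
  moreover have D0: "D n i \<ge> 0" if "n \<le> M" for n i using le[OF that] by (simp add: D_def)
  then have "S i \<ge> 0" for i unfolding S_def by (intro sum_nonneg) simp
  ultimately have S: "S i = 0" for i
    using \<Lambda>pos \<Lambda>less by (intro subharmonic_zero[of c \<Lambda> S]) (auto simp: c_def)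
  have "D N i = 0" for i
  proof -
    have "D N i \<le> S i" unfolding S_def using D0 \<open>N < M\<close> by (intro member_le_sum) auto
    then show ?thesis using S[of i] D0[of N i] \<open>N < M\<close> by simp
  qed
  then have "growth (unit_vec k) (\<lambda>q. X N q i) 0" for i using E[of N i] by (simp add: D_def)
  then have "growth (unit_vec k)
      (\<lambda>q. cluster_along (rev (path N)) (matrix_along (path N) C) (X N q) k) 0"
    by (rule growth_zero_along)
  then have "growth (unit_vec k) (\<lambda>q. q k) 0"
    by (rule growth_cong) (simp add: X cluster_along_rev_pos[OF C])
  from growth_unique[OF this growth_coord] show False by (simp add: unit_vec_def)
qed

text \<open>Turns around the belt produce seeds with the matrix \<open>B\<close>. If there are only finitely many, the
  belt is periodic, and every cluster variable is one of the finitely many belt variables.\<close>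

lemma finite_type_if_bipartite:
  fixes x :: "'n::finite \<Rightarrow> 'a::field_char_0" and B :: "int ^ 'n ^ 'n"
  assumes xB: "labeled_seed x B" and "bipartite B" and fin: "automorphism_finite x B"
  shows "finite_type x B"
proof -
  have "skew_symmetrizable B" using xB by (simp add: labeled_seed_def)
  then obtain \<epsilon> where \<epsilon>: "bipartition B \<epsilon>"
    using assms(2) unfolding bipartite_def bipartition_def by blast
  obtain ls where ls: "matrix_along ls B = B"
    and rel: "\<And>(y :: 'n \<Rightarrow> real) i. pos y \<Longrightarrow> cluster_along ls B y i * y i =
      1 + (\<Prod>j\<in>UNIV. (if \<epsilon> i = 1 then y j else cluster_along ls B y j) ^ nat \<bar>B $ j $ i\<bar>)"
    using ex_belt[OF \<epsilon>] by blast
  define turns where "turns = (\<lambda>n. ((\<lambda>ks. ks @ ls) ^^ n) [])"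
  have turns: "turns (Suc n) = turns n @ ls" for n by (simp add: turns_def)
  have mat: "matrix_along (turns n) B = B" for n
  proof (induction n)
    case (Suc n)
    then show ?case unfolding turns matrix_along_append by (simp add: ls)
  qed (simp add: turns_def)
  define Y where "Y = (\<lambda>n. cluster_along (turns n) B x)"
  have xs: "(x, B) \<in> seeds x B" by (simp add: seeds_def)
  have Ys: "(Y n, B) \<in> seeds x B" for n
    using seed_along[OF xB xs, of "turns n"] by (simp add: Y_def mat)
  have "range Y \<subseteq> {y'. (y', B) \<in> seeds x B}" using Ys by blast
  then have "finite (range Y)" using finite_seeds_same_matrix[OF xB fin xs] by (rule finite_subset)
  then have "\<not> inj Y" using finite_imageD by auto
  then obtain a b where "a \<noteq> b" "Y a = Y b" by (auto simp: inj_on_def)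
  then obtain N M where NM: "N < M" "Y N = Y M" by (metis linorder_neqE_nat)
  have "cluster_variables x B \<subseteq> (\<Union>n\<in>{..M}. range (Y n))"
  proof
    fix z assume "z \<in> cluster_variables x B"
    then obtain y C k where yC: "(y, C) \<in> seeds x B" and z: "z = y k"
      by (auto simp: cluster_variables_def clusters_def)
    obtain ks where ks: "x = cluster_along ks C y" "B = matrix_along ks C"
      by (rule seed_connected[OF xB yC xs])
    note y = seed_props[OF xB yC]
    have Yy: "cluster_along (ks @ turns n) C y = Y n" for n
      by (simp add: cluster_along_append Y_def ks[symmetric])
    define X where "X = (\<lambda>n (q :: 'n \<Rightarrow> real). cluster_along (ks @ turns n) C q)"
    have Xpos: "pos (X n q)" if "pos q" for n q
      unfolding X_def by (rule cluster_along_pos[OF that])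
    have Suc: "X (Suc n) q = cluster_along ls B (X n q)" for n q
      by (simp add: X_def turns cluster_along_append matrix_along_append ks(2)[symmetric] mat)
    have per: "X N q i = X M q i" if "pos q" for q i
    proof -
      have "cluster_along (ks @ turns N) C y i = cluster_along (ks @ turns M) C y i"
        by (simp add: Yy NM(2))
      then show ?thesis using that unfolding cluster_variable_eq_iff[OF y(2)] X_def by blast
    qed
    have Xrel: "X (Suc n) q i * X n q i =
        1 + (\<Prod>j\<in>UNIV. X (if \<epsilon> i = 1 then n else Suc n) q j ^ nat \<bar>B $ j $ i\<bar>)"
      if "pos q" for n q i
      using rel[OF Xpos[OF that], of n i] by (cases "\<epsilon> i = 1") (simp_all add: Suc)
    have Xpath: "X n q = cluster_along (ks @ turns n) C q" for n q by (simp add: X_def)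
    obtain n i e where n: "n \<le> M" "e > 0" "growth (unit_vec k) (\<lambda>q. X n q i) e"
      by (rule belt_variable_vanishing[OF y(3) NM(1) Xpath per Xrel, of k])
    have "cluster_along (ks @ turns n) C q i = q k" if "pos q" for q
      by (rule cluster_variable_vanishing[OF y(3) n(3)[unfolded X_def] n(2) that])
    then have "cluster_along (ks @ turns n) C y i = cluster_along [] C y k"
      unfolding cluster_variable_eq_iff[OF y(2)] by simp
    then have "z = Y n i" by (simp add: Yy z)
    then show "z \<in> (\<Union>n\<in>{..M}. range (Y n))" using n(1) by blast
  qed
  then show ?thesis unfolding finite_type_def by (rule finite_subset) simp
qed

theorem theorem4p6:
  fixes x :: "'n::finite \<Rightarrow> 'a::field_char_0" and B :: "int ^ 'n ^ 'n"
  assumes "labeled_seed x B" and "indecomposable B"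
    and "finite_mutation_type x B \<or> (indecomposable B \<and> bipartite B)"
  shows "automorphism_finite x B \<longleftrightarrow> finite_type x B"
  using automorphism_finite_if_finite_type[OF assms(1)]
    finite_type_if_finite_mutation_type[OF assms(1)] finite_type_if_bipartite[OF assms(1)] assms(3)
  by blast

end
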